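(* Let $T>0$, $d\ge1$, and let $b:[0,T]\times\mathbb{R}^d\times\mathcal{P}(\mathbb{R}^d)\to\mathbb{R}^d$ and $a:[0,T]\times\mathbb{R}^d\times\mathcal{P}(\mathbb{R}^d)\to\mathrm{Sym}_+(\mathbb{R}^{d\times d})$ be Borel measurable functions. Then the subset $\mathrm{MP}(b,a)\subset\mathcal{P}(C([0,T],\mathbb{R}^d))$ is Borel.
   Context: $\mathcal{P}(X)$: Borel probability measures on a Polish space $X$ with the narrow topology (Polish); $C([0,T],\mathbb{R}^d)$ has the uniform topology; $\mathrm{e}_t(\gamma)=\gamma_t$; $f_\sharp$ is push-forward. $\mathrm{Sym}_+(\mathbb{R}^{d\times d})$: symmetric positive semidefinite matrices; $A:B=\sum_{i,j}A_{ij}B_{ij}$; $b_t(x,\mu)=b(t,x,\mu)$, $a_t(x,\mu)=a(t,x,\mu)$. For $\phi\in C_b^2(\mathbb{R}^d)$ and $\lambda\in\mathcal{P}(C([0,T],\mathbb{R}^d))$: $L^\lambda_{b_t,a_t}\phi(x)=\frac12a_t(x,(\mathrm{e}_t)_\sharp\lambda):\nabla^2\phi(x)+b_t(x,(\mathrm{e}_t)_\sharp\lambda)\cdot\nabla\phi(x)$. $\mathrm{MP}(b,a)$ is the set of $\lambda\in\mathcal{P}(C([0,T],\mathbb{R}^d))$ such that $\int\int_0^T\frac{|b_t(\gamma_t,(\mathrm{e}_t)_\sharp\lambda)|}{1+|\gamma_t|}+\frac{|a_t(\gamma_t,(\mathrm{e}_t)_\sharp\lambda)|}{1+|\gamma_t|^2}dt\,d\lambda(\gamma)<\infty$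 and $\lambda$ solves the martingale problem associated to $L^\lambda_{b_t,a_t}$, i.e. for all $\xi\in C_c^1((0,T))$, $\phi\in C_c^2(\mathbb{R}^d)$, the process $t\mapsto\xi(t)\phi(\gamma_t)-\int_0^t\xi'(r)\phi(\gamma_r)+\xi(r)L^\lambda_{b_r,a_r}\phi(\gamma_r)dr$ is a martingale on $(C([0,T],\mathbb{R}^d),(\mathcal{F}_t)_{t\in[0,T]},\lambda)$, $\mathcal{F}_t=\sigma(\mathrm{e}_r:r\in[0,t])$. *)

theory Defs
  imports "HOL-Analysis.Analysis" "HOL-Probability.Probability"
begin

definition borel_of :: "'a topology \<Rightarrow> 'a measure" where
  "borel_of X = sigma (topspace X) {U. openin X U}"

definition borel_prob :: "'a topology \<Rightarrow> 'a measure set" where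
  "borel_prob X = {\<mu>. prob_space \<mu> \<and> sets \<mu> = sets (borel_of X)}"

text \<open>The narrow topology is the coarsest one for which \<open>\<mu> \<mapsto> \<integral> f d\<mu>\<close> is continuous for every
  bounded continuous \<open>f\<close>.\<close>

definition narrow_topology :: "'a topology \<Rightarrow> 'a measure topology" where
  "narrow_topology X = topology_generated_by
     {{\<mu> \<in> borel_prob X. (LINT x|\<mu>. f x) \<in> U} | (f :: 'a \<Rightarrow> real) U.
        continuous_map X euclideanreal f \<and> bounded (f ` topspace X) \<and> open U}"

text \<open>A path on \<open>[0,T]\<close> is encoded as a function on the reals that takes the fixed value
  \<^term>\<open>undefined\<close> off \<open>[0,T]\<close> (this is how \<^const>\<open>cfunspace\<close> makes paths with the same
  restriction to \<open>[0,T]\<close> equal).\<close>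

definition path_topology :: "real \<Rightarrow> (real \<Rightarrow> real^'d) topology" where
  "path_topology T = mtopology_of (cfunspace (top_of_set {0..T}) euclidean_metric)"

definition time_marginal :: "(real \<Rightarrow> real^'d) measure \<Rightarrow> real \<Rightarrow> (real^'d) measure" where
  "time_marginal \<Lambda> t = distr \<Lambda> borel (\<lambda>\<gamma>. \<gamma> t)"

definition path_filtration :: "real \<Rightarrow> real \<Rightarrow> (real \<Rightarrow> real^'d) measure" where
  "path_filtration T t = sigma (topspace (path_topology T))
     {{\<gamma> \<in> topspace (path_topology T). \<gamma> r \<in> B} | r B. r \<in> {0..t} \<and> B \<in> sets borel}"

definition Sym_plus :: "(real^'d^'d) set" where
  "Sym_plus = {A. transpose A = A \<and> (\<forall>v. 0 \<le> v \<bullet> (A *v v))}"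

definition frob :: "real^'d^'d \<Rightarrow> real^'d^'d \<Rightarrow> real" where
  "frob A B = (\<Sum>i\<in>UNIV. \<Sum>j\<in>UNIV. A $ i $ j * B $ i $ j)"

definition grad :: "(real^'d \<Rightarrow> real) \<Rightarrow> real^'d \<Rightarrow> real^'d" where
  "grad \<phi> x = (\<chi> i. frechet_derivative \<phi> (at x) (axis i 1))"

definition hess :: "(real^'d \<Rightarrow> real) \<Rightarrow> real^'d \<Rightarrow> real^'d^'d" where
  "hess \<phi> x = (\<chi> i j. frechet_derivative (\<lambda>y. grad \<phi> y $ i) (at x) (axis j 1))"

text \<open>Elements of \<open>C\<^sub>c\<^sup>1((0,T))\<close> are represented by their extension by zero to the real line.\<close>

definition C1_compact_supp :: "real \<Rightarrow> (real \<Rightarrow> real) set" where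
  "C1_compact_supp T = {\<xi>. \<xi> C1_differentiable_on UNIV \<and>
     compact (closure {t. \<xi> t \<noteq> 0}) \<and> closure {t. \<xi> t \<noteq> 0} \<subseteq> {0<..<T}}"

definition C2_compact_supp :: "(real^'d \<Rightarrow> real) set" where
  "C2_compact_supp = {\<phi>. (\<forall>x. \<phi> differentiable (at x)) \<and> (\<forall>x. grad \<phi> differentiable (at x)) \<and>
     continuous_on UNIV (hess \<phi>) \<and> compact (closure {x. \<phi> x \<noteq> 0})}"

definition martingale_on ::
  "'a measure \<Rightarrow> real set \<Rightarrow> (real \<Rightarrow> 'a measure) \<Rightarrow> (real \<Rightarrow> 'a \<Rightarrow> real) \<Rightarrow> bool" where
  "martingale_on M I F X \<longleftrightarrow>
     (\<forall>t\<in>I. subalgebra M (F t)) \<and>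
     (\<forall>s\<in>I. \<forall>t\<in>I. s \<le> t \<longrightarrow> sets (F s) \<subseteq> sets (F t)) \<and>
     (\<forall>t\<in>I. X t \<in> borel_measurable (F t)) \<and>
     (\<forall>t\<in>I. integrable M (X t)) \<and>
     (\<forall>s\<in>I. \<forall>t\<in>I. s \<le> t \<longrightarrow> (AE \<omega> in M. real_cond_exp M (F s) (X t) \<omega> = X s \<omega>))"

definition gen ::
  "(real \<Rightarrow> real^'d \<Rightarrow> (real^'d) measure \<Rightarrow> real^'d) \<Rightarrow>
   (real \<Rightarrow> real^'d \<Rightarrow> (real^'d) measure \<Rightarrow> real^'d^'d) \<Rightarrow>
   (real \<Rightarrow> real^'d) measure \<Rightarrow> real \<Rightarrow> (real^'d \<Rightarrow> real) \<Rightarrow> real^'d \<Rightarrow> real" where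
  "gen b a \<Lambda> t \<phi> x =
     1/2 * frob (a t x (time_marginal \<Lambda> t)) (hess \<phi> x) + b t x (time_marginal \<Lambda> t) \<bullet> grad \<phi> x"

text \<open>The time integral is a Bochner integral, hence \<open>0\<close> on the paths for which the integrand is not
  integrable; the first condition in \<open>MP\<close> below makes these paths a null set.\<close>

definition mp_process ::
  "(real \<Rightarrow> real^'d \<Rightarrow> (real^'d) measure \<Rightarrow> real^'d) \<Rightarrow>
   (real \<Rightarrow> real^'d \<Rightarrow> (real^'d) measure \<Rightarrow> real^'d^'d) \<Rightarrow>
   (real \<Rightarrow> real^'d) measure \<Rightarrow> (real \<Rightarrow> real) \<Rightarrow> (real^'d \<Rightarrow> real) \<Rightarrow>
   real \<Rightarrow> (real \<Rightarrow> real^'d) \<Rightarrow> real" where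
  "mp_process b a \<Lambda> \<xi> \<phi> t \<gamma> = \<xi> t * \<phi> (\<gamma> t) -
     (LINT r:{0..t}|lborel. deriv \<xi> r * \<phi> (\<gamma> r) + \<xi> r * gen b a \<Lambda> r \<phi> (\<gamma> r))"

text \<open>The norm of \<open>a\<close> is the library norm of \<^typ>\<open>real^'d^'d\<close>, i.e. the Frobenius norm.\<close>

definition MP ::
  "real \<Rightarrow> (real \<Rightarrow> real^'d \<Rightarrow> (real^'d) measure \<Rightarrow> real^'d) \<Rightarrow>
   (real \<Rightarrow> real^'d \<Rightarrow> (real^'d) measure \<Rightarrow> real^'d^'d) \<Rightarrow>
   (real \<Rightarrow> real^'d) measure set" where
  "MP T b a = {\<Lambda> \<in> borel_prob (path_topology T).
     (\<integral>\<^sup>+\<gamma>. (\<integral>\<^sup>+t\<in>{0..T}. ennreal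
        (norm (b t (\<gamma> t) (time_marginal \<Lambda> t)) / (1 + norm (\<gamma> t)) +
         norm (a t (\<gamma> t) (time_marginal \<Lambda> t)) / (1 + (norm (\<gamma> t))\<^sup>2)) \<partial>lborel) \<partial>\<Lambda>) < \<infinity> \<and>
     (\<forall>\<xi>\<in>C1_compact_supp T. \<forall>\<phi>\<in>C2_compact_supp.
        martingale_on \<Lambda> {0..T} (path_filtration T) (mp_process b a \<Lambda> \<xi> \<phi>))}"

end

theory Submission
  imports Defs
begin

text \<open>
  The narrow topology of a separable metrizable space is second countable, so the Borel
  \<open>\<sigma>\<close>-algebra on \<open>[0,T] \<times> \<real>\<^sup>d \<times> \<P>(\<real>\<^sup>d)\<close> is the product one and the coefficients, evaluated along a
  path and its law's time marginals, are jointly measurable in law, path and time. Hence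
  \<open>\<Lambda> \<mapsto> \<integral> 1\<^sub>A X\<^sub>t d\<Lambda>\<close> is Borel for every process \<open>X\<close> of the martingale problem, and so is the set of
  laws satisfying the integrability condition. On that set the martingale property only has to be
  tested on countably many data: test functions from countable families in which every
  test function has an approximating sequence in \<open>C\<^sup>1\<close>, respectively in \<open>C\<^sup>2\<close> with a common bounded
  support, rational times \<open>s \<le> t\<close>, and events \<open>A\<close> from a countable
  \<open>\<pi>\<close>-system generating \<open>\<F>\<^sub>s\<close>. Dynkin's theorem and a dominated convergence argument, with
  the integrability condition as dominating function, recover all other data.
\<close>

section \<open>Borel sets of topological spaces\<close>

text \<open>A law enters the test integrals twice: as the measure that is integrated against, and
  through its time marginals inside \<open>b\<close> and \<open>a\<close>. Both are handled by
  regarding the law as a probability kernel from the space of laws to the space of paths. This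
  requires two comparisons of the narrow Borel structure with integrals: the mass that a law gives
  to a Borel set must depend measurably on the law, and a map into the space of marginals must be
  testable on integrals of bounded continuous functions alone. The processes must moreover be
  adapted. Joint measurability is therefore established over \<open>path_filtration T t\<close> in
  the path variable, and only afterwards enlarged to all Borel sets of paths. Two dominated
  convergences are nested, one in time along a fixed path and one over the law. Since
  \<open>s\<close>, \<open>t\<close> and even \<open>T\<close> may be irrational, rational times
  cannot simply replace them; the approximating times are chosen strictly between \<open>s\<close>
  and \<open>t\<close>, so that an event known at time \<open>s\<close> stays admissible and the
  interval \<open>{0..T}\<close> is never left.\<close>

lemma space_borel_of [simp]: "space (borel_of X) = topspace X"
  by (auto simp: borel_of_def space_measure_of_conv)

lemma sets_borel_of: "sets (borel_of X) = sigma_sets (topspace X) {U. openin X U}"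
  unfolding borel_of_def by (rule sets_measure_of) (auto dest: openin_subset)

lemma borel_of_euclidean [simp]: "borel_of euclidean = borel"
  by (simp add: borel_of_def borel_def)

lemma openin_in_sets_borel_of: "openin X U \<Longrightarrow> U \<in> sets (borel_of X)"
  by (simp add: sets_borel_of sigma_sets.Basic)

lemma measurable_into_borel_of:
  assumes "f \<in> space M \<rightarrow> topspace X"
    and "\<And>U. openin X U \<Longrightarrow> f -` U \<inter> space M \<in> sets M"
  shows "f \<in> M \<rightarrow>\<^sub>M borel_of X"
  by (rule measurable_sigma_sets[OF sets_borel_of]) (use assms in \<open>auto dest: openin_subset\<close>)

lemma borel_measurable_continuous_map:
  assumes "continuous_map X euclidean f"
  shows "f \<in> borel_measurable (borel_of X)"
proof -
  have "f -` U \<inter> topspace X \<in> sets (borel_of X)" if "open U" for U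
  proof -
    have "openin X {x \<in> topspace X. f x \<in> U}"
      using assms that by (simp add: continuous_map_def)
    moreover have "{x \<in> topspace X. f x \<in> U} = f -` U \<inter> topspace X"
      by auto
    ultimately show ?thesis
      by (metis openin_in_sets_borel_of)
  qed
  then show ?thesis
    by (auto intro: borel_measurableI)
qed

text \<open>Only those members of a countable base matter that fit inside some member of
  \<open>\<U>\<close>; they cover the same union, and one host in \<open>\<U>\<close> is chosen for
  each.\<close>

lemma second_countable_Lindelof:
  assumes "second_countable X" and "\<And>U. U \<in> \<U> \<Longrightarrow> openin X U"
  obtains \<V> where "countable \<V>" "\<V> \<subseteq> \<U>" "\<Union>\<V> = \<Union>\<U>"
proof -
  obtain \<B> where \<B>: "countable \<B>"
    "\<And>U x. openin X U \<Longrightarrow> x \<in> U \<Longrightarrow> \<exists>V\<in>\<B>. x \<in> V \<and> V \<subseteq> U"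
    using assms(1) unfolding second_countable_def by metis
  define \<D> where "\<D> = {B \<in> \<B>. \<exists>U\<in>\<U>. B \<subseteq> U}"
  have "\<forall>B\<in>\<D>. \<exists>U. U \<in> \<U> \<and> B \<subseteq> U"
    by (auto simp: \<D>_def)
  then obtain G where G: "\<And>B. B \<in> \<D> \<Longrightarrow> G B \<in> \<U> \<and> B \<subseteq> G B"
    using bchoice[of \<D> "\<lambda>B U. U \<in> \<U> \<and> B \<subseteq> U"] by metis
  have "\<Union>(G ` \<D>) = \<Union>\<U>"
  proof (rule subset_antisym)
    show "\<Union>\<U> \<subseteq> \<Union>(G ` \<D>)"
    proof
      fix x assume "x \<in> \<Union>\<U>"
      then obtain U where "U \<in> \<U>" "x \<in> U" by auto
      with \<B>(2) assms(2) obtain B where "B \<in> \<B>" "x \<in> B" "B \<subseteq> U" by metis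
      then have "B \<in> \<D>" using \<open>U \<in> \<U>\<close> by (auto simp: \<D>_def)
      with G \<open>x \<in> B\<close> show "x \<in> \<Union>(G ` \<D>)" by blast
    qed
  qed (use G in blast)
  moreover have "countable (G ` \<D>)"
    using \<B>(1) by (simp add: \<D>_def)
  ultimately show thesis
    using that G by blast
qed

lemma second_countable_prod_topology:
  assumes "second_countable X" and "second_countable Y"
  shows "second_countable (prod_topology X Y)"
proof -
  obtain \<B> where \<B>: "countable \<B>" "\<And>V. V \<in> \<B> \<Longrightarrow> openin X V"
    "\<And>U x. openin X U \<Longrightarrow> x \<in> U \<Longrightarrow> \<exists>V\<in>\<B>. x \<in> V \<and> V \<subseteq> U"
    using assms(1) unfolding second_countable_def by metis
  obtain \<C> where \<C>: "countable \<C>" "\<And>V. V \<in> \<C> \<Longrightarrow> openin Y V"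
    "\<And>U x. openin Y U \<Longrightarrow> x \<in> U \<Longrightarrow> \<exists>V\<in>\<C>. x \<in> V \<and> V \<subseteq> U"
    using assms(2) unfolding second_countable_def by metis
  let ?D = "(\<lambda>(B, C). B \<times> C) ` (\<B> \<times> \<C>)"
  have 1: "countable ?D" using \<B>(1) \<C>(1) by blast
  have 2: "\<forall>V\<in>?D. openin (prod_topology X Y) V"
    using \<B>(2) \<C>(2) by (auto simp: openin_prod_Times_iff)
  have 3: "\<exists>V\<in>?D. z \<in> V \<and> V \<subseteq> U" if U: "openin (prod_topology X Y) U" and "z \<in> U" for U z
  proof -
    obtain x y where z: "z = (x, y)" by (cases z)
    then have "(x, y) \<in> U" using that by simp
    then obtain V W where VW: "openin X V" "openin Y W" "x \<in> V" "y \<in> W" "V \<times> W \<subseteq> U"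
      using U unfolding openin_prod_topology_alt by meson
    obtain B C where "B \<in> \<B>" "x \<in> B" "B \<subseteq> V" "C \<in> \<C>" "y \<in> C" "C \<subseteq> W"
      using \<B>(3)[OF VW(1,3)] \<C>(3)[OF VW(2,4)] by auto
    then show ?thesis
      using VW(5) z by (intro bexI[of _ "B \<times> C"]) auto
  qed
  show ?thesis
    unfolding second_countable_def using 1 2 3 by (intro exI[of _ ?D]) auto
qed

lemma second_countable_euclidean:
  "second_countable (euclidean :: 'a::second_countable_topology topology)"
proof -
  obtain \<B> :: "'a set set" where "countable \<B>" "topological_basis \<B>"
    using ex_countable_basis by auto
  then show ?thesis
    unfolding second_countable_def
    by (metis open_openin topological_basisE topological_basis_open)
qed

text \<open>Preimages of open rectangles are measurable, but an open set is an arbitrary union of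
  them. Second countability makes a countable subunion suffice, so the Borel sets of the product
  topology are no more than those of the product \<sigma>-algebra.\<close>

lemma measurable_Pair_borel_of:
  assumes "second_countable X" and "second_countable Y"
    and f: "f \<in> M \<rightarrow>\<^sub>M borel_of X" and g: "g \<in> M \<rightarrow>\<^sub>M borel_of Y"
  shows "(\<lambda>\<omega>. (f \<omega>, g \<omega>)) \<in> M \<rightarrow>\<^sub>M borel_of (prod_topology X Y)"
proof (rule measurable_into_borel_of)
  show "(\<lambda>\<omega>. (f \<omega>, g \<omega>)) \<in> space M \<rightarrow> topspace (prod_topology X Y)"
    using measurable_space[OF f] measurable_space[OF g] by auto
  fix U assume U: "openin (prod_topology X Y) U"
  define \<U> where "\<U> = {V \<times> W | V W. openin X V \<and> openin Y W \<and> V \<times> W \<subseteq> U}"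
  have "openin (prod_topology X Y) R" if "R \<in> \<U>" for R
    using that by (auto simp: \<U>_def openin_prod_Times_iff)
  then obtain \<V> where \<V>: "countable \<V>" "\<V> \<subseteq> \<U>" "\<Union>\<V> = \<Union>\<U>"
    using second_countable_Lindelof[OF second_countable_prod_topology[OF assms(1,2)]] by metis
  have "\<Union>\<U> = U"
  proof
    show "U \<subseteq> \<Union>\<U>"
    proof
      fix z assume "z \<in> U"
      then have "(fst z, snd z) \<in> U" by simp
      then obtain V W where "openin X V" "openin Y W" "fst z \<in> V" "snd z \<in> W" "V \<times> W \<subseteq> U"
        using U unfolding openin_prod_topology_alt by meson
      then show "z \<in> \<Union>\<U>"
        unfolding \<U>_def by (intro UnionI[of "V \<times> W"]) (auto simp: mem_Times_iff)
    qed
  qed (auto simp: \<U>_def)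
  then have eq: "(\<lambda>\<omega>. (f \<omega>, g \<omega>)) -` U \<inter> space M = (\<Union>R\<in>\<V>. (\<lambda>\<omega>. (f \<omega>, g \<omega>)) -` R \<inter> space M)"
    using \<V>(3) by blast
  have "(\<lambda>\<omega>. (f \<omega>, g \<omega>)) -` R \<inter> space M \<in> sets M" if R: "R \<in> \<V>" for R
  proof -
    obtain V W where RVW: "R = V \<times> W" "openin X V" "openin Y W"
      using R \<V>(2) unfolding \<U>_def by blast
    have "(\<lambda>\<omega>. (f \<omega>, g \<omega>)) -` R \<inter> space M = (f -` V \<inter> space M) \<inter> (g -` W \<inter> space M)"
      by (auto simp: RVW)
    then show ?thesis
      using measurable_sets[OF f openin_in_sets_borel_of[OF RVW(2)]]
        measurable_sets[OF g openin_in_sets_borel_of[OF RVW(3)]] by simp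
  qed
  then show "(\<lambda>\<omega>. (f \<omega>, g \<omega>)) -` U \<inter> space M \<in> sets M"
    unfolding eq by (intro sets.countable_UN'') (use \<V>(1) in auto)
qed

lemma measurable_into_borel_of_top_of_set:
  assumes f: "f \<in> borel_measurable M" and "\<And>\<omega>. \<omega> \<in> space M \<Longrightarrow> f \<omega> \<in> S"
  shows "f \<in> M \<rightarrow>\<^sub>M borel_of (top_of_set S)"
proof (rule measurable_into_borel_of)
  fix U assume "openin (top_of_set S) U"
  then obtain V where V: "open V" "U = V \<inter> S"
    by (auto simp: openin_subtopology)
  have "f -` U \<inter> space M = f -` V \<inter> space M"
    using assms(2) V by auto
  then show "f -` U \<inter> space M \<in> sets M"
    using measurable_sets[OF f, of V] V by auto
qed (use assms in auto)

text \<open>Among the operations that build open sets from a subbase, only arbitrary unions could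
  leave the \<sigma>-algebra generated by it, and Lindelof makes them countable.\<close>

lemma sets_borel_of_generated:
  assumes "second_countable (topology_generated_by S)"
  shows "sets (borel_of (topology_generated_by S)) = sigma_sets (\<Union>S) S"
proof -
  have "U \<in> sigma_sets (\<Union>S) S" if "generate_topology_on S U" for U
    using that
  proof (induction rule: generate_topology_on.induct)
    case (Int a b)
    interpret S: sigma_algebra "\<Union>S" "sigma_sets (\<Union>S) S"
      by (rule sigma_algebra_sigma_sets) auto
    show ?case using Int.IH by (rule S.Int)
  next
    case (UN K)
    then obtain K' where K': "countable K'" "K' \<subseteq> K" "\<Union>K' = \<Union>K"
      using second_countable_Lindelof[OF assms, of K]
      by (metis openin_topology_generated_by_iff)
    interpret S: sigma_algebra "\<Union>S" "sigma_sets (\<Union>S) S"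
      by (rule sigma_algebra_sigma_sets) auto
    have "\<Union>K' \<in> sigma_sets (\<Union>S) S"
      using K' UN.IH by (intro S.countable_Union) auto
    then show ?case using K' by simp
  qed (auto intro: sigma_sets.intros)
  then have "{U. openin (topology_generated_by S) U} \<subseteq> sigma_sets (\<Union>S) S"
    by (auto simp: openin_topology_generated_by_iff)
  moreover have "S \<subseteq> {U. openin (topology_generated_by S) U}"
    by (auto intro: topology_generated_by_Basis)
  ultimately show ?thesis
    unfolding sets_borel_of topology_generated_by_topspace
    by (meson sigma_sets_eqI sigma_sets.Basic subset_iff)
qed

section \<open>The narrow topology\<close>

text \<open>An open set of a metrizable space is an increasing union of closed sets
  \<open>C n\<close>; the \<open>h n\<close> are Urysohn functions that are 1 on \<open>C n\<close>
  and 0 off \<open>V\<close>. Through them, integrals of continuous functions control the masses of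
  open sets.\<close>

lemma open_indicator_approximation:
  assumes X: "metrizable_space X" and V: "openin X V"
  obtains h :: "nat \<Rightarrow> 'a \<Rightarrow> real"
  where "\<And>n. continuous_map X euclideanreal (h n)"
    and "\<And>n x. x \<in> topspace X \<Longrightarrow> 0 \<le> h n x \<and> h n x \<le> 1"
    and "\<And>n x. x \<in> topspace X - V \<Longrightarrow> h n x = 0"
    and "\<And>x. x \<in> V \<Longrightarrow> \<exists>N. \<forall>n\<ge>N. h n x = 1"
proof -
  obtain C where C: "\<And>n. closedin X (C n)" "\<And>n. C n \<subseteq> C (Suc n)" "\<Union>(range C) = V"
    using open_imp_fsigma_in[OF X V] unfolding fsigma_in_ascending by auto
  have "\<exists>h. continuous_map X (top_of_set {0..1::real}) h \<and> h ` (topspace X - V) \<subseteq> {0} \<and> h ` C n \<subseteq> {1}" for n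
  proof -
    have "closedin X (topspace X - V)" "disjnt (topspace X - V) (C n)"
      using C V by (auto simp: disjnt_def)
    then obtain h where "continuous_map X (top_of_set {0..1::real}) h" "h ` (topspace X - V) \<subseteq> {0}" "h ` C n \<subseteq> {1}"
      by (rule Urysohn_lemma[OF metrizable_imp_normal_space[OF X] _ C(1), of _ _ 0 1]) simp
    then show ?thesis by metis
  qed
  then obtain h where h: "\<And>n. continuous_map X (top_of_set {0..1::real}) (h n)"
    "\<And>n. h n ` (topspace X - V) \<subseteq> {0}" "\<And>n. h n ` C n \<subseteq> {1}"
    by metis
  show thesis
  proof (rule that[of h])
    show "\<exists>N. \<forall>n\<ge>N. h n x = 1" if x: "x \<in> V" for x
    proof -
      obtain N where "x \<in> C N" using x unfolding C(3)[symmetric] by blast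
      moreover have "C N \<subseteq> C n" if "N \<le> n" for n
        using that C(2) lift_Suc_mono_le[of C] by blast
      ultimately show ?thesis using h(3) by (intro exI[of _ N]) blast
    qed
  qed (use h in \<open>auto simp: continuous_map_in_subtopology image_subset_iff Pi_iff\<close>)
qed

lemma continuous_map_Max:
  fixes f :: "'i \<Rightarrow> 'a \<Rightarrow> real"
  assumes "finite F" "F \<noteq> {}" "\<And>i. i \<in> F \<Longrightarrow> continuous_map X euclideanreal (f i)"
  shows "continuous_map X euclideanreal (\<lambda>x. MAX i\<in>F. f i x)"
  using assms
proof (induction rule: finite_ne_induct)
  case (insert i F)
  then have "(\<lambda>x. MAX i\<in>insert i F. f i x) = (\<lambda>x. max (f i x) (MAX i\<in>F. f i x))"
    by auto
  then show ?case
    using insert by (auto intro: continuous_map_real_max)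
qed auto

text \<open>On a non-compact space the bounded continuous functions are in general not separable in
  the sup norm, so no countable family approximates them uniformly. Pointwise approximation from
  below is enough for lower bounds on integrals. The family consists of finite maxima of bumps
  \<open>q * h V n\<close> with rational \<open>q\<close> and basic \<open>V\<close>.\<close>

lemma countable_lower_approximation:
  assumes X: "metrizable_space X" "second_countable X"
  obtains G :: "('a \<Rightarrow> real) set"
  where "countable G"
    and "\<And>g. g \<in> G \<Longrightarrow> continuous_map X euclideanreal g"
    and "\<And>g x. g \<in> G \<Longrightarrow> x \<in> topspace X \<Longrightarrow> 0 \<le> g x"
    and "\<And>g. g \<in> G \<Longrightarrow> bounded (g ` topspace X)"
    and "\<And>f. continuous_map X euclideanreal f \<Longrightarrow> \<forall>x\<in>topspace X. 0 \<le> f x \<Longrightarrow>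
      \<exists>g::nat \<Rightarrow> 'a \<Rightarrow> real. range g \<subseteq> G \<and>
        (\<forall>x\<in>topspace X. (\<forall>n. g n x \<le> f x) \<and> (\<lambda>n. g n x) \<longlonglongrightarrow> f x)"
proof -
  obtain \<B>0 where \<B>0: "countable \<B>0" "\<And>V. V \<in> \<B>0 \<Longrightarrow> openin X V"
    "\<And>U x. openin X U \<Longrightarrow> x \<in> U \<Longrightarrow> \<exists>V\<in>\<B>0. x \<in> V \<and> V \<subseteq> U"
    using X(2) unfolding second_countable_def by metis
  \<comment> \<open>With \<open>{}\<close> in the base there is an index \<open>(0, {}, 0)\<close>,
    whose bump is the zero function. It makes \<open>J\<close> nonempty, so that it can be
    enumerated, and takes care of negative levels.\<close>
  define \<B> where "\<B> = insert {} \<B>0"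
  have \<B>: "countable \<B>" "\<And>V. V \<in> \<B> \<Longrightarrow> openin X V"
    "\<And>U x. openin X U \<Longrightarrow> x \<in> U \<Longrightarrow> \<exists>V\<in>\<B>. x \<in> V \<and> V \<subseteq> U" "{} \<in> \<B>"
    using \<B>0 by (auto simp: \<B>_def)
  have "\<exists>h::nat \<Rightarrow> 'a \<Rightarrow> real. openin X V \<longrightarrow>
      (\<forall>n. continuous_map X euclideanreal (h n)) \<and>
      (\<forall>n. \<forall>x\<in>topspace X. 0 \<le> h n x \<and> h n x \<le> 1) \<and>
      (\<forall>n. \<forall>x\<in>topspace X - V. h n x = 0) \<and> (\<forall>x\<in>V. \<exists>N. \<forall>n\<ge>N. h n x = 1)" for V
  proof (cases "openin X V")
    case True
    then show ?thesis
      using open_indicator_approximation[OF X(1) True] by metis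
  qed auto
  then obtain h :: "'a set \<Rightarrow> nat \<Rightarrow> 'a \<Rightarrow> real" where h: "\<And>V. openin X V \<longrightarrow>
      (\<forall>n. continuous_map X euclideanreal (h V n)) \<and>
      (\<forall>n. \<forall>x\<in>topspace X. 0 \<le> h V n x \<and> h V n x \<le> 1) \<and>
      (\<forall>n. \<forall>x\<in>topspace X - V. h V n x = 0) \<and> (\<forall>x\<in>V. \<exists>N. \<forall>n\<ge>N. h V n x = 1)"
    by metis
  define I where "I = (\<rat> \<inter> {0::real..}) \<times> \<B> \<times> (UNIV :: nat set)"
  define e where "e = (\<lambda>(q::real, V, n) x. q * h V n x)"
  have countI: "countable I"
    unfolding I_def by (intro countable_SIGMA countable_Int1 countable_rat \<B>(1)) auto
  have e_cont: "continuous_map X euclideanreal (e i)" if "i \<in> I" for i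
    using that h \<B>(2) by (auto simp: I_def e_def intro!: continuous_map_real_mult)
  have e_bd: "0 \<le> e i x \<and> e i x \<le> fst i" if "i \<in> I" "x \<in> topspace X" for i x
    using that h \<B>(2) by (auto simp: I_def e_def mult_left_le)
  define G where "G = (\<lambda>F x. MAX i\<in>F. e i x) ` {F. finite F \<and> F \<subseteq> I \<and> F \<noteq> {}}"
  show thesis
  proof (rule that[of G])
    have "countable {F. finite F \<and> F \<subseteq> I}"
      by (intro countable_Collect_finite_subset countI)
    then show "countable G"
      unfolding G_def by (intro countable_image) (auto elim: countable_subset[rotated])
  next
    fix g assume "g \<in> G"
    then obtain F where F: "finite F" "F \<subseteq> I" "F \<noteq> {}" and g: "g = (\<lambda>x. MAX i\<in>F. e i x)"
      by (auto simp: G_def)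
    show "continuous_map X euclideanreal g"
      unfolding g using F e_cont by (intro continuous_map_Max) auto
    have nn: "0 \<le> g x" if "x \<in> topspace X" for x
      using F e_bd[OF _ that] unfolding g by (subst Max_ge_iff) blast+
    then show "0 \<le> g x" if "x \<in> topspace X" for x using that .
    have "g x \<le> (MAX i\<in>F. fst i)" if "x \<in> topspace X" for x
      unfolding g
    proof (rule Max.boundedI)
      fix a assume "a \<in> (\<lambda>i. e i x) ` F"
      then obtain i where i: "i \<in> F" "a = e i x" by auto
      then have "a \<le> fst i" using e_bd[OF _ that, of i] F by auto
      also have "\<dots> \<le> (MAX i\<in>F. fst i)" using F i by (intro Max_ge) auto
      finally show "a \<le> (MAX i\<in>F. fst i)" .
    qed (use F in auto)
    with nn show "bounded (g ` topspace X)"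
      by (intro boundedI[of _ "MAX i\<in>F. fst i"]) auto
  next
    fix f assume f: "continuous_map X euclideanreal f" "\<forall>x\<in>topspace X. 0 \<le> f x"
    define J where "J = {i \<in> I. \<forall>x\<in>topspace X. e i x \<le> f x}"
    have "(0, {}, 0) \<in> J"
      using f(2) \<B>(4) by (auto simp: J_def I_def e_def)
    then have "J \<noteq> {}" by auto
    have "countable J" using countI by (auto simp: J_def)
    define k where "k = from_nat_into J"
    have rk: "range k = J"
      unfolding k_def by (rule range_from_nat_into) fact+
    \<comment> \<open>A running maximum stays above a level once one member of \<open>J\<close>
      exceeds it, so the limit only requires one such member for each level below
      \<open>f x\<close>.\<close>
    define g where "g = (\<lambda>n x. MAX i\<in>k ` {..n}. e i x)"
    have g_le: "g n x \<le> f x" if "x \<in> topspace X" for n x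
      unfolding g_def using rk that by (intro Max.boundedI) (auto simp: J_def)
    have g_ge: "e (k m) x \<le> g n x" if "m \<le> n" for m n x
      unfolding g_def using that by (intro Max_ge) auto
    have lim: "(\<lambda>n. g n x) \<longlonglongrightarrow> f x" if x: "x \<in> topspace X" for x
    proof (rule order_tendstoI)
      fix a assume "a < f x"
      have "\<exists>i\<in>J. a < e i x"
      proof (cases "0 \<le> a")
        case True
        obtain q where q: "q \<in> \<rat>" "a < q" "q < f x"
          using Rats_dense_in_real[OF \<open>a < f x\<close>] by auto
        \<comment> \<open>A basic \<open>V\<close> around \<open>x\<close> on which \<open>f\<close>
          exceeds \<open>q\<close> carries the bump: it is at most \<open>q\<close> on
          \<open>V\<close> and 0 elsewhere, hence below \<open>f\<close>.\<close>
        have "openin X {y \<in> topspace X. f y \<in> {q<..}}"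
          using f(1) by (intro openin_continuous_map_preimage) auto
        then obtain V where V: "V \<in> \<B>" "x \<in> V" "V \<subseteq> {y \<in> topspace X. f y \<in> {q<..}}"
          using \<B>(3) x q by (metis (lifting) greaterThan_iff mem_Collect_eq)
        obtain N where N: "h V N x = 1"
          using h \<B>(2) V by (metis order_refl)
        have "(q, V, N) \<in> J"
        proof -
          have "q * h V N y \<le> f y" if "y \<in> topspace X" for y
          proof (cases "y \<in> V")
            case True
            then have "q < f y" using V by auto
            moreover have "q * h V N y \<le> q"
              using h \<B>(2) V that q True \<open>0 \<le> a\<close> by (auto simp: mult_left_le)
            ultimately show ?thesis by simp
          next
            case False
            then show ?thesis using h \<B>(2) V that f(2) by auto
          qed
          then show ?thesis using V q True by (auto simp: J_def I_def e_def)
        qed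
        then show ?thesis using N q by (intro bexI[of _ "(q, V, N)"]) (auto simp: e_def)
      next
        case False
        then show ?thesis
          using \<open>(0, {}, 0) \<in> J\<close> by (intro bexI[of _ "(0, {}, 0)"]) (auto simp: e_def)
      qed
      then obtain m where "a < e (k m) x" using rk by (metis rangeE)
      then have "\<forall>n\<ge>m. a < g n x" using g_ge by (meson less_le_trans)
      then show "\<forall>\<^sub>F n in sequentially. a < g n x" by (auto simp: eventually_sequentially)
    next
      fix a assume "f x < a"
      then show "\<forall>\<^sub>F n in sequentially. g n x < a"
        using g_le[OF x] by (auto intro: always_eventually le_less_trans)
    qed
    have "range g \<subseteq> G"
    proof safe
      fix n
      have "k ` {..n} \<subseteq> I" using rk by (auto simp: J_def)
      then show "g n \<in> G" unfolding G_def g_def by (intro image_eqI[of _ _ "k ` {..n}"]) auto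
    qed
    then show "\<exists>g::nat \<Rightarrow> 'a \<Rightarrow> real. range g \<subseteq> G \<and>
        (\<forall>x\<in>topspace X. (\<forall>n. g n x \<le> f x) \<and> (\<lambda>n. g n x) \<longlonglongrightarrow> f x)"
      using lim g_le by blast
  qed
qed

lemma topspace_narrow_topology [simp]: "topspace (narrow_topology X) = borel_prob X"
proof
  have "borel_prob X \<in> {{\<mu> \<in> borel_prob X. (LINT x|\<mu>. f x) \<in> U} | (f :: 'a \<Rightarrow> real) U.
        continuous_map X euclideanreal f \<and> bounded (f ` topspace X) \<and> open U}"
    by (rule CollectI, rule exI[of _ "\<lambda>_. 0"], rule exI[of _ UNIV]) (auto simp: image_constant_conv)
  then show "borel_prob X \<subseteq> topspace (narrow_topology X)"
    unfolding narrow_topology_def topology_generated_by_topspace by (rule Union_upper)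
qed (auto simp: narrow_topology_def)

lemma borel_probD:
  assumes "\<mu> \<in> borel_prob X"
  shows "prob_space \<mu>" "sets \<mu> = sets (borel_of X)" "space \<mu> = topspace X"
  using assms sets_eq_imp_space_eq[of \<mu> "borel_of X"] by (auto simp: borel_prob_def)

lemma integrable_bounded_continuous:
  fixes f :: "'a \<Rightarrow> real"
  assumes \<mu>: "\<mu> \<in> borel_prob X" and f: "continuous_map X euclideanreal f" "bounded (f ` topspace X)"
  shows "integrable \<mu> f"
proof -
  interpret prob_space \<mu> using borel_probD[OF \<mu>] by simp
  obtain B where "\<And>x. x \<in> topspace X \<Longrightarrow> norm (f x) \<le> B"
    using f(2) by (auto simp: bounded_iff)
  moreover have "f \<in> borel_measurable \<mu>"
    using borel_measurable_continuous_map[OF f(1)] by (simp cong: measurable_cong_sets add: borel_probD(2)[OF \<mu>])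
  ultimately show ?thesis
    by (intro integrable_const_bound[where B = B]) (auto simp: borel_probD[OF \<mu>])
qed

lemma continuous_map_integral_narrow:
  assumes "continuous_map X euclideanreal f" "bounded (f ` topspace X)"
  shows "continuous_map (narrow_topology X) euclideanreal (\<lambda>\<mu>. LINT x|\<mu>. f x)"
  unfolding continuous_map_def
proof (intro conjI allI impI)
  fix U :: "real set" assume "openin euclidean U"
  then show "openin (narrow_topology X) {\<mu> \<in> topspace (narrow_topology X). (LINT x|\<mu>. f x) \<in> U}"
    unfolding topspace_narrow_topology unfolding narrow_topology_def using assms
    by (intro topology_generated_by_Basis CollectI exI[of _ f] exI[of _ U]) auto
qed auto

text \<open>The base consists of finite intersections of half-spaces of measures with
  \<open>c < (LINT x|\<mu>. g x)\<close>, for rational \<open>c\<close> and \<open>g\<close> from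
  the countable family. Lower bounds suffice, because all measures have mass one and an upper bound
  on the integral of \<open>f\<close> is a lower bound on that of \<open>B - f\<close>.\<close>

lemma second_countable_narrow_topology:
  assumes X: "metrizable_space X" "second_countable X"
  shows "second_countable (narrow_topology X)"
proof -
  obtain G :: "('a \<Rightarrow> real) set" where G: "countable G"
    "\<And>g. g \<in> G \<Longrightarrow> continuous_map X euclideanreal g"
    "\<And>g x. g \<in> G \<Longrightarrow> x \<in> topspace X \<Longrightarrow> 0 \<le> g x"
    "\<And>g. g \<in> G \<Longrightarrow> bounded (g ` topspace X)"
    "\<And>f. continuous_map X euclideanreal f \<Longrightarrow> \<forall>x\<in>topspace X. 0 \<le> f x \<Longrightarrow>
      \<exists>g::nat \<Rightarrow> 'a \<Rightarrow> real. range g \<subseteq> G \<and>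
        (\<forall>x\<in>topspace X. (\<forall>n. g n x \<le> f x) \<and> (\<lambda>n. g n x) \<longlonglongrightarrow> f x)"
    using countable_lower_approximation[OF X] by blast
  define S where "S = (\<lambda>(g, c). {\<mu> \<in> borel_prob X. (LINT x|\<mu>. g x) \<in> {c<..}}) ` (G \<times> \<rat>)"
  define \<B> where "\<B> = (\<lambda>F. borel_prob X \<inter> \<Inter>F) ` {F. finite F \<and> F \<subseteq> S}"
  have "countable S"
    unfolding S_def by (intro countable_image countable_SIGMA G(1) countable_rat)
  then have count: "countable \<B>"
    unfolding \<B>_def by (intro countable_image countable_Collect_finite_subset)
  have S_open: "openin (narrow_topology X) U" if U: "U \<in> S" for U
  proof -
    obtain g c where U: "U = {\<mu> \<in> borel_prob X. (LINT x|\<mu>. g x) \<in> {c<..}}" and "g \<in> G"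
      using U by (auto simp: S_def)
    have "openin (narrow_topology X)
        {\<mu> \<in> topspace (narrow_topology X). (LINT x|\<mu>. g x) \<in> {c<..}}"
      by (rule openin_continuous_map_preimage)
        (auto intro: continuous_map_integral_narrow G(2,4)[OF \<open>g \<in> G\<close>])
    then show ?thesis by (simp add: U)
  qed
  have \<B>_open: "openin (narrow_topology X) U" if U: "U \<in> \<B>" for U
  proof -
    obtain F where F: "finite F" "F \<subseteq> S" "U = borel_prob X \<inter> \<Inter>F"
      using U by (auto simp: \<B>_def)
    have "openin (narrow_topology X) (topspace (narrow_topology X) \<inter> \<Inter>F)"
      using F(1,2) S_open by (intro openin_Int_Inter openin_topspace) auto
    then show ?thesis using F(3) by simp
  qed
  have \<B>_Int: "U \<inter> V \<in> \<B>" if UV: "U \<in> \<B>" "V \<in> \<B>" for U V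
  proof -
    obtain F F' where F: "finite F" "F \<subseteq> S" "U = borel_prob X \<inter> \<Inter>F"
      "finite F'" "F' \<subseteq> S" "V = borel_prob X \<inter> \<Inter>F'"
      using UV by (auto simp: \<B>_def)
    then show ?thesis
      unfolding \<B>_def by (intro image_eqI[of _ _ "F \<union> F'"]) auto
  qed
  have S_\<B>: "U \<in> \<B>" if "U \<in> S" for U
    unfolding \<B>_def using that by (intro image_eqI[of _ _ "{U}"]) (auto simp: S_def)
  \<comment> \<open>Dominated convergence at \<open>\<mu>0\<close> selects a single
    \<open>g n\<close> whose integral exceeds \<open>c\<close>; since \<open>g n\<close> lies below
    \<open>f\<close>, the bound then passes to every measure in the half-space of
    \<open>g n\<close>.\<close>
  have lower: "\<exists>U\<in>\<B>. \<mu>0 \<in> U \<and> (\<forall>\<mu>\<in>U. c < (LINT x|\<mu>. f x))"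
    if \<mu>0: "\<mu>0 \<in> borel_prob X" and f: "continuous_map X euclideanreal f" "bounded (f ` topspace X)"
      "\<And>x. x \<in> topspace X \<Longrightarrow> 0 \<le> f x" and c: "c < (LINT x|\<mu>0. f x)"
    for \<mu>0 c and f :: "'a \<Rightarrow> real"
  proof -
    obtain g :: "nat \<Rightarrow> 'a \<Rightarrow> real" where g: "range g \<subseteq> G"
      "\<And>x n. x \<in> topspace X \<Longrightarrow> g n x \<le> f x"
      "\<And>x. x \<in> topspace X \<Longrightarrow> (\<lambda>n. g n x) \<longlonglongrightarrow> f x"
      using G(5)[OF f(1)] f(3) by metis
    have gi: "integrable \<mu> (g n)" if "\<mu> \<in> borel_prob X" for \<mu> n
      using g(1) G(2,4) that by (intro integrable_bounded_continuous) auto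
    have "(\<lambda>n. LINT x|\<mu>0. g n x) \<longlonglongrightarrow> (LINT x|\<mu>0. f x)"
    proof (rule integral_dominated_convergence[where w = f])
      show "f \<in> borel_measurable \<mu>0" "integrable \<mu>0 f"
        using integrable_bounded_continuous[OF \<mu>0 f(1,2)] by auto
      show "g n \<in> borel_measurable \<mu>0" for n
        using gi[OF \<mu>0] by auto
      show "AE x in \<mu>0. (\<lambda>n. g n x) \<longlonglongrightarrow> f x"
        using g(3) by (auto simp: borel_probD[OF \<mu>0])
      show "AE x in \<mu>0. norm (g n x) \<le> f x" for n
        using g(1,2) G(3) by (auto simp: borel_probD[OF \<mu>0] subset_iff)
    qed
    then have "\<forall>\<^sub>F n in sequentially. c < (LINT x|\<mu>0. g n x)"
      using c by (rule order_tendstoD)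
    then obtain n where n: "c < (LINT x|\<mu>0. g n x)"
      by (auto simp: eventually_sequentially)
    then obtain q where q: "q \<in> \<rat>" "c < q" "q < (LINT x|\<mu>0. g n x)"
      using Rats_dense_in_real by blast
    let ?U = "{\<mu> \<in> borel_prob X. (LINT x|\<mu>. g n x) \<in> {q<..}}"
    have "?U \<in> S"
      unfolding S_def using g(1) q by (intro image_eqI[of _ _ "(g n, q)"]) auto
    moreover have "c < (LINT x|\<mu>. f x)" if "\<mu> \<in> ?U" for \<mu>
    proof -
      have \<mu>: "\<mu> \<in> borel_prob X" using that by auto
      have "c < (LINT x|\<mu>. g n x)" using q that by auto
      also have "\<dots> \<le> (LINT x|\<mu>. f x)"
        using g(2) by (intro integral_mono gi[OF \<mu>] integrable_bounded_continuous[OF \<mu> f(1,2)])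
          (auto simp: borel_probD[OF \<mu>])
      finally show ?thesis .
    qed
    ultimately show ?thesis
      using S_\<B> q \<mu>0 by (intro bexI[of _ ?U]) auto
  qed
  have base: "\<forall>\<mu>0\<in>U. \<exists>V\<in>\<B>. \<mu>0 \<in> V \<and> V \<subseteq> U"
    if "generate_topology_on {{\<mu> \<in> borel_prob X. (LINT x|\<mu>. f x) \<in> U} | (f :: 'a \<Rightarrow> real) U.
        continuous_map X euclideanreal f \<and> bounded (f ` topspace X) \<and> open U} U" for U
    using that
  proof (induction rule: generate_topology_on.induct)
    case (Int a b)
    show ?case
    proof
      fix \<mu>0 assume "\<mu>0 \<in> a \<inter> b"
      then obtain V W where "V \<in> \<B>" "\<mu>0 \<in> V" "V \<subseteq> a" "W \<in> \<B>" "\<mu>0 \<in> W" "W \<subseteq> b"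
        using bspec[OF Int.IH(1), of \<mu>0] bspec[OF Int.IH(2), of \<mu>0] by auto
      then show "\<exists>V\<in>\<B>. \<mu>0 \<in> V \<and> V \<subseteq> a \<inter> b"
        using \<B>_Int by (intro bexI[of _ "V \<inter> W"]) auto
    qed
  next
    case (UN K)
    then show ?case by (meson UnionE Union_upper order_trans)
  next
    case (Basis s)
    then obtain f :: "'a \<Rightarrow> real" and U where s: "s = {\<mu> \<in> borel_prob X. (LINT x|\<mu>. f x) \<in> U}"
      and f: "continuous_map X euclideanreal f" "bounded (f ` topspace X)" and "open U"
      by blast
    \<comment> \<open>The bound \<open>B\<close> makes \<open>f + B\<close> and \<open>B - f\<close>
      nonnegative, as \<open>lower\<close> requires; their two lower bounds enclose the integral of
      \<open>f\<close> from both sides.\<close>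
    obtain B where B: "\<And>x. x \<in> topspace X \<Longrightarrow> \<bar>f x\<bar> \<le> B"
      using f(2) by (auto simp: bounded_iff)
    have B': "0 \<le> f x + B" "0 \<le> B - f x" if "x \<in> topspace X" for x
      using B[OF that] by auto
    have c: "continuous_map X euclideanreal (\<lambda>x. f x + B)" "continuous_map X euclideanreal (\<lambda>x. B - f x)"
      using f(1) by (auto intro: continuous_map_add continuous_map_diff)
    have b: "bounded ((\<lambda>x. f x + B) ` topspace X)" "bounded ((\<lambda>x. B - f x) ` topspace X)"
    proof -
      have "norm (f x + B) \<le> 2 * B" "norm (B - f x) \<le> 2 * B" if "x \<in> topspace X" for x
        using B[OF that] by auto
      then show "bounded ((\<lambda>x. f x + B) ` topspace X)" "bounded ((\<lambda>x. B - f x) ` topspace X)"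
        by (auto intro!: boundedI[of _ "2 * B"])
    qed
    show ?case
    proof
      fix \<mu>0 assume "\<mu>0 \<in> s"
      then have \<mu>0: "\<mu>0 \<in> borel_prob X" "(LINT x|\<mu>0. f x) \<in> U" by (auto simp: s)
      then obtain \<epsilon> where \<epsilon>: "\<epsilon> > 0" "\<And>y. \<bar>y - (LINT x|\<mu>0. f x)\<bar> < \<epsilon> \<Longrightarrow> y \<in> U"
        using \<open>open U\<close> unfolding open_dist by (metis dist_real_def)
      have eq: "(LINT x|\<mu>. f x + B) = (LINT x|\<mu>. f x) + B" "(LINT x|\<mu>. B - f x) = B - (LINT x|\<mu>. f x)"
        if "\<mu> \<in> borel_prob X" for \<mu>
      proof -
        interpret prob_space \<mu> using borel_probD[OF that] by simp
        show "(LINT x|\<mu>. f x + B) = (LINT x|\<mu>. f x) + B" "(LINT x|\<mu>. B - f x) = B - (LINT x|\<mu>. f x)"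
          using integrable_bounded_continuous[OF that f] by (simp_all add: prob_space)
      qed
      obtain V where V: "V \<in> \<B>" "\<mu>0 \<in> V" "\<And>\<mu>. \<mu> \<in> V \<Longrightarrow> (LINT x|\<mu>0. f x) + B - \<epsilon> < (LINT x|\<mu>. f x + B)"
        using lower[OF \<mu>0(1) c(1) b(1) B'(1), of "(LINT x|\<mu>0. f x) + B - \<epsilon>"] \<epsilon>(1) eq[OF \<mu>0(1)] by auto
      obtain W where W: "W \<in> \<B>" "\<mu>0 \<in> W" "\<And>\<mu>. \<mu> \<in> W \<Longrightarrow> B - (LINT x|\<mu>0. f x) - \<epsilon> < (LINT x|\<mu>. B - f x)"
        using lower[OF \<mu>0(1) c(2) b(2) B'(2), of "B - (LINT x|\<mu>0. f x) - \<epsilon>"] \<epsilon>(1) eq[OF \<mu>0(1)] by auto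
      have "V \<inter> W \<subseteq> s"
      proof
        fix \<mu> assume \<mu>: "\<mu> \<in> V \<inter> W"
        then have P: "\<mu> \<in> borel_prob X" using V(1) by (auto simp: \<B>_def)
        have "(LINT x|\<mu>. f x) \<in> U"
          using V(3)[of \<mu>] W(3)[of \<mu>] \<mu> eq[OF P] by (intro \<epsilon>(2)) (auto simp: abs_less_iff)
        then show "\<mu> \<in> s" using P by (simp add: s)
      qed
      then show "\<exists>V\<in>\<B>. \<mu>0 \<in> V \<and> V \<subseteq> s"
        using \<B>_Int V W by (intro bexI[of _ "V \<inter> W"]) auto
    qed
  qed auto
  show ?thesis
    unfolding second_countable_def
  proof (intro exI[of _ \<B>] conjI ballI allI impI)
    fix U \<mu>0 assume U: "openin (narrow_topology X) U \<and> \<mu>0 \<in> U"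
    then show "\<exists>V\<in>\<B>. \<mu>0 \<in> V \<and> V \<subseteq> U"
      using base unfolding narrow_topology_def openin_topology_generated_by_iff by blast
  qed (use count \<B>_open in auto)
qed

text \<open>By second countability the subbase of the narrow topology already generates its Borel
  \<sigma>-algebra, so only preimages of subbasic sets have to be examined.\<close>

lemma measurable_into_narrow:
  assumes X: "metrizable_space X" "second_countable X"
    and "\<And>\<omega>. \<omega> \<in> space M \<Longrightarrow> h \<omega> \<in> borel_prob X"
    and h: "\<And>f :: 'a \<Rightarrow> real. continuous_map X euclideanreal f \<Longrightarrow> bounded (f ` topspace X) \<Longrightarrow>
      (\<lambda>\<omega>. LINT x|h \<omega>. f x) \<in> borel_measurable M"
  shows "h \<in> M \<rightarrow>\<^sub>M borel_of (narrow_topology X)"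
proof (rule measurable_sigma_sets)
  show "sets (borel_of (narrow_topology X)) = sigma_sets (borel_prob X)
    {{\<mu> \<in> borel_prob X. (LINT x|\<mu>. f x) \<in> U} | (f :: 'a \<Rightarrow> real) U.
        continuous_map X euclideanreal f \<and> bounded (f ` topspace X) \<and> open U}"
    using second_countable_narrow_topology[OF X] topspace_narrow_topology[of X]
    unfolding narrow_topology_def topology_generated_by_topspace
    by (simp add: sets_borel_of_generated)
  fix y assume "y \<in> {{\<mu> \<in> borel_prob X. (LINT x|\<mu>. f x) \<in> U} | (f :: 'a \<Rightarrow> real) U.
        continuous_map X euclideanreal f \<and> bounded (f ` topspace X) \<and> open U}"
  then obtain f :: "'a \<Rightarrow> real" and U where y: "y = {\<mu> \<in> borel_prob X. (LINT x|\<mu>. f x) \<in> U}"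
    and f: "continuous_map X euclideanreal f" "bounded (f ` topspace X)" and "open U"
    by blast
  have "h -` y \<inter> space M = (\<lambda>\<omega>. LINT x|h \<omega>. f x) -` U \<inter> space M"
    using assms(3) by (auto simp: y)
  then show "h -` y \<inter> space M \<in> sets M"
    using measurable_sets[OF h[OF f], of U] \<open>open U\<close> by auto
qed (use assms(3) in auto)

text \<open>This turns the narrow space of laws into a source of measurable kernels. The open sets
  are an intersection-stable generator, and the mass of an open set is a limit of integrals of
  bounded continuous functions, each of which is narrowly continuous.\<close>

lemma narrow_measurable_subprob_algebra:
  assumes X: "metrizable_space X"
  shows "(\<lambda>\<mu>. \<mu>) \<in> borel_of (narrow_topology X) \<rightarrow>\<^sub>M subprob_algebra (borel_of X)"
proof (rule measurable_subprob_algebra_generated[OF sets_borel_of])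
  show "Int_stable {U. openin X U}"
    by (auto simp: Int_stable_def)
  have em: "(\<lambda>\<mu>. emeasure \<mu> V) \<in> borel_measurable (borel_of (narrow_topology X))" if V: "openin X V" for V
  proof -
    obtain h :: "nat \<Rightarrow> 'a \<Rightarrow> real" where h: "\<And>n. continuous_map X euclideanreal (h n)"
      "\<And>n x. x \<in> topspace X \<Longrightarrow> 0 \<le> h n x \<and> h n x \<le> 1"
      "\<And>n x. x \<in> topspace X - V \<Longrightarrow> h n x = 0"
      "\<And>x. x \<in> V \<Longrightarrow> \<exists>N. \<forall>n\<ge>N. h n x = 1"
      using open_indicator_approximation[OF X V] by metis
    have bdd: "bounded (h n ` topspace X)" for n
      using h(2) by (intro boundedI[of _ 1]) fastforce
    have lim: "(\<lambda>n. LINT x|\<mu>. h n x) \<longlonglongrightarrow> measure \<mu> V" if \<mu>: "\<mu> \<in> borel_prob X" for \<mu>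
    proof -
      interpret prob_space \<mu> using borel_probD[OF \<mu>] by simp
      have Vs: "V \<in> sets \<mu>" using borel_probD[OF \<mu>] openin_in_sets_borel_of[OF V] by simp
      have "(\<lambda>n. LINT x|\<mu>. h n x) \<longlonglongrightarrow> (LINT x|\<mu>. indicator V x)"
      proof (rule integral_dominated_convergence[where w = "\<lambda>_. 1"])
        show "h n \<in> borel_measurable \<mu>" for n
          using integrable_bounded_continuous[OF \<mu> h(1) bdd] by auto
        show "AE x in \<mu>. norm (h n x) \<le> 1" for n
          by (rule AE_I2) (use h(2)[of _ n] in \<open>auto simp: borel_probD[OF \<mu>]\<close>)
        show "AE x in \<mu>. (\<lambda>n. h n x) \<longlonglongrightarrow> indicator V x"
        proof (rule AE_I2)
          fix x assume x: "x \<in> space \<mu>"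
          show "(\<lambda>n. h n x) \<longlonglongrightarrow> indicator V x"
          proof (cases "x \<in> V")
            case True
            then show ?thesis
              by (intro tendsto_eventually) (simp add: eventually_sequentially h(4))
          next
            case False
            then show ?thesis
              using h(3)[of x] x by (auto simp: borel_probD[OF \<mu>])
          qed
        qed
      qed (use Vs in auto)
      then show ?thesis
        using Vs sets.sets_into_space[OF Vs] by (simp add: Int_absorb2)
    qed
    have "(\<lambda>\<mu>. measure \<mu> V) \<in> borel_measurable (borel_of (narrow_topology X))"
    proof (rule borel_measurable_LIMSEQ_real)
      show "(\<lambda>\<mu>. LINT x|\<mu>. h n x) \<in> borel_measurable (borel_of (narrow_topology X))" for n
        by (intro borel_measurable_continuous_map continuous_map_integral_narrow h bdd)
    qed (use lim in auto)
    then have "(\<lambda>\<mu>. ennreal (measure \<mu> V)) \<in> borel_measurable (borel_of (narrow_topology X))"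
      by measurable
    moreover have "emeasure \<mu> V = ennreal (measure \<mu> V)" if "\<mu> \<in> borel_prob X" for \<mu>
      using borel_probD(1)[OF that] by (intro finite_measure.emeasure_eq_measure)
        (simp add: prob_space_def)
    ultimately show ?thesis
      by (subst measurable_cong) auto
  qed
  show "\<And>A. A \<in> {U. openin X U} \<Longrightarrow> (\<lambda>\<mu>. emeasure \<mu> A) \<in> borel_measurable (borel_of (narrow_topology X))"
    using em by auto
  show "(\<lambda>\<mu>. emeasure \<mu> (topspace X)) \<in> borel_measurable (borel_of (narrow_topology X))"
    by (rule em) simp
qed (auto simp: borel_probD prob_space_imp_subprob_space dest: openin_subset)

section \<open>Measurability on path space\<close>

abbreviation path_borel :: "real \<Rightarrow> (real \<Rightarrow> real^'d) measure" where
  "path_borel T \<equiv> borel_of (path_topology T)"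

abbreviation law_borel :: "real \<Rightarrow> (real \<Rightarrow> real^'d) measure measure" where
  "law_borel T \<equiv> borel_of (narrow_topology (path_topology T))"

lemma metrizable_path_topology: "metrizable_space (path_topology T)"
  unfolding path_topology_def mtopology_of_def
  by (rule Metric_space.metrizable_space_mtopology[OF Metric_space_mspace_mdist])

lemma continuous_on_path:
  "\<gamma> \<in> topspace (path_topology T) \<Longrightarrow> continuous_on {0..T} \<gamma>"
  by (simp add: path_topology_def)

lemma continuous_map_eval:
  assumes r: "r \<in> {0..T}"
  shows "continuous_map (path_topology T) euclidean (\<lambda>\<gamma>. \<gamma> r)"
proof -
  have "Lipschitz_continuous_map (cfunspace (top_of_set {0..T}) euclidean_metric) euclidean_metric
      (\<lambda>\<gamma> :: real \<Rightarrow> real^'d. \<gamma> r)"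
    unfolding Lipschitz_continuous_map_def
  proof (intro conjI exI[of _ 1] ballI)
    fix f g :: "real \<Rightarrow> real^'d"
    assume "f \<in> mspace (cfunspace (top_of_set {0..T}) euclidean_metric)"
      "g \<in> mspace (cfunspace (top_of_set {0..T}) euclidean_metric)"
    then show "mdist euclidean_metric (f r) (g r) \<le>
        1 * mdist (cfunspace (top_of_set {0..T}) euclidean_metric) f g"
      using mdist_cfunspace_imp_mdist_le[of f "top_of_set {0..T}" euclidean_metric g, OF _ _ order_refl, of r] r
      by simp
  qed auto
  from Lipschitz_continuous_imp_continuous_map[OF this] show ?thesis
    by (simp add: path_topology_def)
qed

section \<open>The canonical filtration and evaluation at a variable time\<close>

lemma space_path_filtration [simp]:
  "space (path_filtration T t) = topspace (path_topology T)"
  by (auto simp: path_filtration_def space_measure_of_conv)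

lemma sets_path_filtration:
  "sets (path_filtration T t) = sigma_sets (topspace (path_topology T))
     {{\<gamma> \<in> topspace (path_topology T). \<gamma> r \<in> B} | r B. r \<in> {0..t} \<and> B \<in> sets borel}"
  unfolding path_filtration_def by (rule sets_measure_of) auto

lemma measurable_eval_path_filtration:
  assumes "r \<in> {0..t}"
  shows "(\<lambda>\<gamma> :: real \<Rightarrow> real^'d. \<gamma> r) \<in> borel_measurable (path_filtration T t)"
proof (rule measurableI)
  fix B :: "(real^'d) set" assume "B \<in> sets borel"
  then have "{\<gamma> \<in> topspace (path_topology T). \<gamma> r \<in> B} \<in> sets (path_filtration T t)"
    unfolding sets_path_filtration using assms by (intro sigma_sets.Basic) blast
  moreover have "(\<lambda>\<gamma>. \<gamma> r) -` B \<inter> space (path_filtration T t) =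
      {\<gamma> \<in> topspace (path_topology T). \<gamma> r \<in> B}"
    by auto
  ultimately show "(\<lambda>\<gamma>. \<gamma> r) -` B \<inter> space (path_filtration T t) \<in> sets (path_filtration T t)"
    by metis
qed auto

lemma sets_path_filtration_mono:
  assumes "s \<le> t"
  shows "sets (path_filtration T s) \<subseteq> sets (path_filtration T t)"
  unfolding sets_path_filtration using assms by (intro sigma_sets_mono') force

lemma sets_path_filtration_subset:
  assumes "t \<le> T"
  shows "sets (path_filtration T t :: (real \<Rightarrow> real^'d) measure) \<subseteq> sets (path_borel T)"
proof -
  have "{\<gamma> \<in> topspace (path_topology T). \<gamma> r \<in> B} \<in> sets (path_borel T)"
    if "r \<in> {0..t}" "B \<in> sets borel" for r and B :: "(real^'d) set"
  proof -
    have "(\<lambda>\<gamma> :: real \<Rightarrow> real^'d. \<gamma> r) \<in> borel_measurable (path_borel T)"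
      using that assms by (intro borel_measurable_continuous_map continuous_map_eval) auto
    from measurable_sets[OF this that(2)] show ?thesis
      by (simp add: vimage_def Int_def conj_commute)
  qed
  then show ?thesis
    unfolding sets_path_filtration
    by (intro sets.sigma_sets_subset' openin_in_sets_borel_of openin_topspace) auto
qed

text \<open>Evaluation of a path at \<open>clip t r\<close> is well behaved for every real \<open>r\<close>, whereas \<open>\<gamma> r\<close> is
  \<^term>\<open>undefined\<close> off \<open>[0,T]\<close> and not \<open>\<F>\<^sub>t\<close>-measurable for \<open>r > t\<close>.\<close>

definition clip :: "real \<Rightarrow> real \<Rightarrow> real" where
  "clip t r = max 0 (min t r)"

lemma clip_in: "0 \<le> t \<Longrightarrow> clip t r \<in> {0..t}"
  by (auto simp: clip_def)

lemma clip_id: "r \<in> {0..t} \<Longrightarrow> clip t r = r"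
  by (auto simp: clip_def)

lemma borel_measurable_clip [measurable]: "clip t \<in> borel_measurable borel"
  unfolding clip_def by measurable

text \<open>Progressive measurability of the coordinate process: the path variable carries
  \<open>path_filtration T t\<close> rather than all Borel sets, because adaptedness will be read
  off from this. Time is discretized, and continuity of the paths permits the limit.\<close>

lemma measurable_eval_joint:
  assumes t: "0 \<le> t" "t \<le> T"
  shows "(\<lambda>(\<gamma>, r). \<gamma> (clip t r)) \<in>
    borel_measurable (path_filtration T t \<Otimes>\<^sub>M borel :: ((real \<Rightarrow> real^'d) \<times> real) measure)"
proof -
  \<comment> \<open>Each \<open>q n\<close> has countably many values, so the evaluation is pieced
    together from countably many evaluations at fixed times, which clipping keeps in
    \<open>{0..t}\<close>. \<open>Suc n\<close> avoids a division by zero.\<close>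
  define q where "q = (\<lambda>(n::nat) (r::real). real_of_int \<lfloor>real (Suc n) * r\<rfloor> / real (Suc n))"
  have q_lim: "(\<lambda>n. q n r) \<longlonglongrightarrow> r" for r
  proof (rule LIMSEQ_I)
    fix \<epsilon> :: real assume "0 < \<epsilon>"
    then obtain N where N: "inverse (real (Suc N)) < \<epsilon>" using reals_Archimedean by blast
    have "norm (q n r - r) < \<epsilon>" if "N \<le> n" for n
    proof -
      have "\<bar>q n r - r\<bar> = \<bar>real_of_int \<lfloor>real (Suc n) * r\<rfloor> - real (Suc n) * r\<bar> / real (Suc n)"
        by (simp add: q_def field_simps abs_divide)
      also have "\<dots> \<le> 1 / real (Suc n)"
        by (intro divide_right_mono) linarith+
      also have "\<dots> \<le> 1 / real (Suc N)"
        using that by (intro divide_left_mono) auto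
      finally show ?thesis using N by (simp add: inverse_eq_divide)
    qed
    then show "\<exists>N. \<forall>n\<ge>N. norm (q n r - r) < \<epsilon>" by blast
  qed
  have lim: "(\<lambda>n. (\<lambda>(\<gamma>, r). \<gamma> (clip t (q n r))) z) \<longlonglongrightarrow> (\<lambda>(\<gamma>, r). \<gamma> (clip t r)) z"
    if z: "z \<in> space (path_filtration T t \<Otimes>\<^sub>M borel)" for z :: "(real \<Rightarrow> real^'d) \<times> real"
  proof -
    obtain \<gamma> r where [simp]: "z = (\<gamma>, r)" by (cases z)
    have "\<gamma> \<in> topspace (path_topology T)" using z by (simp add: space_pair_measure)
    then have c: "continuous_on {0..T} \<gamma>" by (rule continuous_on_path)
    have "(\<lambda>n. clip t (q n r)) \<longlonglongrightarrow> clip t r"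
      unfolding clip_def by (intro tendsto_intros q_lim)
    moreover have "clip t x \<in> {0..T}" for x
      using clip_in[OF t(1), of x] t(2) by auto
    ultimately have "(\<lambda>n. \<gamma> (clip t (q n r))) \<longlonglongrightarrow> \<gamma> (clip t r)"
      by (intro continuous_on_tendsto_compose[OF c]) auto
    then show ?thesis by simp
  qed
  have meas: "(\<lambda>(\<gamma>, r). \<gamma> (clip t (q n r))) \<in>
    borel_measurable (path_filtration T t \<Otimes>\<^sub>M borel :: ((real \<Rightarrow> real^'d) \<times> real) measure)" for n
  proof -
    have [measurable]: "(\<lambda>\<gamma> :: real \<Rightarrow> real^'d. \<gamma> (clip t x)) \<in> borel_measurable (path_filtration T t)" for x
      by (rule measurable_eval_path_filtration[OF clip_in[OF t(1)]])
    have "(\<lambda>z. (\<lambda>i z. fst z (clip t (real_of_int i / real (Suc n)))) \<lfloor>real (Suc n) * snd z\<rfloor> z) \<in>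
      borel_measurable (path_filtration T t \<Otimes>\<^sub>M borel :: ((real \<Rightarrow> real^'d) \<times> real) measure)"
    proof (rule measurable_compose_countable[where g = "\<lambda>z. \<lfloor>real (Suc n) * snd z\<rfloor>"
        and f = "\<lambda>i z. fst z (clip t (real_of_int i / real (Suc n)))"])
      show "(\<lambda>z. \<lfloor>real (Suc n) * snd z\<rfloor>) \<in>
        (path_filtration T t \<Otimes>\<^sub>M borel :: ((real \<Rightarrow> real^'d) \<times> real) measure) \<rightarrow>\<^sub>M count_space UNIV"
        by measurable
    qed measurable
    then show ?thesis by (simp add: q_def case_prod_beta)
  qed
  show ?thesis
    by (rule borel_measurable_LIMSEQ_metric[OF meas]) (rule lim)
qed

text \<open>Measurability is proved over the filtration for the sake of adaptedness, but integration
  against a law uses the Borel sets of paths.\<close>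

lemma measurable_from_path_filtration:
  assumes "f \<in> M \<Otimes>\<^sub>M path_filtration T t \<rightarrow>\<^sub>M L" and "t \<le> T"
  shows "f \<in> M \<Otimes>\<^sub>M path_borel T \<rightarrow>\<^sub>M L"
proof -
  have id: "(\<lambda>\<gamma>. \<gamma>) \<in> path_borel T \<rightarrow>\<^sub>M path_filtration T t"
    using sets_path_filtration_subset[OF assms(2)] sets.sets_into_space
    by (intro measurableI) (auto simp: Int_absorb2)
  have "(\<lambda>z. (fst z, snd z)) \<in> M \<Otimes>\<^sub>M path_borel T \<rightarrow>\<^sub>M M \<Otimes>\<^sub>M path_filtration T t"
    by (intro measurable_Pair measurable_fst measurable_compose[OF measurable_snd id])
  from measurable_compose[OF this assms(1)] show ?thesis by simp
qed

text \<open>The parameter \<open>x\<close> occurs in the integrand and in the measure. Pushing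
  \<open>L x\<close> forward along \<open>\<lambda>y. (x, y)\<close> moves all dependence on
  \<open>x\<close> into a kernel on the product, where the integrand is fixed.\<close>

lemma integral_measurable_subprob_algebra2:
  fixes f :: "'a \<Rightarrow> 'b \<Rightarrow> 'c::{banach, second_countable_topology}"
  assumes f[measurable]: "(\<lambda>(x, y). f x y) \<in> borel_measurable (M \<Otimes>\<^sub>M N)"
    and L[measurable]: "L \<in> M \<rightarrow>\<^sub>M subprob_algebra N"
  shows "(\<lambda>x. integral\<^sup>L (L x) (f x)) \<in> borel_measurable M"
proof -
  note integral_measurable_subprob_algebra[measurable] measurable_distr2[measurable]
  have "(\<lambda>x. integral\<^sup>L (distr (L x) (M \<Otimes>\<^sub>M N) (\<lambda>y. (x, y))) (\<lambda>(x, y). f x y)) \<in> borel_measurable M"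
    by measurable
  then show ?thesis
    by (rule measurable_cong[THEN iffD1, rotated]) (simp add: integral_distr)
qed

lemma time_marginal_borel_prob:
  assumes \<Lambda>: "\<Lambda> \<in> borel_prob (path_topology T)" and r: "r \<in> {0..T}"
  shows "time_marginal \<Lambda> r \<in> borel_prob euclidean"
proof -
  interpret prob_space \<Lambda> using borel_probD[OF \<Lambda>] by simp
  have "(\<lambda>\<gamma>. \<gamma> r) \<in> borel_measurable \<Lambda>"
    using borel_measurable_continuous_map[OF continuous_map_eval[OF r]]
    by (simp cong: measurable_cong_sets add: borel_probD(2)[OF \<Lambda>])
  then show ?thesis
    by (auto simp: borel_prob_def time_marginal_def intro: prob_space_distr)
qed

text \<open>The integral of \<open>f\<close> against the marginal equals the integral of
  \<open>f (\<gamma> (clip t r))\<close> against \<open>\<Lambda>\<close>, that is, of a jointly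
  measurable function against a measurable kernel.\<close>

lemma measurable_time_marginal:
  assumes t: "0 \<le> t" "t \<le> T"
  shows "(\<lambda>(\<Lambda>, r). time_marginal \<Lambda> (clip t r)) \<in>
    law_borel T \<Otimes>\<^sub>M borel \<rightarrow>\<^sub>M borel_of (narrow_topology (euclidean :: (real^'d) topology))"
proof (rule measurable_into_narrow[OF metrizable_space_euclidean second_countable_euclidean])
  have clipT: "clip t r \<in> {0..T}" for r using clip_in[OF t(1), of r] t(2) by auto
  fix z :: "(real \<Rightarrow> real^'d) measure \<times> real" assume "z \<in> space (law_borel T \<Otimes>\<^sub>M borel)"
  then show "(\<lambda>(\<Lambda>, r). time_marginal \<Lambda> (clip t r)) z \<in> borel_prob euclidean"
    by (auto simp: space_pair_measure intro!: time_marginal_borel_prob clipT)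
next
  have clipT: "clip t r \<in> {0..T}" for r using clip_in[OF t(1), of r] t(2) by auto
  fix f :: "real^'d \<Rightarrow> real" assume f: "continuous_map euclidean euclideanreal f" "bounded (f ` topspace euclidean)"
  then have [measurable]: "f \<in> borel_measurable borel"
    using borel_measurable_continuous_map[OF f(1)] by simp
  have [measurable]: "(\<lambda>z. fst z (clip t (snd z))) \<in>
      borel_measurable (path_filtration T t \<Otimes>\<^sub>M borel :: ((real \<Rightarrow> real^'d) \<times> real) measure)"
    using measurable_eval_joint[OF t] by (simp add: case_prod_beta')
  have "(\<lambda>z. f ((snd z) (clip t (snd (fst z))))) \<in>
      borel_measurable ((law_borel T \<Otimes>\<^sub>M borel) \<Otimes>\<^sub>M path_filtration T t
        :: (((real \<Rightarrow> real^'d) measure \<times> real) \<times> (real \<Rightarrow> real^'d)) measure)"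
  proof -
    have "(\<lambda>z. (\<lambda>w. f (fst w (clip t (snd w)))) (snd z, snd (fst z))) \<in>
      borel_measurable ((law_borel T \<Otimes>\<^sub>M borel) \<Otimes>\<^sub>M path_filtration T t
        :: (((real \<Rightarrow> real^'d) measure \<times> real) \<times> (real \<Rightarrow> real^'d)) measure)"
      by measurable
    then show ?thesis by simp
  qed
  from measurable_from_path_filtration[OF this t(2)]
  have "(\<lambda>(z, \<gamma>). f (\<gamma> (clip t (snd z)))) \<in>
      borel_measurable ((law_borel T \<Otimes>\<^sub>M borel) \<Otimes>\<^sub>M path_borel T
        :: (((real \<Rightarrow> real^'d) measure \<times> real) \<times> (real \<Rightarrow> real^'d)) measure)"
    by (simp add: case_prod_beta')
  then have "(\<lambda>z. integral\<^sup>L (fst z) (\<lambda>\<gamma>. f (\<gamma> (clip t (snd z))))) \<in>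
      borel_measurable (law_borel T \<Otimes>\<^sub>M borel)"
    by (rule integral_measurable_subprob_algebra2)
      (rule measurable_compose[OF measurable_fst narrow_measurable_subprob_algebra[OF metrizable_path_topology]])
  then show "(\<lambda>z. LINT x|(\<lambda>(\<Lambda>, r). time_marginal \<Lambda> (clip t r)) z. f x) \<in>
      borel_measurable (law_borel T \<Otimes>\<^sub>M borel)"
  proof (rule measurable_cong[THEN iffD1, rotated])
    fix z :: "(real \<Rightarrow> real^'d) measure \<times> real" assume z: "z \<in> space (law_borel T \<Otimes>\<^sub>M borel)"
    have \<Lambda>: "fst z \<in> borel_prob (path_topology T)" using z by (auto simp: space_pair_measure)
    have "(\<lambda>\<gamma>. \<gamma> (clip t (snd z))) \<in> borel_measurable (fst z)"
      using borel_measurable_continuous_map[OF continuous_map_eval[OF clipT]]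
      by (simp cong: measurable_cong_sets add: borel_probD(2)[OF \<Lambda>])
    then show "integral\<^sup>L (fst z) (\<lambda>\<gamma>. f (\<gamma> (clip t (snd z)))) =
        (LINT x|(\<lambda>(\<Lambda>, r). time_marginal \<Lambda> (clip t r)) z. f x)"
      by (simp add: case_prod_beta' time_marginal_def integral_distr)
  qed
qed

text \<open>The coefficient is measurable for the Borel sets of a product topology, whereas time,
  position and marginal are known to be measurable one by one. Second countability of the three
  factors joins them. Clipping keeps the time argument in \<open>{0..T}\<close> for every real
  time.\<close>

lemma measurable_coefficient:
  fixes c :: "real \<Rightarrow> real^'d \<Rightarrow> (real^'d) measure \<Rightarrow> 'b::topological_space"
  assumes c: "(\<lambda>(t, x, \<mu>). c t x \<mu>) \<in>
      borel_of (prod_topology (top_of_set {0..T}) (prod_topology euclidean (narrow_topology euclidean)))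
        \<rightarrow>\<^sub>M borel"
    and t: "0 \<le> t" "t \<le> T"
  shows "(\<lambda>z. c (clip t (snd z)) (snd (fst z) (clip t (snd z))) (time_marginal (fst (fst z)) (clip t (snd z))))
    \<in> borel_measurable ((law_borel T \<Otimes>\<^sub>M path_filtration T t) \<Otimes>\<^sub>M borel)"
proof -
  let ?M = "(law_borel T \<Otimes>\<^sub>M path_filtration T t) \<Otimes>\<^sub>M borel ::
    (((real \<Rightarrow> real^'d) measure \<times> (real \<Rightarrow> real^'d)) \<times> real) measure"
  have clipT: "clip t r \<in> {0..T}" for r using clip_in[OF t(1), of r] t(2) by auto
  have sc: "second_countable (narrow_topology (euclidean :: (real^'d) topology))"
    by (intro second_countable_narrow_topology metrizable_space_euclidean second_countable_euclidean)
  have 1: "(\<lambda>z. clip t (snd z)) \<in> ?M \<rightarrow>\<^sub>M borel_of (top_of_set {0..T})"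
    by (rule measurable_into_borel_of_top_of_set) (measurable, rule clipT)
  have "(\<lambda>z. (snd (fst z), snd z)) \<in> ?M \<rightarrow>\<^sub>M path_filtration T t \<Otimes>\<^sub>M borel"
    by measurable
  from measurable_compose[OF this measurable_eval_joint[OF t]]
  have 2: "(\<lambda>z. snd (fst z) (clip t (snd z))) \<in> ?M \<rightarrow>\<^sub>M borel_of euclidean"
    by simp
  have "(\<lambda>z. (fst (fst z), snd z)) \<in> ?M \<rightarrow>\<^sub>M law_borel T \<Otimes>\<^sub>M borel"
    by measurable
  from measurable_compose[OF this measurable_time_marginal[OF t]]
  have 3: "(\<lambda>z. time_marginal (fst (fst z)) (clip t (snd z))) \<in> ?M \<rightarrow>\<^sub>M borel_of (narrow_topology euclidean)"
    by simp
  have "(\<lambda>z. (clip t (snd z), snd (fst z) (clip t (snd z)), time_marginal (fst (fst z)) (clip t (snd z)))) \<in>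
    ?M \<rightarrow>\<^sub>M borel_of (prod_topology (top_of_set {0..T}) (prod_topology euclidean (narrow_topology euclidean)))"
    by (intro measurable_Pair_borel_of 1 2 3 second_countable_prod_topology sc
        second_countable_subtopology second_countable_euclidean)
  from measurable_compose[OF this c] show ?thesis by simp
qed

section \<open>Test functions\<close>

lemma C1_compact_supp_continuous:
  assumes "\<xi> \<in> C1_compact_supp T"
  shows "continuous_on UNIV \<xi>" "continuous_on UNIV (deriv \<xi>)"
proof -
  obtain D where D: "\<And>x. (\<xi> has_vector_derivative D x) (at x)" "continuous_on UNIV D"
    using assms by (auto simp: C1_compact_supp_def C1_differentiable_on_def)
  then have "deriv \<xi> = D"
    by (auto simp: fun_eq_iff has_real_derivative_iff_has_vector_derivative[symmetric] intro: DERIV_imp_deriv)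
  with D(2) show "continuous_on UNIV (deriv \<xi>)" by simp
  show "continuous_on UNIV \<xi>"
    using D(1) by (auto intro!: continuous_at_imp_continuous_on has_vector_derivative_continuous)
qed

lemma C2_compact_supp_continuous:
  assumes "\<phi> \<in> C2_compact_supp"
  shows "continuous_on UNIV \<phi>" "continuous_on UNIV (grad \<phi>)" "continuous_on UNIV (hess \<phi>)"
  using assms by (auto simp: C2_compact_supp_def intro!: continuous_at_imp_continuous_on differentiable_imp_continuous_within)

lemma frechet_derivative_outside_support:
  fixes f :: "'a::real_normed_vector \<Rightarrow> 'b::real_normed_vector"
  assumes "closed K" "\<And>y. y \<notin> K \<Longrightarrow> f y = 0" "x \<notin> K"
  shows "frechet_derivative f (at x) = (\<lambda>_. 0)"
proof -
  have "(f has_derivative (\<lambda>_. 0)) (at x)"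
    by (rule has_derivative_transform_within_open[of "\<lambda>_. 0" _ _ _ "- K"]) (use assms in auto)
  then show ?thesis by (metis frechet_derivative_at)
qed

text \<open>The gradient vanishes on the whole open complement of \<open>K\<close>, so the argument
  for the first derivative applies to it again.\<close>

lemma C2_compact_supp_vanish:
  assumes "closed K" "\<And>y. y \<notin> K \<Longrightarrow> \<phi> y = 0" "x \<notin> K"
  shows "\<phi> x = 0" "grad \<phi> x = 0" "hess \<phi> x = 0"
proof -
  show "\<phi> x = 0" using assms by simp
  have g: "grad \<phi> y = 0" if "y \<notin> K" for y
    using frechet_derivative_outside_support[OF assms(1,2) that] by (simp add: grad_def vec_eq_iff)
  then show "grad \<phi> x = 0" using assms by simp
  have "frechet_derivative (\<lambda>y. grad \<phi> y $ i) (at x) = (\<lambda>_. 0)" for i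
    by (rule frechet_derivative_outside_support[OF assms(1) _ assms(3)]) (simp add: g)
  then show "hess \<phi> x = 0" by (simp add: hess_def vec_eq_iff)
qed

text \<open>Gives access to Cauchy-Schwarz and to the measurability and limit rules of the inner
  product.\<close>

lemma frob_eq_inner: "frob A B = A \<bullet> B"
  by (simp add: frob_def inner_vec_def)

section \<open>The martingale problem process\<close>

definition mp_integrand ::
  "(real \<Rightarrow> real^'d \<Rightarrow> (real^'d) measure \<Rightarrow> real^'d) \<Rightarrow>
   (real \<Rightarrow> real^'d \<Rightarrow> (real^'d) measure \<Rightarrow> real^'d^'d) \<Rightarrow>
   (real \<Rightarrow> real^'d) measure \<Rightarrow> (real \<Rightarrow> real) \<Rightarrow> (real^'d \<Rightarrow> real) \<Rightarrow>
   (real \<Rightarrow> real^'d) \<Rightarrow> real \<Rightarrow> real" where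
  "mp_integrand b a \<Lambda> \<xi> \<phi> \<gamma> r = deriv \<xi> r * \<phi> (\<gamma> r) + \<xi> r * gen b a \<Lambda> r \<phi> (\<gamma> r)"

text \<open>The integrand of the integrability condition in \<open>MP\<close>; up to constants it
  dominates every \<open>mp_integrand\<close>.\<close>

definition mp_density ::
  "(real \<Rightarrow> real^'d \<Rightarrow> (real^'d) measure \<Rightarrow> real^'d) \<Rightarrow>
   (real \<Rightarrow> real^'d \<Rightarrow> (real^'d) measure \<Rightarrow> real^'d^'d) \<Rightarrow>
   (real \<Rightarrow> real^'d) measure \<Rightarrow> (real \<Rightarrow> real^'d) \<Rightarrow> real \<Rightarrow> real" where
  "mp_density b a \<Lambda> \<gamma> t =
     norm (b t (\<gamma> t) (time_marginal \<Lambda> t)) / (1 + norm (\<gamma> t)) +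
     norm (a t (\<gamma> t) (time_marginal \<Lambda> t)) / (1 + (norm (\<gamma> t))\<^sup>2)"

locale mp_coefficients =
  fixes T :: real
    and b :: "real \<Rightarrow> real^'d \<Rightarrow> (real^'d) measure \<Rightarrow> real^'d"
    and a :: "real \<Rightarrow> real^'d \<Rightarrow> (real^'d) measure \<Rightarrow> real^'d^'d"
  assumes T: "0 < T"
    and b: "(\<lambda>(t, x, \<mu>). b t x \<mu>) \<in>
      borel_of (prod_topology (top_of_set {0..T}) (prod_topology euclidean (narrow_topology euclidean)))
        \<rightarrow>\<^sub>M borel"
    and a: "(\<lambda>(t, x, \<mu>). a t x \<mu>) \<in>
      borel_of (prod_topology (top_of_set {0..T}) (prod_topology euclidean (narrow_topology euclidean)))
        \<rightarrow>\<^sub>M borel"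
begin

lemma measurable_mp_integrand:
  assumes t: "0 \<le> t" "t \<le> T" and \<xi>: "\<xi> \<in> C1_compact_supp T" and \<phi>: "\<phi> \<in> C2_compact_supp"
  shows "(\<lambda>z. indicator {0..t} (snd z) *\<^sub>R mp_integrand b a (fst (fst z)) \<xi> \<phi> (snd (fst z)) (snd z))
    \<in> borel_measurable ((law_borel T \<Otimes>\<^sub>M path_filtration T t) \<Otimes>\<^sub>M borel)"
proof -
  note [measurable] = borel_measurable_continuous_onI[OF C1_compact_supp_continuous(1)[OF \<xi>]]
    borel_measurable_continuous_onI[OF C1_compact_supp_continuous(2)[OF \<xi>]]
    borel_measurable_continuous_onI[OF C2_compact_supp_continuous(1)[OF \<phi>]]
    borel_measurable_continuous_onI[OF C2_compact_supp_continuous(2)[OF \<phi>]]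
    borel_measurable_continuous_onI[OF C2_compact_supp_continuous(3)[OF \<phi>]]
    measurable_coefficient[OF b t] measurable_coefficient[OF a t]
  let ?M = "(law_borel T \<Otimes>\<^sub>M path_filtration T t) \<Otimes>\<^sub>M borel ::
    (((real \<Rightarrow> real^'d) measure \<times> (real \<Rightarrow> real^'d)) \<times> real) measure"
  have "(\<lambda>z. (snd (fst z), snd z)) \<in> ?M \<rightarrow>\<^sub>M path_filtration T t \<Otimes>\<^sub>M borel"
    by measurable
  from measurable_compose[OF this measurable_eval_joint[OF t]]
  have [measurable]: "(\<lambda>z. snd (fst z) (clip t (snd z))) \<in> ?M \<rightarrow>\<^sub>M borel"
    by simp
  have clipped: "(\<lambda>z. indicator {0..t} (snd z) *\<^sub>R
      mp_integrand b a (fst (fst z)) \<xi> \<phi> (snd (fst z)) (clip t (snd z))) \<in> borel_measurable ?M"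
    unfolding mp_integrand_def gen_def frob_eq_inner by measurable
  \<comment> \<open>The indicator removes all times at which clipping has an effect.\<close>
  have "indicator {0..t} (snd z) *\<^sub>R
      mp_integrand b a (fst (fst z)) \<xi> \<phi> (snd (fst z)) (clip t (snd z)) =
      indicator {0..t} (snd z) *\<^sub>R mp_integrand b a (fst (fst z)) \<xi> \<phi> (snd (fst z)) (snd z)"
    for z :: "((real \<Rightarrow> real^'d) measure \<times> (real \<Rightarrow> real^'d)) \<times> real"
    by (auto simp: indicator_def clip_id)
  with clipped show ?thesis by (simp only:)
qed

lemma measurable_mp_density:
  "(\<lambda>z. indicator {0..T} (snd z) * mp_density b a (fst (fst z)) (snd (fst z)) (snd z))
    \<in> borel_measurable ((law_borel T \<Otimes>\<^sub>M path_borel T) \<Otimes>\<^sub>M borel)"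
proof -
  have t: "0 \<le> T" "T \<le> T" using T by auto
  note [measurable] = measurable_coefficient[OF b t] measurable_coefficient[OF a t]
  let ?M = "(law_borel T \<Otimes>\<^sub>M path_filtration T T) \<Otimes>\<^sub>M borel ::
    (((real \<Rightarrow> real^'d) measure \<times> (real \<Rightarrow> real^'d)) \<times> real) measure"
  have "(\<lambda>z. (snd (fst z), snd z)) \<in> ?M \<rightarrow>\<^sub>M path_filtration T T \<Otimes>\<^sub>M borel"
    by measurable
  from measurable_compose[OF this measurable_eval_joint[OF t]]
  have [measurable]: "(\<lambda>z. snd (fst z) (clip T (snd z))) \<in> ?M \<rightarrow>\<^sub>M borel"
    by simp
  have clipped: "(\<lambda>z. indicator {0..T} (snd z) * mp_density b a (fst (fst z)) (snd (fst z)) (clip T (snd z)))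
      \<in> borel_measurable ?M"
    unfolding mp_density_def by measurable
  have "indicator {0..T} (snd z) * mp_density b a (fst (fst z)) (snd (fst z)) (clip T (snd z)) =
      indicator {0..T} (snd z) * mp_density b a (fst (fst z)) (snd (fst z)) (snd z)"
    for z :: "((real \<Rightarrow> real^'d) measure \<times> (real \<Rightarrow> real^'d)) \<times> real"
    by (auto simp: indicator_def clip_id)
  with clipped have density: "(\<lambda>z. indicator {0..T} (snd z) * mp_density b a (fst (fst z)) (snd (fst z)) (snd z))
      \<in> borel_measurable ?M"
    by (simp only:)
  \<comment> \<open>The path factor is brought into the last position, where
    \<open>measurable_from_path_filtration\<close> can enlarge its \<sigma>-algebra, and is then put
    back.\<close>
  have "(\<lambda>z. ((fst (fst z), snd z), snd (fst z))) \<in>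
      (law_borel T \<Otimes>\<^sub>M borel) \<Otimes>\<^sub>M path_filtration T T \<rightarrow>\<^sub>M ?M"
    by measurable
  from measurable_compose[OF this density]
  have "(\<lambda>z. indicator {0..T} (snd (fst z)) * mp_density b a (fst (fst z)) (snd z) (snd (fst z)))
      \<in> borel_measurable ((law_borel T \<Otimes>\<^sub>M borel) \<Otimes>\<^sub>M path_filtration T T)"
    by simp
  note density' = measurable_from_path_filtration[OF this order_refl]
  have "(\<lambda>z. ((fst (fst z), snd z), snd (fst z))) \<in>
      (law_borel T \<Otimes>\<^sub>M path_borel T) \<Otimes>\<^sub>M borel \<rightarrow>\<^sub>M
      ((law_borel T \<Otimes>\<^sub>M borel) \<Otimes>\<^sub>M path_borel T ::
    (((real \<Rightarrow> real^'d) measure \<times> real) \<times> (real \<Rightarrow> real^'d)) measure)"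
    by measurable
  from measurable_compose[OF this density'] show ?thesis
    by simp
qed

lemma mp_process_eq:
  "mp_process b a \<Lambda> \<xi> \<phi> t \<gamma> = \<xi> t * \<phi> (\<gamma> t) - (LINT r:{0..t}|lborel. mp_integrand b a \<Lambda> \<xi> \<phi> \<gamma> r)"
  by (simp add: mp_process_def mp_integrand_def)

text \<open>Serves two purposes: its section at a fixed law is adaptedness, and after enlarging to
  the Borel sets of paths it yields measurability of test integrals in the law.\<close>

lemma measurable_mp_process:
  assumes t: "0 \<le> t" "t \<le> T" and \<xi>: "\<xi> \<in> C1_compact_supp T" and \<phi>: "\<phi> \<in> C2_compact_supp"
  shows "(\<lambda>(\<Lambda>, \<gamma>). mp_process b a \<Lambda> \<xi> \<phi> t \<gamma>) \<in> borel_measurable (law_borel T \<Otimes>\<^sub>M path_filtration T t)"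
proof -
  have [measurable]: "\<phi> \<in> borel_measurable borel"
    by (rule borel_measurable_continuous_onI[OF C2_compact_supp_continuous(1)[OF \<phi>]])
  have [measurable]: "(\<lambda>\<gamma> :: real \<Rightarrow> real^'d. \<gamma> t) \<in> borel_measurable (path_filtration T t)"
    using t by (intro measurable_eval_path_filtration) auto
  have "(\<lambda>x. LINT r|lborel. indicator {0..t} r *\<^sub>R mp_integrand b a (fst x) \<xi> \<phi> (snd x) r)
      \<in> borel_measurable (law_borel T \<Otimes>\<^sub>M path_filtration T t)"
  proof (rule sigma_finite_measure.borel_measurable_lebesgue_integral)
    show "sigma_finite_measure (lborel :: real measure)" by (rule sigma_finite_lborel)
    show "(\<lambda>(x, r). indicator {0..t} r *\<^sub>R mp_integrand b a (fst x) \<xi> \<phi> (snd x) r)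
      \<in> borel_measurable ((law_borel T \<Otimes>\<^sub>M path_filtration T t) \<Otimes>\<^sub>M lborel)"
      using measurable_mp_integrand[OF assms]
      by (simp add: case_prod_beta' cong: measurable_cong_sets)
  qed
  then show ?thesis
    unfolding mp_process_eq set_lebesgue_integral_def case_prod_beta' by measurable
qed

end

section \<open>Countable families of test functions\<close>

text \<open>Indices are classed by a modulus of continuity, an accuracy, and approximate values from
  a countable dense set on a finite net of \<open>K\<close>. There are countably many classes, and
  one index is picked from each nonempty one. Picking inside \<open>S\<close> keeps the approximants
  admissible: when \<open>F i\<close> bundles a test function with its derivatives, the approximants
  are again test functions and their derivatives converge along with them.\<close>

lemma separable_continuous_functions:
  fixes F :: "'i \<Rightarrow> 'a::metric_space \<Rightarrow> 'b::{metric_space, second_countable_topology}"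
  assumes K: "compact K" and F: "\<forall>i\<in>S. continuous_on K (F i)"
  shows "\<exists>D. countable D \<and> D \<subseteq> S \<and>
    (\<forall>i\<in>S. \<forall>\<epsilon>>0. \<exists>j\<in>D. \<forall>x\<in>K. dist (F j x) (F i x) < \<epsilon>)"
proof -
  obtain Q :: "'b set" where Q: "countable Q" "\<And>U. open U \<Longrightarrow> U \<noteq> {} \<Longrightarrow> \<exists>q\<in>Q. q \<in> U"
    using countable_dense_exists by blast
  have "\<exists>k. finite k \<and> k \<subseteq> K \<and> K \<subseteq> (\<Union>x\<in>k. ball x (inverse (real (Suc m))))" for m
    using seq_compact_imp_totally_bounded[OF compact_imp_seq_compact[OF K]] by simp
  then obtain P where P: "\<And>m. finite (P m)" "\<And>m. P m \<subseteq> K"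
    "\<And>m. K \<subseteq> (\<Union>x\<in>P m. ball x (inverse (real (Suc m))))"
    by metis
  \<comment> \<open>\<open>m\<close> fixes the modulus and the net \<open>P m\<close>,
    \<open>n\<close> the accuracy. Any two indices of one class are closer than
    \<open>4 / (n + 1)\<close> on all of \<open>K\<close>.\<close>
  define A where "A = (\<lambda>(m, n, g). {i \<in> S.
      (\<forall>x\<in>K. \<forall>y\<in>K. dist x y < inverse (real (Suc m)) \<longrightarrow> dist (F i x) (F i y) < inverse (real (Suc n))) \<and>
      (\<forall>p\<in>P m. dist (g p) (F i p) < inverse (real (Suc n)))})"
  define I where "I = (SIGMA m:UNIV. SIGMA n:(UNIV :: nat set). P m \<rightarrow>\<^sub>E Q)"
  have "countable I"
    unfolding I_def using P(1) Q(1) by (intro countable_SIGMA countable_PiE) auto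
  define D where "D = (\<lambda>k. SOME i. i \<in> A k) ` {k \<in> I. A k \<noteq> {}}"
  have some: "(SOME i. i \<in> A k) \<in> A k" if "A k \<noteq> {}" for k
    using that by (simp add: some_in_eq)
  show ?thesis
  proof (intro exI[of _ D] conjI ballI allI impI)
    show "countable D" unfolding D_def using \<open>countable I\<close> by simp
    show "D \<subseteq> S"
    proof
      fix i assume "i \<in> D"
      then obtain k where "i = (SOME i. i \<in> A k)" "A k \<noteq> {}" unfolding D_def by blast
      then have "i \<in> A k" using some by simp
      then show "i \<in> S" by (cases k) (auto simp: A_def)
    qed
    fix i and \<epsilon> :: real assume i: "i \<in> S" and \<epsilon>: "0 < \<epsilon>"
    \<comment> \<open>The comparison of \<open>j\<close> with \<open>i\<close> passes through a net
      point and the class value there: four distances, hence \<open>\<epsilon> / 4\<close>.\<close>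
    obtain n where n: "inverse (real (Suc n)) < \<epsilon> / 4"
      using reals_Archimedean[of "\<epsilon> / 4"] \<epsilon> by auto
    have "uniformly_continuous_on K (F i)"
      by (rule compact_uniformly_continuous[OF F[rule_format, OF i] K])
    then obtain \<delta> where \<delta>: "0 < \<delta>"
      "\<And>x y. x \<in> K \<Longrightarrow> y \<in> K \<Longrightarrow> dist x y < \<delta> \<Longrightarrow> dist (F i x) (F i y) < inverse (real (Suc n))"
      unfolding uniformly_continuous_on_def by (metis dist_commute inverse_positive_iff_positive of_nat_0_less_iff zero_less_Suc)
    obtain m where m: "inverse (real (Suc m)) < \<delta>"
      using reals_Archimedean[OF \<delta>(1)] by auto
    have "\<exists>q\<in>Q. q \<in> ball (F i p) (inverse (real (Suc n)))" for p
      by (rule Q(2)) auto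
    then obtain g0 where g0: "\<And>p. g0 p \<in> Q" "\<And>p. dist (F i p) (g0 p) < inverse (real (Suc n))"
      by (metis mem_ball)
    define k where "k = (m, n, restrict g0 (P m))"
    have "k \<in> I" using g0 by (auto simp: I_def k_def)
    have ik: "i \<in> A k"
      using i \<delta>(2) m g0(2) by (auto simp: A_def k_def dist_commute)
    define j where "j = (SOME i. i \<in> A k)"
    have jk: "j \<in> A k" unfolding j_def using some ik by blast
    have "j \<in> D" unfolding D_def j_def using \<open>k \<in> I\<close> ik by blast
    moreover have "dist (F j x) (F i x) < \<epsilon>" if x: "x \<in> K" for x
    proof -
      obtain p where p: "p \<in> P m" "dist p x < inverse (real (Suc m))"
        using P(3)[of m] x by auto
      then have pK: "p \<in> K" using P(2) by blast
      have near: "dist (F l p) (F l x) < \<epsilon> / 4" "dist (restrict g0 (P m) p) (F l p) < \<epsilon> / 4"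
        if "l \<in> A k" for l
      proof -
        have "dist (F l p) (F l x) < inverse (real (Suc n))"
          "dist (restrict g0 (P m) p) (F l p) < inverse (real (Suc n))"
          using that p pK x unfolding A_def k_def by auto
        with n show "dist (F l p) (F l x) < \<epsilon> / 4" "dist (restrict g0 (P m) p) (F l p) < \<epsilon> / 4"
          by linarith+
      qed
      have "dist (F j x) (F i x) \<le> dist (F j p) (F j x) + dist (restrict g0 (P m) p) (F j p)
          + dist (restrict g0 (P m) p) (F i p) + dist (F i p) (F i x)"
        by metric
      then show ?thesis
        using near[OF jk] near[OF ik] by linarith
    qed
    ultimately show "\<exists>j\<in>D. \<forall>x\<in>K. dist (F j x) (F i x) < \<epsilon>" by blast
  qed
qed

lemma separable_continuous_functions_sequence:
  fixes F :: "'i \<Rightarrow> 'a::metric_space \<Rightarrow> 'b::{metric_space, second_countable_topology}"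
  assumes K: "compact K" and F: "\<forall>i\<in>S. continuous_on K (F i)"
  shows "\<exists>D. countable D \<and> D \<subseteq> S \<and>
    (\<forall>i\<in>S. \<exists>j. range j \<subseteq> D \<and> uniform_limit K (\<lambda>n. F (j n)) (F i) sequentially)"
proof -
  obtain D where D: "countable D" "D \<subseteq> S"
    "\<forall>i\<in>S. \<forall>\<epsilon>>0. \<exists>j\<in>D. \<forall>x\<in>K. dist (F j x) (F i x) < \<epsilon>"
    using separable_continuous_functions[where F = F and S = S, OF assms] by (elim exE conjE)
  show ?thesis
  proof (intro exI[of _ D] conjI ballI)
    fix i assume i: "i \<in> S"
    have "\<exists>j. j \<in> D \<and> (\<forall>x\<in>K. dist (F j x) (F i x) < inverse (real (Suc n)))" for n
      using D(3)[rule_format, OF i, of "inverse (real (Suc n))"] by auto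
    then obtain j where j: "\<And>n. j n \<in> D" "\<And>n x. x \<in> K \<Longrightarrow> dist (F (j n) x) (F i x) < inverse (real (Suc n))"
      by metis
    have "uniform_limit K (\<lambda>n. F (j n)) (F i) sequentially"
      unfolding uniform_limit_sequentially_iff
    proof (intro allI impI)
      fix e :: real assume "0 < e"
      then obtain N where N: "inverse (real (Suc N)) < e" using reals_Archimedean by blast
      have "dist (F (j n) x) (F i x) < e" if "N \<le> n" "x \<in> K" for n x
      proof -
        have "inverse (real (Suc n)) \<le> inverse (real (Suc N))" using that by simp
        with j(2)[OF that(2), of n] N show ?thesis by linarith
      qed
      then show "\<exists>N. \<forall>n\<ge>N. \<forall>x\<in>K. dist (F (j n) x) (F i x) < e" by blast
    qed
    with j(1) show "\<exists>j. range j \<subseteq> D \<and> uniform_limit K (\<lambda>n. F (j n)) (F i) sequentially"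
      by blast
  qed (use D in auto)
qed

lemma uniform_limit_PairD:
  fixes f :: "'i \<Rightarrow> 'a \<Rightarrow> 'b::metric_space" and g :: "'i \<Rightarrow> 'a \<Rightarrow> 'c::metric_space"
  assumes "uniform_limit K (\<lambda>n x. (f n x, g n x)) (\<lambda>x. (f' x, g' x)) F"
  shows "uniform_limit K f f' F" "uniform_limit K g g' F"
proof -
  have *: "dist u u' \<le> dist (u, v) (u', v')" "dist v v' \<le> dist (u, v) (u', v')"
    for u u' :: 'b and v v' :: 'c
    using dist_fst_le[of "(u, v)" "(u', v')"] dist_snd_le[of "(u, v)" "(u', v')"] by auto
  show "uniform_limit K f f' F"
    by (rule metric_uniform_limit_imp_uniform_limit[OF assms]) (simp add: *)
  show "uniform_limit K g g' F"
    by (rule metric_uniform_limit_imp_uniform_limit[OF assms]) (simp add: *)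
qed

text \<open>Function and derivative are treated as one continuous map on the compact interval, which
  gives convergence of both along the same sequence.\<close>

lemma C1_compact_supp_separable:
  "\<exists>D. countable D \<and> D \<subseteq> C1_compact_supp T \<and>
    (\<forall>\<xi>\<in>C1_compact_supp T. \<exists>\<zeta>. range \<zeta> \<subseteq> D \<and>
      uniform_limit {0..T} \<zeta> \<xi> sequentially \<and>
      uniform_limit {0..T} (\<lambda>n. deriv (\<zeta> n)) (deriv \<xi>) sequentially)"
proof -
  have "\<forall>\<xi>\<in>C1_compact_supp T. continuous_on {0..T} (\<lambda>t. (\<xi> t, deriv \<xi> t))"
    by (intro ballI continuous_on_Pair) (meson C1_compact_supp_continuous continuous_on_subset subset_UNIV)+
  from separable_continuous_functions_sequence[where F = "\<lambda>\<xi> t. (\<xi> t, deriv \<xi> t)"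
      and S = "C1_compact_supp T", OF compact_Icc this]
  obtain D where D: "countable D" "D \<subseteq> C1_compact_supp T"
    "\<forall>\<xi>\<in>C1_compact_supp T. \<exists>\<zeta>. range \<zeta> \<subseteq> D \<and>
      uniform_limit {0..T} (\<lambda>n t. (\<zeta> n t, deriv (\<zeta> n) t)) (\<lambda>t. (\<xi> t, deriv \<xi> t)) sequentially"
    by (elim exE conjE)
  show ?thesis
  proof (intro exI[of _ D] conjI ballI)
    fix \<xi> assume "\<xi> \<in> C1_compact_supp T"
    with D(3) obtain \<zeta> where \<zeta>: "range \<zeta> \<subseteq> D"
      "uniform_limit {0..T} (\<lambda>n t. (\<zeta> n t, deriv (\<zeta> n) t)) (\<lambda>t. (\<xi> t, deriv \<xi> t)) sequentially"
      by blast
    then show "\<exists>\<zeta>. range \<zeta> \<subseteq> D \<and>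
      uniform_limit {0..T} \<zeta> \<xi> sequentially \<and>
      uniform_limit {0..T} (\<lambda>n. deriv (\<zeta> n)) (deriv \<xi>) sequentially"
      using uniform_limit_PairD[OF \<zeta>(2)] by blast
  qed (use D in auto)
qed

text \<open>Fixing the ball makes value, gradient and Hessian one continuous map on a compact set.
  Outside the ball all three vanish, so convergence on it is uniform on the whole space.\<close>

lemma C2_compact_supp_separable_cball:
  "\<exists>D :: (real^'d \<Rightarrow> real) set. countable D \<and>
    D \<subseteq> {\<phi> \<in> C2_compact_supp. \<forall>x. R < norm x \<longrightarrow> \<phi> x = 0} \<and>
    (\<forall>\<phi>\<in>C2_compact_supp. (\<forall>x. R < norm x \<longrightarrow> \<phi> x = 0) \<longrightarrow> (\<exists>\<psi>. range \<psi> \<subseteq> D \<and>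
      uniform_limit UNIV \<psi> \<phi> sequentially \<and>
      uniform_limit UNIV (\<lambda>n. grad (\<psi> n)) (grad \<phi>) sequentially \<and>
      uniform_limit UNIV (\<lambda>n. hess (\<psi> n)) (hess \<phi>) sequentially))"
proof -
  let ?S = "{\<phi> :: real^'d \<Rightarrow> real. \<phi> \<in> C2_compact_supp \<and> (\<forall>x. R < norm x \<longrightarrow> \<phi> x = 0)}"
  have "\<forall>\<phi>\<in>?S. continuous_on (cball 0 R) (\<lambda>x. (\<phi> x, grad \<phi> x, hess \<phi> x))"
    by (intro ballI continuous_on_Pair)
      (metis (no_types, lifting) C2_compact_supp_continuous continuous_on_subset mem_Collect_eq subset_UNIV)+
  from separable_continuous_functions_sequence[where F = "\<lambda>\<phi> x. (\<phi> x, grad \<phi> x, hess \<phi> x)"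
      and S = ?S, OF compact_cball this]
  obtain D where D: "countable D" "D \<subseteq> ?S"
    "\<forall>\<phi>\<in>?S. \<exists>\<psi>. range \<psi> \<subseteq> D \<and>
      uniform_limit (cball 0 R) (\<lambda>n x. (\<psi> n x, grad (\<psi> n) x, hess (\<psi> n) x))
        (\<lambda>x. (\<phi> x, grad \<phi> x, hess \<phi> x)) sequentially"
    by (elim exE conjE)
  have extend: "uniform_limit UNIV f g sequentially"
    if lim: "uniform_limit (cball 0 R) f g sequentially" and "\<And>n x. R < norm x \<Longrightarrow> f n x = 0" "\<And>x. R < norm x \<Longrightarrow> g x = 0"
    for f :: "nat \<Rightarrow> real^'d \<Rightarrow> 'e::real_normed_vector" and g
    unfolding uniform_limit_sequentially_iff
  proof (intro allI impI)
    fix e :: real assume "0 < e"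
    then obtain N where N: "\<And>n x. N \<le> n \<Longrightarrow> x \<in> cball 0 R \<Longrightarrow> dist (f n x) (g x) < e"
      using lim unfolding uniform_limit_sequentially_iff by metis
    have "dist (f n x) (g x) < e" if "N \<le> n" for n x
    proof (cases "norm x \<le> R")
      case False
      then show ?thesis using \<open>0 < e\<close> \<open>\<And>n x. R < norm x \<Longrightarrow> f n x = 0\<close> \<open>\<And>x. R < norm x \<Longrightarrow> g x = 0\<close> by simp
    qed (use N that in auto)
    then show "\<exists>N. \<forall>n\<ge>N. \<forall>x\<in>UNIV. dist (f n x) (g x) < e" by blast
  qed
  have van: "\<phi> x = 0" "grad \<phi> x = 0" "hess \<phi> x = 0" if "\<phi> \<in> ?S" "R < norm x" for \<phi> x
    using C2_compact_supp_vanish[of "cball 0 R" \<phi> x] that by auto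
  show ?thesis
  proof (intro exI[of _ D] conjI ballI impI)
    fix \<phi> :: "real^'d \<Rightarrow> real" assume \<phi>: "\<phi> \<in> C2_compact_supp" "\<forall>x. R < norm x \<longrightarrow> \<phi> x = 0"
    then have \<phi>S: "\<phi> \<in> ?S" by simp
    obtain \<psi> where \<psi>: "range \<psi> \<subseteq> D"
      "uniform_limit (cball 0 R) (\<lambda>n x. (\<psi> n x, grad (\<psi> n) x, hess (\<psi> n) x))
        (\<lambda>x. (\<phi> x, grad \<phi> x, hess \<phi> x)) sequentially"
      using bspec[OF D(3) \<phi>S] by (elim exE conjE)
    have \<psi>S: "\<psi> n \<in> ?S" for n using \<psi>(1) D(2) by blast
    note lim1 = uniform_limit_PairD(1)[OF \<psi>(2)]
      and lim2 = uniform_limit_PairD(1)[OF uniform_limit_PairD(2)[OF \<psi>(2)]]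
      and lim3 = uniform_limit_PairD(2)[OF uniform_limit_PairD(2)[OF \<psi>(2)]]
    have "uniform_limit UNIV \<psi> \<phi> sequentially"
      by (rule extend) (use lim1 van[OF \<psi>S] van[OF \<phi>S] in auto)
    moreover have "uniform_limit UNIV (\<lambda>n. grad (\<psi> n)) (grad \<phi>) sequentially"
      by (rule extend) (use lim2 van[OF \<psi>S] van[OF \<phi>S] in auto)
    moreover have "uniform_limit UNIV (\<lambda>n. hess (\<psi> n)) (hess \<phi>) sequentially"
      by (rule extend) (use lim3 van[OF \<psi>S] van[OF \<phi>S] in auto)
    ultimately show "\<exists>\<psi>. range \<psi> \<subseteq> D \<and>
      uniform_limit UNIV \<psi> \<phi> sequentially \<and>
      uniform_limit UNIV (\<lambda>n. grad (\<psi> n)) (grad \<phi>) sequentially \<and>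
      uniform_limit UNIV (\<lambda>n. hess (\<psi> n)) (hess \<phi>) sequentially"
      using \<psi>(1) by blast
  qed (use D in auto)
qed

lemma C2_compact_supp_bounded_support:
  assumes "\<phi> \<in> C2_compact_supp"
  obtains N :: nat where "\<forall>x. real N < norm x \<longrightarrow> \<phi> x = 0"
proof -
  have "bounded {x. \<phi> x \<noteq> 0}"
    using assms
    by (auto simp: C2_compact_supp_def intro: bounded_subset[OF compact_imp_bounded closure_subset])
  then obtain R where R: "\<And>x. \<phi> x \<noteq> 0 \<Longrightarrow> norm x \<le> R"
    by (auto simp: bounded_iff)
  obtain N :: nat where "R \<le> real N" using real_arch_simple by blast
  with R show thesis by (intro that[of N]) force
qed

text \<open>The countable families for integer radii are united. The radius common to the limit and
  its sequence matters later: on a fixed ball the weights of the integrability condition are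
  bounded.\<close>

lemma C2_compact_supp_separable:
  "\<exists>D :: (real^'d \<Rightarrow> real) set. countable D \<and> D \<subseteq> C2_compact_supp \<and>
    (\<forall>\<phi>\<in>C2_compact_supp. \<exists>\<psi> R. range \<psi> \<subseteq> D \<and> 0 \<le> R \<and>
      (\<forall>x. R < norm x \<longrightarrow> \<phi> x = 0) \<and> (\<forall>n x. R < norm x \<longrightarrow> \<psi> n x = 0) \<and>
      uniform_limit UNIV \<psi> \<phi> sequentially \<and>
      uniform_limit UNIV (\<lambda>n. grad (\<psi> n)) (grad \<phi>) sequentially \<and>
      uniform_limit UNIV (\<lambda>n. hess (\<psi> n)) (hess \<phi>) sequentially)"
proof -
  define P where "P = (\<lambda>N (D :: (real^'d \<Rightarrow> real) set). countable D \<and>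
      D \<subseteq> {\<phi> \<in> C2_compact_supp. \<forall>x. real N < norm x \<longrightarrow> \<phi> x = 0} \<and>
      (\<forall>\<phi>\<in>C2_compact_supp. (\<forall>x. real N < norm x \<longrightarrow> \<phi> x = 0) \<longrightarrow> (\<exists>\<psi>. range \<psi> \<subseteq> D \<and>
      uniform_limit UNIV \<psi> \<phi> sequentially \<and>
      uniform_limit UNIV (\<lambda>n. grad (\<psi> n)) (grad \<phi>) sequentially \<and>
      uniform_limit UNIV (\<lambda>n. hess (\<psi> n)) (hess \<phi>) sequentially)))"
  have "\<exists>D. P N D" for N
    unfolding P_def by (rule C2_compact_supp_separable_cball)
  then obtain D where PD: "\<And>N. P N (D N)" by metis
  note D = PD[unfolded P_def, THEN conjunct1]
    PD[unfolded P_def, THEN conjunct2, THEN conjunct1]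
    PD[unfolded P_def, THEN conjunct2, THEN conjunct2]
  show ?thesis
  proof (intro exI[of _ "\<Union>N. D N"] conjI ballI)
    show "countable (\<Union>N. D N)" using D(1) by auto
    show "(\<Union>N. D N) \<subseteq> C2_compact_supp" using D(2) by blast
    fix \<phi> :: "real^'d \<Rightarrow> real" assume \<phi>: "\<phi> \<in> C2_compact_supp"
    then obtain N :: nat where N: "\<forall>x. real N < norm x \<longrightarrow> \<phi> x = 0"
      by (rule C2_compact_supp_bounded_support)
    obtain \<psi> where \<psi>: "range \<psi> \<subseteq> D N" "uniform_limit UNIV \<psi> \<phi> sequentially"
      "uniform_limit UNIV (\<lambda>n. grad (\<psi> n)) (grad \<phi>) sequentially"
      "uniform_limit UNIV (\<lambda>n. hess (\<psi> n)) (hess \<phi>) sequentially"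
      using D(3)[of N, THEN bspec, OF \<phi>, THEN mp, OF N] by (elim exE conjE)
    have "\<forall>n x. real N < norm x \<longrightarrow> \<psi> n x = 0" using \<psi>(1) D(2)[of N] by blast
    then show "\<exists>\<psi> R. range \<psi> \<subseteq> (\<Union>N. D N) \<and> 0 \<le> R \<and>
      (\<forall>x. R < norm x \<longrightarrow> \<phi> x = 0) \<and> (\<forall>n x. R < norm x \<longrightarrow> \<psi> n x = 0) \<and>
      uniform_limit UNIV \<psi> \<phi> sequentially \<and>
      uniform_limit UNIV (\<lambda>n. grad (\<psi> n)) (grad \<phi>) sequentially \<and>
      uniform_limit UNIV (\<lambda>n. hess (\<psi> n)) (hess \<phi>) sequentially"
      using \<psi> N by (intro exI[of _ \<psi>] exI[of _ "real N"] conjI UN_upper subset_trans[OF \<psi>(1)]) auto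
  qed
qed

section \<open>Limits of the martingale problem process\<close>

text \<open>The tail stays within distance 1 of the bounded limit, and the sum of the individual
  bounds covers the finitely many earlier terms.\<close>

lemma uniform_limit_bounded_sequence:
  fixes f :: "nat \<Rightarrow> 'a \<Rightarrow> 'b::real_normed_vector"
  assumes lim: "uniform_limit K f g sequentially"
    and f: "\<And>n. bounded (f n ` K)" and g: "bounded (g ` K)"
  shows "\<exists>C. \<forall>n. \<forall>x\<in>K. norm (f n x) \<le> C"
proof -
  obtain N where N: "\<And>n x. N \<le> n \<Longrightarrow> x \<in> K \<Longrightarrow> dist (f n x) (g x) < 1"
    using lim unfolding uniform_limit_sequentially_iff by (metis zero_less_one)
  obtain c where c: "\<And>n x. x \<in> K \<Longrightarrow> norm (f n x) \<le> c n"
    using f unfolding bounded_iff by (metis imageI)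
  obtain c' where c': "\<And>x. x \<in> K \<Longrightarrow> norm (g x) \<le> c'"
    using g unfolding bounded_iff by (metis imageI)
  have "norm (f n x) \<le> \<bar>c'\<bar> + 1 + (\<Sum>i<N. \<bar>c i\<bar>)" if x: "x \<in> K" for n x
  proof (cases "n < N")
    case True
    have "\<bar>c n\<bar> \<le> (\<Sum>i<N. \<bar>c i\<bar>)"
      using True by (intro member_le_sum) auto
    then show ?thesis using c[OF x, of n] by linarith
  next
    case False
    have "norm (f n x) \<le> norm (g x) + dist (f n x) (g x)"
      by (metis dist_norm norm_triangle_sub)
    moreover have "0 \<le> (\<Sum>i<N. \<bar>c i\<bar>)" by (rule sum_nonneg) auto
    ultimately show ?thesis using N[of n x] c'[OF x] x False by linarith
  qed
  then show ?thesis by blast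
qed

text \<open>Test functions and times are approximated simultaneously, so functions and arguments
  move together.\<close>

lemma uniform_limit_tendsto_diagonal:
  assumes lim: "uniform_limit S f g sequentially" and x: "\<And>n. x n \<in> S" and g: "(\<lambda>n. g (x n)) \<longlonglongrightarrow> l"
  shows "(\<lambda>n. f n (x n)) \<longlonglongrightarrow> l"
proof (rule metric_LIMSEQ_I)
  fix e :: real assume "0 < e"
  then have e: "0 < e / 2" by simp
  obtain N1 where N1: "\<And>n. N1 \<le> n \<Longrightarrow> dist (f n (x n)) (g (x n)) < e / 2"
    using lim x e unfolding uniform_limit_sequentially_iff by metis
  obtain N2 where N2: "\<And>n. N2 \<le> n \<Longrightarrow> dist (g (x n)) l < e / 2"
    using metric_LIMSEQ_D[OF g e] by auto
  have "dist (f n (x n)) l < e" if "max N1 N2 \<le> n" for n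
    using N1[of n] N2[of n] that dist_triangle_half_r dist_triangle[of "f n (x n)" l "g (x n)"] by simp
  then show "\<exists>N. \<forall>n\<ge>N. dist (f n (x n)) l < e" by blast
qed

lemma bounded_range_vanishing:
  fixes f :: "real^'d \<Rightarrow> 'b::real_normed_vector"
  assumes "continuous_on UNIV f" "\<And>x. R < norm x \<Longrightarrow> f x = 0"
  shows "bounded (range f)"
proof -
  have "compact (f ` cball 0 R)"
    using assms(1) by (intro compact_continuous_image) (auto intro: continuous_on_subset)
  then have "bounded (insert 0 (f ` cball 0 R))"
    by (simp add: compact_imp_bounded)
  then show ?thesis
    by (rule bounded_subset) (use assms(2) in \<open>force simp: not_less\<close>)
qed

lemma mp_density_nonneg: "0 \<le> mp_density b a \<Lambda> \<gamma> t"
  unfolding mp_density_def by (intro add_nonneg_nonneg divide_nonneg_nonneg) auto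

text \<open>The support of the test function undoes the weights in \<open>mp_density\<close>: where
  \<open>norm x \<le> R\<close>, both \<open>1 + norm x\<close> and
  \<open>1 + (norm x)\<^sup>2\<close> are at most \<open>(1 + R)\<^sup>2\<close>, and elsewhere the
  integrand is 0. The summand 1 absorbs the term with \<open>deriv \<xi>\<close>, which contains no
  coefficient.\<close>

lemma mp_integrand_bound:
  assumes \<phi>: "\<And>x. \<bar>\<phi> x\<bar> \<le> C" "\<And>x. norm (grad \<phi> x) \<le> C" "\<And>x. norm (hess \<phi> x) \<le> C"
    and supp: "\<And>x. R < norm x \<Longrightarrow> \<phi> x = 0 \<and> grad \<phi> x = 0 \<and> hess \<phi> x = 0"
    and \<xi>: "\<bar>\<xi> r\<bar> \<le> B" "\<bar>deriv \<xi> r\<bar> \<le> B" and "0 \<le> R"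
  shows "\<bar>mp_integrand b a \<Lambda> \<xi> \<phi> \<gamma> r\<bar> \<le> B * C * (1 + R)\<^sup>2 * (1 + mp_density b a \<Lambda> \<gamma> r)"
proof -
  define x where "x = \<gamma> r"
  define \<alpha> where "\<alpha> = norm (a r x (time_marginal \<Lambda> r))"
  define \<beta> where "\<beta> = norm (b r x (time_marginal \<Lambda> r))"
  have B: "0 \<le> B" using \<xi>(1) by linarith
  have C: "0 \<le> C" using \<phi>(1)[of 0] by linarith
  have pos: "0 \<le> \<alpha>" "0 \<le> \<beta>" by (auto simp: \<alpha>_def \<beta>_def)
  show ?thesis
  proof (cases "norm x \<le> R")
    case True
    have "\<beta> \<le> (1 + R)\<^sup>2 * (\<beta> / (1 + norm x))"
    proof -
      have "1 + norm x \<le> (1 + R)\<^sup>2"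
        using True \<open>0 \<le> R\<close> by (simp add: power2_eq_square algebra_simps) (smt (verit) mult_nonneg_nonneg)
      then have "\<beta> * (1 + norm x) \<le> \<beta> * (1 + R)\<^sup>2"
        by (rule mult_left_mono) (rule pos)
      moreover have "0 < 1 + norm x" by (simp add: add_pos_nonneg)
      ultimately show ?thesis by (simp add: field_simps)
    qed
    moreover have "\<alpha> \<le> (1 + R)\<^sup>2 * (\<alpha> / (1 + (norm x)\<^sup>2))"
    proof -
      have "(norm x)\<^sup>2 \<le> R\<^sup>2" using True by (intro power_mono) auto
      moreover have "(1 + R)\<^sup>2 = 1 + 2 * R + R\<^sup>2" by (simp add: power2_eq_square algebra_simps)
      ultimately have "1 + (norm x)\<^sup>2 \<le> (1 + R)\<^sup>2" using \<open>0 \<le> R\<close> by linarith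
      then have "\<alpha> * (1 + (norm x)\<^sup>2) \<le> \<alpha> * (1 + R)\<^sup>2"
        by (rule mult_left_mono) (rule pos)
      moreover have "0 < 1 + (norm x)\<^sup>2" by (simp add: add_pos_nonneg)
      ultimately show ?thesis by (simp add: field_simps)
    qed
    moreover have "1 \<le> (1 + R)\<^sup>2" using \<open>0 \<le> R\<close> by simp
    ultimately have dens: "1 + (\<alpha> + \<beta>) \<le> (1 + R)\<^sup>2 * (1 + mp_density b a \<Lambda> \<gamma> r)"
      unfolding mp_density_def \<alpha>_def \<beta>_def x_def by (simp add: algebra_simps)
    have "\<bar>gen b a \<Lambda> r \<phi> x\<bar> \<le> \<alpha> * C + \<beta> * C"
    proof -
      have "\<bar>frob (a r x (time_marginal \<Lambda> r)) (hess \<phi> x)\<bar> \<le> \<alpha> * norm (hess \<phi> x)"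
        unfolding frob_eq_inner \<alpha>_def by (rule Cauchy_Schwarz_ineq2)
      also have "\<dots> \<le> \<alpha> * C" using pos \<phi>(3) by (intro mult_left_mono) auto
      finally have 1: "\<bar>frob (a r x (time_marginal \<Lambda> r)) (hess \<phi> x)\<bar> \<le> \<alpha> * C" .
      have "\<bar>b r x (time_marginal \<Lambda> r) \<bullet> grad \<phi> x\<bar> \<le> \<beta> * norm (grad \<phi> x)"
        unfolding \<beta>_def by (rule Cauchy_Schwarz_ineq2)
      also have "\<dots> \<le> \<beta> * C" using pos \<phi>(2) by (intro mult_left_mono) auto
      finally have 2: "\<bar>b r x (time_marginal \<Lambda> r) \<bullet> grad \<phi> x\<bar> \<le> \<beta> * C" .
      show ?thesis using 1 2 unfolding gen_def by linarith
    qed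
    then have "\<bar>\<xi> r * gen b a \<Lambda> r \<phi> x\<bar> \<le> B * (\<alpha> * C + \<beta> * C)"
      unfolding abs_mult using \<xi>(1) B by (intro mult_mono) auto
    moreover have "\<bar>deriv \<xi> r * \<phi> x\<bar> \<le> B * C"
      unfolding abs_mult using \<xi>(2) \<phi>(1) B by (intro mult_mono) auto
    ultimately have "\<bar>mp_integrand b a \<Lambda> \<xi> \<phi> \<gamma> r\<bar> \<le> B * C + B * (\<alpha> * C + \<beta> * C)"
      unfolding mp_integrand_def x_def by linarith
    also have "\<dots> = B * C * (1 + (\<alpha> + \<beta>))" by (simp add: algebra_simps)
    also have "\<dots> \<le> B * C * ((1 + R)\<^sup>2 * (1 + mp_density b a \<Lambda> \<gamma> r))"
      using dens B C by (intro mult_left_mono) auto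
    finally show ?thesis by (simp add: mult.assoc)
  next
    case False
    then have "mp_integrand b a \<Lambda> \<xi> \<phi> \<gamma> r = 0"
      using supp[of x] by (simp add: mp_integrand_def gen_def frob_eq_inner x_def)
    moreover have "0 \<le> B * C * (1 + R)\<^sup>2 * (1 + mp_density b a \<Lambda> \<gamma> r)"
      using B C mp_density_nonneg[of b a \<Lambda> \<gamma> r] by (intro mult_nonneg_nonneg) auto
    ultimately show ?thesis by simp
  qed
qed

section \<open>Laws that satisfy the integrability condition\<close>

context mp_coefficients
begin

definition finite_laws :: "(real \<Rightarrow> real^'d) measure set" where
  "finite_laws = {\<Lambda> \<in> borel_prob (path_topology T).
     (\<integral>\<^sup>+\<gamma>. (\<integral>\<^sup>+t\<in>{0..T}. ennreal (mp_density b a \<Lambda> \<gamma> t) \<partial>lborel) \<partial>\<Lambda>) < \<infinity>}"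

text \<open>As a Bochner integral it is real-valued on every path, with value 0 on those of infinite
  density. For laws in \<open>finite_laws\<close> the latter form a null set.\<close>

definition total_density :: "(real \<Rightarrow> real^'d) measure \<Rightarrow> (real \<Rightarrow> real^'d) \<Rightarrow> real" where
  "total_density \<Lambda> \<gamma> = (LINT r|lborel. indicator {0..T} r * mp_density b a \<Lambda> \<gamma> r)"

lemma measurable_integrand_time:
  assumes "\<Lambda> \<in> borel_prob (path_topology T)" "\<gamma> \<in> topspace (path_topology T)"
    and "0 \<le> t" "t \<le> T" "\<xi> \<in> C1_compact_supp T" "\<phi> \<in> C2_compact_supp"
  shows "(\<lambda>r. indicator {0..t} r *\<^sub>R mp_integrand b a \<Lambda> \<xi> \<phi> \<gamma> r) \<in> borel_measurable lborel"
  using measurable_Pair2[OF measurable_mp_integrand[OF assms(3-6)], of "(\<Lambda>, \<gamma>)"] assms(1,2)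
  by (simp add: space_pair_measure)

lemma measurable_density_time:
  assumes "\<Lambda> \<in> borel_prob (path_topology T)" "\<gamma> \<in> topspace (path_topology T)"
  shows "(\<lambda>r. indicator {0..T} r * mp_density b a \<Lambda> \<gamma> r) \<in> borel_measurable lborel"
  using measurable_Pair2[OF measurable_mp_density, of "(\<Lambda>, \<gamma>)"] assms
  by (simp add: space_pair_measure)

lemma nn_integral_density:
  "(\<integral>\<^sup>+t\<in>{0..T}. ennreal (mp_density b a \<Lambda> \<gamma> t) \<partial>lborel) =
   (\<integral>\<^sup>+t. ennreal (indicator {0..T} t * mp_density b a \<Lambda> \<gamma> t) \<partial>lborel)"
  by (intro nn_integral_cong) (auto simp: indicator_def)

lemma measurable_nn_density:
  "(\<lambda>(\<Lambda>, \<gamma>). \<integral>\<^sup>+t\<in>{0..T}. ennreal (mp_density b a \<Lambda> \<gamma> t) \<partial>lborel)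
    \<in> borel_measurable (law_borel T \<Otimes>\<^sub>M path_borel T)"
proof -
  have "(\<lambda>(x, t). ennreal (indicator {0..T} t * mp_density b a (fst x) (snd x) t))
      \<in> borel_measurable ((law_borel T \<Otimes>\<^sub>M path_borel T) \<Otimes>\<^sub>M lborel)"
    using measurable_mp_density by (simp add: case_prod_beta' cong: measurable_cong_sets)
  from sigma_finite_measure.borel_measurable_nn_integral[OF sigma_finite_lborel this]
  show ?thesis unfolding nn_integral_density by (simp add: case_prod_beta')
qed

text \<open>The law occurs both as the outer measure and, through its marginals, in the density, so
  joint measurability in law and path is what is integrated.\<close>

lemma sets_finite_laws: "finite_laws \<in> sets (law_borel T)"
proof -
  have [measurable]: "(\<lambda>\<Lambda>. \<integral>\<^sup>+\<gamma>. (\<integral>\<^sup>+t\<in>{0..T}. ennreal (mp_density b a \<Lambda> \<gamma> t) \<partial>lborel) \<partial>\<Lambda>)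
      \<in> borel_measurable (law_borel T)"
    by (rule nn_integral_measurable_subprob_algebra2[OF measurable_nn_density
          narrow_measurable_subprob_algebra[OF metrizable_path_topology]])
  have "{\<Lambda> \<in> space (law_borel T).
     (\<integral>\<^sup>+\<gamma>. (\<integral>\<^sup>+t\<in>{0..T}. ennreal (mp_density b a \<Lambda> \<gamma> t) \<partial>lborel) \<partial>\<Lambda>) < \<infinity>} \<in> sets (law_borel T)"
    by measurable
  then show ?thesis by (simp add: finite_laws_def)
qed

lemma measurable_law_section:
  assumes \<Lambda>: "\<Lambda> \<in> borel_prob (path_topology T)" and f: "f \<in> law_borel T \<Otimes>\<^sub>M path_borel T \<rightarrow>\<^sub>M M"
  shows "(\<lambda>\<gamma>. f (\<Lambda>, \<gamma>)) \<in> \<Lambda> \<rightarrow>\<^sub>M M"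
  using measurable_Pair2[OF f, of \<Lambda>] \<Lambda> by (simp cong: measurable_cong_sets add: borel_probD(2)[OF \<Lambda>])

lemma total_density_nonneg: "0 \<le> total_density \<Lambda> \<gamma>"
  unfolding total_density_def by (intro Bochner_Integration.integral_nonneg) (auto simp: mp_density_nonneg)

lemma
  assumes \<Lambda>: "\<Lambda> \<in> finite_laws"
  shows integrable_total_density: "integrable \<Lambda> (total_density \<Lambda>)"
    and AE_integrable_density:
      "AE \<gamma> in \<Lambda>. integrable lborel (\<lambda>r. indicator {0..T} r * mp_density b a \<Lambda> \<gamma> r)"
proof -
  have P: "\<Lambda> \<in> borel_prob (path_topology T)"
    and fin: "(\<integral>\<^sup>+\<gamma>. (\<integral>\<^sup>+t\<in>{0..T}. ennreal (mp_density b a \<Lambda> \<gamma> t) \<partial>lborel) \<partial>\<Lambda>) < \<infinity>"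
    using \<Lambda> by (auto simp: finite_laws_def)
  have meas: "(\<lambda>\<gamma>. \<integral>\<^sup>+t\<in>{0..T}. ennreal (mp_density b a \<Lambda> \<gamma> t) \<partial>lborel) \<in> borel_measurable \<Lambda>"
    using measurable_law_section[OF P measurable_nn_density] by simp
  \<comment> \<open>Valid on paths of infinite density as well: there both sides are 0 by
    convention.\<close>
  have eq: "total_density \<Lambda> \<gamma> = enn2real (\<integral>\<^sup>+t\<in>{0..T}. ennreal (mp_density b a \<Lambda> \<gamma> t) \<partial>lborel)"
    if "\<gamma> \<in> space \<Lambda>" for \<gamma>
    unfolding total_density_def nn_integral_density
    using that borel_probD(3)[OF P] mp_density_nonneg
    by (intro integral_eq_nn_integral measurable_density_time[OF P] AE_I2 mult_nonneg_nonneg mp_density_nonneg) auto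
  show "integrable \<Lambda> (total_density \<Lambda>)"
  proof (rule integrableI_bounded)
    show "total_density \<Lambda> \<in> borel_measurable \<Lambda>"
      using meas by (subst measurable_cong[OF eq]) auto
    have "(\<integral>\<^sup>+\<gamma>. ennreal (norm (total_density \<Lambda> \<gamma>)) \<partial>\<Lambda>) \<le>
        (\<integral>\<^sup>+\<gamma>. (\<integral>\<^sup>+t\<in>{0..T}. ennreal (mp_density b a \<Lambda> \<gamma> t) \<partial>lborel) \<partial>\<Lambda>)"
    proof (rule nn_integral_mono)
      fix \<gamma> assume "\<gamma> \<in> space \<Lambda>"
      then show "ennreal (norm (total_density \<Lambda> \<gamma>)) \<le> (\<integral>\<^sup>+t\<in>{0..T}. ennreal (mp_density b a \<Lambda> \<gamma> t) \<partial>lborel)"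
        by (simp add: eq ennreal_enn2real_if)
    qed
    then show "(\<integral>\<^sup>+\<gamma>. ennreal (norm (total_density \<Lambda> \<gamma>)) \<partial>\<Lambda>) < \<infinity>"
      using fin by (rule le_less_trans)
  qed
  have "AE \<gamma> in \<Lambda>. (\<integral>\<^sup>+t\<in>{0..T}. ennreal (mp_density b a \<Lambda> \<gamma> t) \<partial>lborel) \<noteq> \<infinity>"
    using fin by (intro nn_integral_PInf_AE meas) auto
  then show "AE \<gamma> in \<Lambda>. integrable lborel (\<lambda>r. indicator {0..T} r * mp_density b a \<Lambda> \<gamma> r)"
  proof (rule AE_mp, intro AE_I2 impI)
    fix \<gamma> assume \<gamma>: "\<gamma> \<in> space \<Lambda>"
      and "(\<integral>\<^sup>+t\<in>{0..T}. ennreal (mp_density b a \<Lambda> \<gamma> t) \<partial>lborel) \<noteq> \<infinity>"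
    then show "integrable lborel (\<lambda>r. indicator {0..T} r * mp_density b a \<Lambda> \<gamma> r)"
      using \<gamma> borel_probD(3)[OF P] mp_density_nonneg
      by (intro integrableI_nonneg measurable_density_time[OF P])
        (auto simp: nn_integral_density less_top intro!: AE_I2 mult_nonneg_nonneg mp_density_nonneg)
  qed
qed

lemma measurable_mp_process_law:
  assumes \<Lambda>: "\<Lambda> \<in> borel_prob (path_topology T)"
    and t: "t \<in> {0..T}" and \<xi>: "\<xi> \<in> C1_compact_supp T" and \<phi>: "\<phi> \<in> C2_compact_supp"
  shows "mp_process b a \<Lambda> \<xi> \<phi> t \<in> borel_measurable \<Lambda>"
proof -
  have "0 \<le> t" "t \<le> T" using t by auto
  from measurable_law_section[OF \<Lambda> measurable_from_path_filtration[OF measurable_mp_process[OF this \<xi> \<phi>] this(2)]]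
  show ?thesis by simp
qed

end

text \<open>Collects what the separability lemmas deliver for one pair of test functions, so that
  all bounds below are uniform in \<open>n\<close>. With constant sequences it also provides bounds
  for a single pair.\<close>

locale test_function_approximation = mp_coefficients T b a
  for T :: real
    and b :: "real \<Rightarrow> real^'d \<Rightarrow> (real^'d) measure \<Rightarrow> real^'d"
    and a :: "real \<Rightarrow> real^'d \<Rightarrow> (real^'d) measure \<Rightarrow> real^'d^'d" +
  fixes \<zeta> :: "nat \<Rightarrow> real \<Rightarrow> real" and \<xi> :: "real \<Rightarrow> real"
    and \<psi> :: "nat \<Rightarrow> real^'d \<Rightarrow> real" and \<phi> :: "real^'d \<Rightarrow> real" and R :: real
  assumes \<zeta>: "\<And>n. \<zeta> n \<in> C1_compact_supp T" and \<xi>: "\<xi> \<in> C1_compact_supp T"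
    and \<psi>: "\<And>n. \<psi> n \<in> C2_compact_supp" and \<phi>: "\<phi> \<in> C2_compact_supp"
    and R: "0 \<le> R" "\<And>x. R < norm x \<Longrightarrow> \<phi> x = 0" "\<And>n x. R < norm x \<Longrightarrow> \<psi> n x = 0"
    and lim: "uniform_limit {0..T} \<zeta> \<xi> sequentially"
      "uniform_limit {0..T} (\<lambda>n. deriv (\<zeta> n)) (deriv \<xi>) sequentially"
      "uniform_limit UNIV \<psi> \<phi> sequentially"
      "uniform_limit UNIV (\<lambda>n. grad (\<psi> n)) (grad \<phi>) sequentially"
      "uniform_limit UNIV (\<lambda>n. hess (\<psi> n)) (hess \<phi>) sequentially"
begin

lemma support:
  assumes "R < norm x"
  shows "\<phi> x = 0 \<and> grad \<phi> x = 0 \<and> hess \<phi> x = 0" "\<psi> n x = 0 \<and> grad (\<psi> n) x = 0 \<and> hess (\<psi> n) x = 0"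
  using C2_compact_supp_vanish[of "cball 0 R" \<phi> x] C2_compact_supp_vanish[of "cball 0 R" "\<psi> n" x] R assms
  by auto

lemma time_bound: "\<exists>B. \<forall>n. \<forall>r\<in>{0..T}. \<bar>\<zeta> n r\<bar> \<le> B \<and> \<bar>deriv (\<zeta> n) r\<bar> \<le> B"
proof -
  have bdd: "bounded (f ` {0..T})" if "continuous_on UNIV f" for f :: "real \<Rightarrow> real"
    using that by (intro compact_imp_bounded compact_continuous_image) (auto intro: continuous_on_subset)
  obtain B1 where B1: "\<And>n r. r \<in> {0..T} \<Longrightarrow> norm (\<zeta> n r) \<le> B1"
    using uniform_limit_bounded_sequence[OF lim(1)] bdd C1_compact_supp_continuous(1) \<zeta> \<xi> by metis
  obtain B2 where B2: "\<And>n r. r \<in> {0..T} \<Longrightarrow> norm (deriv (\<zeta> n) r) \<le> B2"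
    using uniform_limit_bounded_sequence[OF lim(2)] bdd C1_compact_supp_continuous(2) \<zeta> \<xi> by metis
  show ?thesis
    using B1 B2 by (intro exI[of _ "max B1 B2"]) (auto simp: le_max_iff_disj)
qed

lemma space_bound: "\<exists>C. \<forall>n x. \<bar>\<psi> n x\<bar> \<le> C \<and> norm (grad (\<psi> n) x) \<le> C \<and> norm (hess (\<psi> n) x) \<le> C"
proof -
  have "bounded (range (\<psi> n))" "bounded (range (grad (\<psi> n)))" "bounded (range (hess (\<psi> n)))" for n
    using C2_compact_supp_continuous[OF \<psi>[of n]] support(2)[of _ n] by (auto intro: bounded_range_vanishing)
  moreover have "bounded (range \<phi>)" "bounded (range (grad \<phi>))" "bounded (range (hess \<phi>))"
    using C2_compact_supp_continuous[OF \<phi>] support(1) by (auto intro: bounded_range_vanishing)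
  ultimately obtain C1 C2 C3 where "\<And>n x. norm (\<psi> n x) \<le> C1" "\<And>n x. norm (grad (\<psi> n) x) \<le> C2"
    "\<And>n x. norm (hess (\<psi> n) x) \<le> C3"
    using uniform_limit_bounded_sequence[OF lim(3)] uniform_limit_bounded_sequence[OF lim(4)]
      uniform_limit_bounded_sequence[OF lim(5)] by (metis UNIV_I)
  then show ?thesis
    by (intro exI[of _ "max C1 (max C2 C3)"]) (auto simp: le_max_iff_disj)
qed

lemma uniform_bound:
  obtains K where "0 \<le> K"
    "\<And>n r x. r \<in> {0..T} \<Longrightarrow> \<bar>\<zeta> n r * \<psi> n x\<bar> \<le> K"
    "\<And>n r \<Lambda> \<gamma>. r \<in> {0..T} \<Longrightarrow>
      \<bar>mp_integrand b a \<Lambda> (\<zeta> n) (\<psi> n) \<gamma> r\<bar> \<le> K * (1 + mp_density b a \<Lambda> \<gamma> r)"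
proof -
  obtain B where B: "\<And>n r. r \<in> {0..T} \<Longrightarrow> \<bar>\<zeta> n r\<bar> \<le> B \<and> \<bar>deriv (\<zeta> n) r\<bar> \<le> B"
    using time_bound by blast
  obtain C where C: "\<And>n x. \<bar>\<psi> n x\<bar> \<le> C \<and> norm (grad (\<psi> n) x) \<le> C \<and> norm (hess (\<psi> n) x) \<le> C"
    using space_bound by blast
  have B0: "0 \<le> B" using B[of 0 0] T by auto
  have C0: "0 \<le> C" using C[of 0 0] by linarith
  have "1 \<le> (1 + R)\<^sup>2" using R(1) by simp
  show thesis
  \<comment> \<open>The constant of \<open>mp_integrand_bound\<close>; as
    \<open>(1 + R)\<^sup>2\<close> is at least 1, it bounds \<open>\<zeta> n r * \<psi> n x\<close>
    too.\<close>
  proof (rule that[of "B * C * (1 + R)\<^sup>2"])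
    show "0 \<le> B * C * (1 + R)\<^sup>2" using B0 C0 by simp
    show "\<bar>\<zeta> n r * \<psi> n x\<bar> \<le> B * C * (1 + R)\<^sup>2" if "r \<in> {0..T}" for n r x
    proof -
      have "\<bar>\<zeta> n r * \<psi> n x\<bar> \<le> B * C"
        unfolding abs_mult using B[OF that] C B0 by (intro mult_mono) auto
      also have "\<dots> \<le> B * C * (1 + R)\<^sup>2"
        using mult_left_mono[OF \<open>1 \<le> (1 + R)\<^sup>2\<close>, of "B * C"] B0 C0 by simp
      finally show ?thesis .
    qed
    show "\<bar>mp_integrand b a \<Lambda> (\<zeta> n) (\<psi> n) \<gamma> r\<bar> \<le> B * C * (1 + R)\<^sup>2 * (1 + mp_density b a \<Lambda> \<gamma> r)"
      if "r \<in> {0..T}" for n r \<Lambda> \<gamma>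
      using B[OF that] C support(2) R(1) by (intro mp_integrand_bound) auto
  qed
qed

lemma mp_integrand_tendsto:
  assumes r: "r \<in> {0..T}"
  shows "(\<lambda>n. mp_integrand b a \<Lambda> (\<zeta> n) (\<psi> n) \<gamma> r) \<longlonglongrightarrow> mp_integrand b a \<Lambda> \<xi> \<phi> \<gamma> r"
  unfolding mp_integrand_def gen_def frob_eq_inner
  by (intro tendsto_intros tendsto_uniform_limitI[OF lim(1) r] tendsto_uniform_limitI[OF lim(2) r]
      tendsto_uniform_limitI[OF lim(3) UNIV_I] tendsto_uniform_limitI[OF lim(4) UNIV_I]
      tendsto_uniform_limitI[OF lim(5) UNIV_I])

lemma integrable_dominating:
  assumes "integrable lborel (\<lambda>r. indicator {0..T} r * mp_density b a \<Lambda> \<gamma> r)"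
  shows "integrable lborel (\<lambda>r. indicator {0..T} r * (1 + mp_density b a \<Lambda> \<gamma> r))"
    and "(LINT r|lborel. indicator {0..T} r * (1 + mp_density b a \<Lambda> \<gamma> r)) = T + total_density \<Lambda> \<gamma>"
proof -
  have i: "integrable lborel (indicator {0..T} :: real \<Rightarrow> real)"
    by (rule integrable_real_indicator) (use T in auto)
  have eq: "(\<lambda>r. indicator {0..T} r * (1 + mp_density b a \<Lambda> \<gamma> r)) =
      (\<lambda>r. indicator {0..T} r + indicator {0..T} r * mp_density b a \<Lambda> \<gamma> r)"
    by (auto simp: algebra_simps)
  show "integrable lborel (\<lambda>r. indicator {0..T} r * (1 + mp_density b a \<Lambda> \<gamma> r))"
    unfolding eq by (rule Bochner_Integration.integrable_add[OF i assms])
  show "(LINT r|lborel. indicator {0..T} r * (1 + mp_density b a \<Lambda> \<gamma> r)) = T + total_density \<Lambda> \<gamma>"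
    unfolding eq Bochner_Integration.integral_add[OF i assms] total_density_def using T by simp
qed

text \<open>The boundary term contributes \<open>K\<close>, and integrating
  \<open>K * (1 + mp_density)\<close> over \<open>{0..T}\<close> contributes the rest. The bound
  depends on neither \<open>n\<close> nor \<open>t\<close>, as dominated convergence over the law
  requires.\<close>

lemma mp_process_bound:
  obtains K where "0 \<le> K"
    "\<And>n t \<Lambda> \<gamma>. t \<in> {0..T} \<Longrightarrow> integrable lborel (\<lambda>r. indicator {0..T} r * mp_density b a \<Lambda> \<gamma> r) \<Longrightarrow>
      \<bar>mp_process b a \<Lambda> (\<zeta> n) (\<psi> n) t \<gamma>\<bar> \<le> K * (1 + T + total_density \<Lambda> \<gamma>)"
proof -
  obtain K where K: "0 \<le> K"
    "\<And>n r x. r \<in> {0..T} \<Longrightarrow> \<bar>\<zeta> n r * \<psi> n x\<bar> \<le> K"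
    "\<And>n r \<Lambda> \<gamma>. r \<in> {0..T} \<Longrightarrow>
      \<bar>mp_integrand b a \<Lambda> (\<zeta> n) (\<psi> n) \<gamma> r\<bar> \<le> K * (1 + mp_density b a \<Lambda> \<gamma> r)"
    using uniform_bound by metis
  have "\<bar>mp_process b a \<Lambda> (\<zeta> n) (\<psi> n) t \<gamma>\<bar> \<le> K * (1 + T + total_density \<Lambda> \<gamma>)"
    if t: "t \<in> {0..T}" and i: "integrable lborel (\<lambda>r. indicator {0..T} r * mp_density b a \<Lambda> \<gamma> r)" for n t \<Lambda> \<gamma>
  proof -
    let ?I = "LINT r:{0..t}|lborel. mp_integrand b a \<Lambda> (\<zeta> n) (\<psi> n) \<gamma> r"
    have "\<bar>?I\<bar> \<le> (LINT r|lborel. K * (indicator {0..T} r * (1 + mp_density b a \<Lambda> \<gamma> r)))"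
      unfolding set_lebesgue_integral_def real_norm_def[symmetric]
    proof (cases "integrable lborel (\<lambda>r. indicator {0..t} r *\<^sub>R mp_integrand b a \<Lambda> (\<zeta> n) (\<psi> n) \<gamma> r)")
      case True
      then show "norm (LINT r|lborel. indicator {0..t} r *\<^sub>R mp_integrand b a \<Lambda> (\<zeta> n) (\<psi> n) \<gamma> r)
          \<le> (LINT r|lborel. K * (indicator {0..T} r * (1 + mp_density b a \<Lambda> \<gamma> r)))"
        using K(1,3) t mp_density_nonneg[of b a \<Lambda> \<gamma>]
        by (intro Bochner_Integration.integral_norm_bound_integral integrable_mult_right integrable_dominating(1)[OF i])
          (auto simp: indicator_def)
    next
      \<comment> \<open>Here the default value counts: the Bochner integral of a non-integrable
        function is 0, and the bound is nonnegative.\<close>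
      case False
      have "0 \<le> (LINT r|lborel. K * (indicator {0..T} r * (1 + mp_density b a \<Lambda> \<gamma> r)))"
        using K(1) mp_density_nonneg[of b a \<Lambda> \<gamma>] by (intro Bochner_Integration.integral_nonneg) auto
      then show "norm (LINT r|lborel. indicator {0..t} r *\<^sub>R mp_integrand b a \<Lambda> (\<zeta> n) (\<psi> n) \<gamma> r)
          \<le> (LINT r|lborel. K * (indicator {0..T} r * (1 + mp_density b a \<Lambda> \<gamma> r)))"
        using not_integrable_integral_eq[OF False] by simp
    qed
    also have "\<dots> = K * (T + total_density \<Lambda> \<gamma>)"
      using integrable_dominating(2)[OF i] by simp
    finally have "\<bar>?I\<bar> \<le> K * (T + total_density \<Lambda> \<gamma>)" .
    moreover have "\<bar>\<zeta> n t * \<psi> n (\<gamma> t)\<bar> \<le> K" using K(2) t by auto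
    ultimately show ?thesis
      unfolding mp_process_eq by (simp add: algebra_simps)
  qed
  with K(1) that show thesis by blast
qed

text \<open>Dominated convergence in time along a fixed path, with both the test functions and the
  upper limit of integration varying. The boundary terms converge by continuity of the path.\<close>

lemma mp_process_tendsto:
  assumes \<Lambda>: "\<Lambda> \<in> borel_prob (path_topology T)" and \<gamma>: "\<gamma> \<in> topspace (path_topology T)"
    and i: "integrable lborel (\<lambda>r. indicator {0..T} r * mp_density b a \<Lambda> \<gamma> r)"
    and u: "\<And>n. u n \<in> {0..T}" "u \<longlonglongrightarrow> t" and t: "t \<in> {0..T}"
  shows "(\<lambda>n. mp_process b a \<Lambda> (\<zeta> n) (\<psi> n) (u n) \<gamma>) \<longlonglongrightarrow> mp_process b a \<Lambda> \<xi> \<phi> t \<gamma>"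
proof -
  obtain K where K: "0 \<le> K"
    "\<And>n r x. r \<in> {0..T} \<Longrightarrow> \<bar>\<zeta> n r * \<psi> n x\<bar> \<le> K"
    "\<And>n r \<Lambda> \<gamma>. r \<in> {0..T} \<Longrightarrow>
      \<bar>mp_integrand b a \<Lambda> (\<zeta> n) (\<psi> n) \<gamma> r\<bar> \<le> K * (1 + mp_density b a \<Lambda> \<gamma> r)"
    using uniform_bound by metis
  have \<gamma>u: "(\<lambda>n. \<gamma> (u n)) \<longlonglongrightarrow> \<gamma> t"
    by (rule continuous_on_tendsto_compose[OF continuous_on_path[OF \<gamma>] u(2) t]) (use u(1) in auto)
  have "(\<lambda>n. \<zeta> n (u n)) \<longlonglongrightarrow> \<xi> t"
    by (rule uniform_limit_tendsto_diagonal[OF lim(1) u(1)],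
        rule continuous_on_tendsto_compose[OF C1_compact_supp_continuous(1)[OF \<xi>] u(2)]) auto
  moreover have "(\<lambda>n. \<psi> n (\<gamma> (u n))) \<longlonglongrightarrow> \<phi> (\<gamma> t)"
    by (rule uniform_limit_tendsto_diagonal[OF lim(3) UNIV_I],
        rule continuous_on_tendsto_compose[OF C2_compact_supp_continuous(1)[OF \<phi>] \<gamma>u]) auto
  moreover have "(\<lambda>n. LINT r:{0..u n}|lborel. mp_integrand b a \<Lambda> (\<zeta> n) (\<psi> n) \<gamma> r) \<longlonglongrightarrow>
      (LINT r:{0..t}|lborel. mp_integrand b a \<Lambda> \<xi> \<phi> \<gamma> r)"
    unfolding set_lebesgue_integral_def
  proof (rule integral_dominated_convergence[where w = "\<lambda>r. K * (indicator {0..T} r * (1 + mp_density b a \<Lambda> \<gamma> r))"])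
    show "(\<lambda>r. indicator {0..t} r *\<^sub>R mp_integrand b a \<Lambda> \<xi> \<phi> \<gamma> r) \<in> borel_measurable lborel"
      using t by (intro measurable_integrand_time \<Lambda> \<gamma> \<xi> \<phi>) auto
    show "(\<lambda>r. indicator {0..u n} r *\<^sub>R mp_integrand b a \<Lambda> (\<zeta> n) (\<psi> n) \<gamma> r) \<in> borel_measurable lborel" for n
      using u(1)[of n] by (intro measurable_integrand_time \<Lambda> \<gamma> \<zeta> \<psi>) auto
    show "integrable lborel (\<lambda>r. K * (indicator {0..T} r * (1 + mp_density b a \<Lambda> \<gamma> r)))"
      by (intro integrable_mult_right integrable_dominating(1)[OF i])
    show "AE r in lborel. norm (indicator {0..u n} r *\<^sub>R mp_integrand b a \<Lambda> (\<zeta> n) (\<psi> n) \<gamma> r)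
        \<le> K * (indicator {0..T} r * (1 + mp_density b a \<Lambda> \<gamma> r))" for n
      using K(1,3) u(1)[of n] mp_density_nonneg[of b a \<Lambda> \<gamma>] by (intro AE_I2) (auto simp: indicator_def)
    \<comment> \<open>The indicators of \<open>{0..u n}\<close> are eventually constant at each
      \<open>r \<noteq> t\<close>; the point \<open>t\<close>, where they may oscillate, is a null
      set.\<close>
    show "AE r in lborel. (\<lambda>n. indicator {0..u n} r *\<^sub>R mp_integrand b a \<Lambda> (\<zeta> n) (\<psi> n) \<gamma> r)
        \<longlonglongrightarrow> indicator {0..t} r *\<^sub>R mp_integrand b a \<Lambda> \<xi> \<phi> \<gamma> r"
      using AE_lborel_singleton[of t]
    proof (rule AE_mp, intro AE_I2 impI)
      fix r assume "r \<noteq> t"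
      consider "r < 0" | "0 \<le> r" "r < t" | "t < r" using \<open>r \<noteq> t\<close> by linarith
      then show "(\<lambda>n. indicator {0..u n} r *\<^sub>R mp_integrand b a \<Lambda> (\<zeta> n) (\<psi> n) \<gamma> r)
        \<longlonglongrightarrow> indicator {0..t} r *\<^sub>R mp_integrand b a \<Lambda> \<xi> \<phi> \<gamma> r"
      proof cases
        case 2
        have "\<forall>\<^sub>F n in sequentially. r < u n" using order_tendstoD(1)[OF u(2) 2(2)] .
        then have "\<forall>\<^sub>F n in sequentially. mp_integrand b a \<Lambda> (\<zeta> n) (\<psi> n) \<gamma> r =
            indicator {0..u n} r *\<^sub>R mp_integrand b a \<Lambda> (\<zeta> n) (\<psi> n) \<gamma> r"
          by eventually_elim (use 2 in auto)
        moreover have "(\<lambda>n. mp_integrand b a \<Lambda> (\<zeta> n) (\<psi> n) \<gamma> r) \<longlonglongrightarrow> mp_integrand b a \<Lambda> \<xi> \<phi> \<gamma> r"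
          using 2 t by (intro mp_integrand_tendsto) auto
        ultimately show ?thesis using 2 by (auto intro: Lim_transform_eventually)
      next
        case 3
        have "\<forall>\<^sub>F n in sequentially. u n < r" using order_tendstoD(2)[OF u(2) 3] .
        then have "\<forall>\<^sub>F n in sequentially. indicator {0..u n} r *\<^sub>R mp_integrand b a \<Lambda> (\<zeta> n) (\<psi> n) \<gamma> r = 0"
          by eventually_elim auto
        then show ?thesis using 3 by (auto intro: tendsto_eventually)
      qed auto
    qed
  qed
  ultimately show ?thesis
    unfolding mp_process_eq by (intro tendsto_intros)
qed

lemma integrable_mp_process_bound:
  assumes \<Lambda>: "\<Lambda> \<in> finite_laws"
  shows "integrable \<Lambda> (\<lambda>\<gamma>. K * (1 + T + total_density \<Lambda> \<gamma>))"
proof -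
  interpret prob_space \<Lambda> using \<Lambda> by (auto simp: finite_laws_def borel_prob_def)
  show ?thesis
    by (intro integrable_mult_right Bochner_Integration.integrable_add integrable_total_density \<Lambda>) auto
qed

text \<open>The second dominated convergence, now over paths: membership in
  \<open>finite_laws\<close> makes the bound of \<open>mp_process_bound\<close> integrable, and
  almost every path has an integrable density.\<close>

lemma integral_mp_process_tendsto:
  assumes \<Lambda>: "\<Lambda> \<in> finite_laws" and A: "A \<in> sets \<Lambda>"
    and u: "\<And>n. u n \<in> {0..T}" "u \<longlonglongrightarrow> t" and t: "t \<in> {0..T}"
  shows "(\<lambda>n. LINT \<gamma>:A|\<Lambda>. mp_process b a \<Lambda> (\<zeta> n) (\<psi> n) (u n) \<gamma>) \<longlonglongrightarrow>
    (LINT \<gamma>:A|\<Lambda>. mp_process b a \<Lambda> \<xi> \<phi> t \<gamma>)"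
proof -
  have P: "\<Lambda> \<in> borel_prob (path_topology T)" using \<Lambda> by (simp add: finite_laws_def)
  obtain K where K: "0 \<le> K"
    "\<And>n t \<Lambda> \<gamma>. t \<in> {0..T} \<Longrightarrow> integrable lborel (\<lambda>r. indicator {0..T} r * mp_density b a \<Lambda> \<gamma> r) \<Longrightarrow>
      \<bar>mp_process b a \<Lambda> (\<zeta> n) (\<psi> n) t \<gamma>\<bar> \<le> K * (1 + T + total_density \<Lambda> \<gamma>)"
    using mp_process_bound by metis
  show ?thesis
    unfolding set_lebesgue_integral_def
  proof (rule integral_dominated_convergence[where w = "\<lambda>\<gamma>. K * (1 + T + total_density \<Lambda> \<gamma>)"])
    show "(\<lambda>\<gamma>. indicator A \<gamma> *\<^sub>R mp_process b a \<Lambda> \<xi> \<phi> t \<gamma>) \<in> borel_measurable \<Lambda>"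
      using measurable_mp_process_law[OF P t \<xi> \<phi>] A by measurable
    show "(\<lambda>\<gamma>. indicator A \<gamma> *\<^sub>R mp_process b a \<Lambda> (\<zeta> n) (\<psi> n) (u n) \<gamma>) \<in> borel_measurable \<Lambda>" for n
      using measurable_mp_process_law[OF P u(1)[of n] \<zeta> \<psi>] A by measurable
    show "integrable \<Lambda> (\<lambda>\<gamma>. K * (1 + T + total_density \<Lambda> \<gamma>))"
      by (rule integrable_mp_process_bound[OF \<Lambda>])
    show "AE \<gamma> in \<Lambda>. (\<lambda>n. indicator A \<gamma> *\<^sub>R mp_process b a \<Lambda> (\<zeta> n) (\<psi> n) (u n) \<gamma>)
        \<longlonglongrightarrow> indicator A \<gamma> *\<^sub>R mp_process b a \<Lambda> \<xi> \<phi> t \<gamma>"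
      using AE_integrable_density[OF \<Lambda>]
      by (rule AE_mp) (intro AE_I2 impI tendsto_scaleR tendsto_const mp_process_tendsto[OF P _ _ u t],
          auto simp: borel_probD(3)[OF P])
    show "AE \<gamma> in \<Lambda>. norm (indicator A \<gamma> *\<^sub>R mp_process b a \<Lambda> (\<zeta> n) (\<psi> n) (u n) \<gamma>)
        \<le> K * (1 + T + total_density \<Lambda> \<gamma>)" for n
      using AE_integrable_density[OF \<Lambda>]
    proof (rule AE_mp, intro AE_I2 impI)
      fix \<gamma> assume "integrable lborel (\<lambda>r. indicator {0..T} r * mp_density b a \<Lambda> \<gamma> r)"
      from K(2)[OF u(1)[of n] this, of n] K(1) T total_density_nonneg[of \<Lambda> \<gamma>]
      show "norm (indicator A \<gamma> *\<^sub>R mp_process b a \<Lambda> (\<zeta> n) (\<psi> n) (u n) \<gamma>)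
        \<le> K * (1 + T + total_density \<Lambda> \<gamma>)"
        by (auto simp: indicator_def)
    qed
  qed
qed

end

context mp_coefficients
begin

lemma integrable_mp_process:
  assumes \<Lambda>: "\<Lambda> \<in> finite_laws" and t: "t \<in> {0..T}"
    and \<xi>: "\<xi> \<in> C1_compact_supp T" and \<phi>: "\<phi> \<in> C2_compact_supp"
  shows "integrable \<Lambda> (mp_process b a \<Lambda> \<xi> \<phi> t)"
proof -
  have P: "\<Lambda> \<in> borel_prob (path_topology T)" using \<Lambda> by (simp add: finite_laws_def)
  obtain N :: nat where N: "\<forall>x. real N < norm x \<longrightarrow> \<phi> x = 0"
    using C2_compact_supp_bounded_support[OF \<phi>] by blast
  \<comment> \<open>Constant sequences turn the uniform bound into one for this single pair.\<close>
  interpret test_function_approximation T b a "\<lambda>_. \<xi>" \<xi> "\<lambda>_. \<phi>" \<phi> "real N"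
    by unfold_locales (use \<xi> \<phi> N in \<open>auto simp: uniform_limit_const\<close>)
  obtain K where K: "0 \<le> K"
    "\<And>n t \<Lambda> \<gamma>. t \<in> {0..T} \<Longrightarrow> integrable lborel (\<lambda>r. indicator {0..T} r * mp_density b a \<Lambda> \<gamma> r) \<Longrightarrow>
      \<bar>mp_process b a \<Lambda> \<xi> \<phi> t \<gamma>\<bar> \<le> K * (1 + T + total_density \<Lambda> \<gamma>)"
    using mp_process_bound by metis
  show ?thesis
  proof (rule Bochner_Integration.integrable_bound[OF integrable_mp_process_bound[OF \<Lambda>, of K]])
    show "mp_process b a \<Lambda> \<xi> \<phi> t \<in> borel_measurable \<Lambda>"
      by (rule measurable_mp_process_law[OF P t \<xi> \<phi>])
    show "AE \<gamma> in \<Lambda>. norm (mp_process b a \<Lambda> \<xi> \<phi> t \<gamma>) \<le> norm (K * (1 + T + total_density \<Lambda> \<gamma>))"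
      using AE_integrable_density[OF \<Lambda>] by (rule AE_mp) (intro AE_I2 impI, unfold real_norm_def, rule order_trans[OF K(2)[OF t] abs_ge_self])
  qed
qed

end

section \<open>Countable reduction\<close>

text \<open>By continuity of paths. The approximating rational times must not exceed
  \<open>s\<close>, which may itself be irrational.\<close>

lemma path_filtration_rational_times:
  assumes r: "r \<in> {0..s}"
    and meas: "\<And>q. q \<in> \<rat> \<Longrightarrow> q \<in> {0..s} \<Longrightarrow> (\<lambda>\<gamma> :: real \<Rightarrow> real^'d. \<gamma> q) \<in> borel_measurable M"
    and sp: "space M = topspace (path_topology T)" and s: "s \<le> T"
  shows "(\<lambda>\<gamma> :: real \<Rightarrow> real^'d. \<gamma> r) \<in> borel_measurable M"
proof -
  have "\<exists>q. q \<in> \<rat> \<and> q \<in> {0..s} \<and> \<bar>q - r\<bar> < inverse (real (Suc n))" for n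
  \<comment> \<open>For \<open>s = 0\<close> the only time is 0, which is rational. Otherwise the
    open interval from 0 to \<open>s\<close> meets every neighbourhood of \<open>r\<close>, also
    when \<open>r\<close> is an endpoint.\<close>
  proof (cases "s = 0")
    case True
    then show ?thesis using r by (intro exI[of _ 0]) auto
  next
    case False
    have "0 < inverse (real (Suc n))" by simp
    then have "max 0 (r - inverse (real (Suc n))) < min s (r + inverse (real (Suc n)))"
      using r False unfolding max_less_iff_conj min_less_iff_conj atLeastAtMost_iff by linarith
    then obtain q where "q \<in> \<rat>" "max 0 (r - inverse (real (Suc n))) < q" "q < min s (r + inverse (real (Suc n)))"
      using Rats_dense_in_real by blast
    then show ?thesis by (intro exI[of _ q]) (auto simp: abs_less_iff)
  qed
  then obtain q where q: "\<And>n. q n \<in> \<rat>" "\<And>n. q n \<in> {0..s}" "\<And>n. \<bar>q n - r\<bar> < inverse (real (Suc n))"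
    by metis
  have "q \<longlonglongrightarrow> r"
  proof (rule LIMSEQ_I)
    fix e :: real assume "0 < e"
    then obtain N where N: "inverse (real (Suc N)) < e" using reals_Archimedean by blast
    have "norm (q n - r) < e" if "N \<le> n" for n
    proof -
      have "inverse (real (Suc n)) \<le> inverse (real (Suc N))" using that by simp
      with q(3)[of n] N show ?thesis unfolding real_norm_def by linarith
    qed
    then show "\<exists>N. \<forall>n\<ge>N. norm (q n - r) < e" by blast
  qed
  show ?thesis
  proof (rule borel_measurable_LIMSEQ_metric)
    show "(\<lambda>\<gamma>. \<gamma> (q n)) \<in> borel_measurable M" for n by (rule meas[OF q(1,2)])
    fix \<gamma> assume "\<gamma> \<in> space M"
    then have "continuous_on {0..T} \<gamma>" by (auto simp: sp intro: continuous_on_path)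
    moreover have "q n \<in> {0..T}" for n using q(2)[of n] s by auto
    moreover have "r \<in> {0..T}" using r s by auto
    ultimately show "(\<lambda>n. \<gamma> (q n)) \<longlonglongrightarrow> \<gamma> r"
      by (intro continuous_on_tendsto_compose[OF _ \<open>q \<longlonglongrightarrow> r\<close>] always_eventually allI)
  qed
qed

text \<open>The system consists of finite intersections of cylinders at rational times over a
  countable base. The empty intersection contributes the whole space, needed for complements in
  Dynkin's theorem.\<close>

lemma path_filtration_countable_pi_system:
  assumes "s \<le> T"
  shows "\<exists>G. countable G \<and> Int_stable G \<and> topspace (path_topology T) \<in> G \<and>
    G \<subseteq> sets (path_filtration T s :: (real \<Rightarrow> real^'d) measure) \<and>
    sets (path_filtration T s :: (real \<Rightarrow> real^'d) measure) = sigma_sets (topspace (path_topology T)) G"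
proof -
  let ?\<Omega> = "topspace (path_topology T) :: (real \<Rightarrow> real^'d) set"
  let ?F = "path_filtration T s :: (real \<Rightarrow> real^'d) measure"
  obtain \<B> :: "(real^'d) set set" where \<B>: "countable \<B>" "topological_basis \<B>"
    using ex_countable_basis by auto
  define E where "E = (\<lambda>(r, B). {\<gamma> \<in> ?\<Omega>. \<gamma> r \<in> B}) ` ((\<rat> \<inter> {0..s}) \<times> \<B>)"
  define G where "G = (\<lambda>\<A>. ?\<Omega> \<inter> \<Inter>\<A>) ` {\<A>. finite \<A> \<and> \<A> \<subseteq> E}"
  have "countable E"
    unfolding E_def using \<B>(1) by (intro countable_image countable_SIGMA countable_Int1 countable_rat)
  then have 1: "countable G"
    unfolding G_def by (intro countable_image countable_Collect_finite_subset)
  have 2: "Int_stable G"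
  proof (rule Int_stableI)
    fix U V assume "U \<in> G" "V \<in> G"
    then obtain \<A> \<A>' where "finite \<A>" "\<A> \<subseteq> E" "U = ?\<Omega> \<inter> \<Inter>\<A>" "finite \<A>'" "\<A>' \<subseteq> E" "V = ?\<Omega> \<inter> \<Inter>\<A>'"
      unfolding G_def by blast
    then show "U \<inter> V \<in> G"
      unfolding G_def by (intro image_eqI[of _ _ "\<A> \<union> \<A>'"]) auto
  qed
  have 3: "?\<Omega> \<in> G" unfolding G_def by (intro image_eqI[of _ _ "{}"]) auto
  have EF: "A \<in> sets ?F" if "A \<in> E" for A
  proof -
    obtain r B where rB: "r \<in> {0..s}" "B \<in> \<B>" "A = {\<gamma> \<in> ?\<Omega>. \<gamma> r \<in> B}"
      using \<open>A \<in> E\<close> by (auto simp: E_def)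
    then have "B \<in> sets borel" using topological_basis_open[OF \<B>(2)] by auto
    then show ?thesis unfolding sets_path_filtration using rB by (intro sigma_sets.Basic) auto
  qed
  have 4: "G \<subseteq> sets ?F"
  proof
    fix U assume "U \<in> G"
    then obtain \<A> where \<A>: "finite \<A>" "\<A> \<subseteq> E" "U = ?\<Omega> \<inter> \<Inter>\<A>"
      unfolding G_def by blast
    have "space ?F \<inter> \<Inter>\<A> \<in> sets ?F"
      using \<A>(1,2)
    proof (induction \<A> rule: finite_induct)
      case (insert A \<A>)
      have "space ?F \<inter> \<Inter>(insert A \<A>) = A \<inter> (space ?F \<inter> \<Inter>\<A>)" by auto
      then show ?case using insert EF by auto
    qed (use sets.top[of ?F] in simp)
    then show "U \<in> sets ?F" using \<A>(3) by simp
  qed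
  \<comment> \<open>In \<open>M\<close>, evaluations at rational times are measurable by
    construction and the remaining ones by continuity, so \<open>M\<close> contains the
    filtration.\<close>
  define M where "M = sigma ?\<Omega> G"
  have GP: "G \<subseteq> Pow ?\<Omega>" unfolding G_def by blast
  have M: "space M = ?\<Omega>" "sets M = sigma_sets ?\<Omega> G"
    unfolding M_def using GP by (auto simp: space_measure_of_conv)
  have EG: "E \<subseteq> G"
  proof
    fix A assume "A \<in> E"
    then show "A \<in> G" unfolding G_def by (intro image_eqI[of _ _ "{A}"]) (auto simp: E_def)
  qed
  have q: "(\<lambda>\<gamma>. \<gamma> q) \<in> borel_measurable M" if "q \<in> \<rat>" "q \<in> {0..s}" for q
    unfolding borel_eq_countable_basis[OF \<B>]
  proof (rule measurable_measure_of)
    fix B assume "B \<in> \<B>"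
    then have "{\<gamma> \<in> ?\<Omega>. \<gamma> q \<in> B} \<in> E"
      unfolding E_def using that by (intro image_eqI[of _ _ "(q, B)"]) auto
    then have "{\<gamma> \<in> ?\<Omega>. \<gamma> q \<in> B} \<in> G"
      using EG by blast
    moreover have "(\<lambda>\<gamma>. \<gamma> q) -` B \<inter> space M = {\<gamma> \<in> ?\<Omega>. \<gamma> q \<in> B}" by (auto simp: M)
    ultimately show "(\<lambda>\<gamma>. \<gamma> q) -` B \<inter> space M \<in> sets M" by (simp add: M)
  qed auto
  have "{\<gamma> \<in> ?\<Omega>. \<gamma> r \<in> B} \<in> sets M" if "r \<in> {0..s}" "B \<in> sets borel" for r B
  proof -
    have "(\<lambda>\<gamma>. \<gamma> r) \<in> borel_measurable M"
      by (rule path_filtration_rational_times[OF that(1) q M(1) assms])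
    from measurable_sets[OF this that(2)] show ?thesis
      by (simp add: M(1) vimage_def Int_def conj_commute)
  qed
  then have "sets ?F \<subseteq> sets M"
    unfolding sets_path_filtration
    by (intro sets.sigma_sets_subset') (use sets.top[of M] in \<open>auto simp: M(1)\<close>)
  moreover have "sets M \<subseteq> sets ?F"
    unfolding M(2) using 4 sets.top[of ?F] by (intro sets.sigma_sets_subset') auto
  ultimately show ?thesis using 1 2 3 4 M(2) by blast
qed

text \<open>Dynkin's theorem for signed integrands: complements are handled by subtracting from the
  integral over \<open>space M\<close>, disjoint unions by countable additivity, and both rely on
  integrability.\<close>

lemma set_integral_eq_sigma_sets:
  fixes f g :: "'a \<Rightarrow> real"
  assumes f: "integrable M f" and g: "integrable M g"
    and G: "Int_stable G" "space M \<in> G" "G \<subseteq> sets M"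
    and eq: "\<And>A. A \<in> G \<Longrightarrow> (LINT x:A|M. f x) = (LINT x:A|M. g x)"
    and A: "A \<in> sigma_sets (space M) G"
  shows "(LINT x:A|M. f x) = (LINT x:A|M. g x)"
proof -
  have sub: "sigma_sets (space M) G \<subseteq> sets M"
    by (rule sets.sigma_sets_subset[OF G(3)])
  have si: "set_integrable M B h" if "B \<in> sets M" "integrable M h" for B and h :: "'a \<Rightarrow> real"
    using integrable_mult_indicator[OF that] unfolding set_integrable_def .
  have GP: "G \<subseteq> Pow (space M)" using G(3) sets.sets_into_space by blast
  show ?thesis
    using G(1) GP A
  proof (induction rule: sigma_sets_induct_disjoint)
    case (basic A)
    then show ?case by (rule eq)
  next
    case empty
    show ?case by (simp add: set_lebesgue_integral_def)
  next
    case (compl A)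
    have A: "A \<in> sets M" using compl(1) sub by auto
    have *: "(LINT x:(space M - A)|M. h x) = (LINT x:space M|M. h x) - (LINT x:A|M. h x)"
      if "integrable M h" for h :: "'a \<Rightarrow> real"
    proof -
      have "(LINT x:(A \<union> (space M - A))|M. h x) = (LINT x:A|M. h x) + (LINT x:(space M - A)|M. h x)"
        using A that by (intro set_integral_Un si) auto
      moreover have "A \<union> (space M - A) = space M" using sets.sets_into_space[OF A] by auto
      ultimately show ?thesis by simp
    qed
    show ?case unfolding *[OF f] *[OF g] using compl(2) eq[OF G(2)] by simp
  next
    case (union A)
    have A: "\<And>i. A i \<in> sets M" using union(2) sub by blast
    have disj: "\<And>i j. i \<noteq> j \<Longrightarrow> A i \<inter> A j = {}" using union(1) by (auto simp: disjoint_family_on_def)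
    have U: "(\<Union>i. A i) \<in> sets M" using A by auto
    have "(LINT x:(\<Union>i. A i)|M. f x) = (\<Sum>i. LINT x:A i|M. f x)"
      by (rule lebesgue_integral_countable_add[OF A disj si[OF U f]])
    also have "\<dots> = (\<Sum>i. LINT x:A i|M. g x)"
      using union(3) by simp
    also have "\<dots> = (LINT x:(\<Union>i. A i)|M. g x)"
      by (rule lebesgue_integral_countable_add[OF A disj si[OF U g], symmetric])
    finally show ?case .
  qed
qed

section \<open>The martingale property through set integrals, and the Borel set of solutions\<close>

context mp_coefficients
begin

text \<open>On \<open>finite_laws\<close>, adaptedness and integrability hold automatically. What
  remains is the conditional expectation identity, which integrals over events of the past
  characterize.\<close>

lemma martingale_iff_set_integrals:
  assumes \<Lambda>: "\<Lambda> \<in> finite_laws" and \<xi>: "\<xi> \<in> C1_compact_supp T" and \<phi>: "\<phi> \<in> C2_compact_supp"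
  shows "martingale_on \<Lambda> {0..T} (path_filtration T) (mp_process b a \<Lambda> \<xi> \<phi>) \<longleftrightarrow>
    (\<forall>s\<in>{0..T}. \<forall>t\<in>{0..T}. s \<le> t \<longrightarrow> (\<forall>A\<in>sets (path_filtration T s).
      (LINT \<gamma>:A|\<Lambda>. mp_process b a \<Lambda> \<xi> \<phi> t \<gamma>) = (LINT \<gamma>:A|\<Lambda>. mp_process b a \<Lambda> \<xi> \<phi> s \<gamma>)))"
proof -
  let ?X = "mp_process b a \<Lambda> \<xi> \<phi>"
  have P: "\<Lambda> \<in> borel_prob (path_topology T)" using \<Lambda> by (simp add: finite_laws_def)
  interpret prob_space \<Lambda> using borel_probD[OF P] by simp
  have sub: "subalgebra \<Lambda> (path_filtration T t)" if "t \<in> {0..T}" for t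
    using sets_path_filtration_subset[of t T] that borel_probD[OF P] by (auto simp: subalgebra_def)
  have sf: "sigma_finite_subalgebra \<Lambda> (path_filtration T t)" if "t \<in> {0..T}" for t
    by (rule finite_measure_subalgebra_is_sigma_finite)
      (simp add: finite_measure_subalgebra_def finite_measure_subalgebra_axioms_def sub[OF that] finite_measure_axioms)
  have int: "integrable \<Lambda> (?X t)" if "t \<in> {0..T}" for t
    by (rule integrable_mp_process[OF \<Lambda> that \<xi> \<phi>])
  have adapted: "?X t \<in> borel_measurable (path_filtration T t)" if "t \<in> {0..T}" for t
    using measurable_Pair2[OF measurable_mp_process[OF _ _ \<xi> \<phi>, of t], of \<Lambda>] that P by simp
  have "(AE \<gamma> in \<Lambda>. real_cond_exp \<Lambda> (path_filtration T s) (?X t) \<gamma> = ?X s \<gamma>) \<longleftrightarrow>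
      (\<forall>A\<in>sets (path_filtration T s). (LINT \<gamma>:A|\<Lambda>. ?X t \<gamma>) = (LINT \<gamma>:A|\<Lambda>. ?X s \<gamma>))"
    if s: "s \<in> {0..T}" and t: "t \<in> {0..T}" for s t
  proof
    interpret S: sigma_finite_subalgebra \<Lambda> "path_filtration T s" by (rule sf[OF s])
    assume AE: "AE \<gamma> in \<Lambda>. real_cond_exp \<Lambda> (path_filtration T s) (?X t) \<gamma> = ?X s \<gamma>"
    show "\<forall>A\<in>sets (path_filtration T s). (LINT \<gamma>:A|\<Lambda>. ?X t \<gamma>) = (LINT \<gamma>:A|\<Lambda>. ?X s \<gamma>)"
    proof
      fix A :: "(real \<Rightarrow> real^'d) set" assume A: "A \<in> sets (path_filtration T s)"
      then have A': "A \<in> sets \<Lambda>" using sub[OF s] by (auto simp: subalgebra_def)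
      have "(LINT \<gamma>:A|\<Lambda>. ?X t \<gamma>) = (LINT \<gamma>:A|\<Lambda>. real_cond_exp \<Lambda> (path_filtration T s) (?X t) \<gamma>)"
        by (rule S.real_cond_exp_intA[OF int[OF t] A])
      also have "\<dots> = (LINT \<gamma>:A|\<Lambda>. ?X s \<gamma>)"
        unfolding set_lebesgue_integral_def
        using AE borel_measurable_integrable[OF int[OF s]] A'
        by (intro integral_cong_AE) (auto intro!: borel_measurable_scaleR borel_measurable_indicator)
      finally show "(LINT \<gamma>:A|\<Lambda>. ?X t \<gamma>) = (LINT \<gamma>:A|\<Lambda>. ?X s \<gamma>)" .
    qed
  next
    interpret S: sigma_finite_subalgebra \<Lambda> "path_filtration T s" by (rule sf[OF s])
    assume "\<forall>A\<in>sets (path_filtration T s). (LINT \<gamma>:A|\<Lambda>. ?X t \<gamma>) = (LINT \<gamma>:A|\<Lambda>. ?X s \<gamma>)"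
    then show "AE \<gamma> in \<Lambda>. real_cond_exp \<Lambda> (path_filtration T s) (?X t) \<gamma> = ?X s \<gamma>"
      by (intro S.real_cond_exp_charact int[OF t] int[OF s] adapted[OF s]) auto
  qed
  then show ?thesis
    unfolding martingale_on_def using sub int adapted by (simp add: sets_path_filtration_mono)
qed

text \<open>Events are extended first, at fixed rational times and for test functions from the
  countable families. Only then do times and test functions pass to the limit together, with the
  event \<open>A\<close> held fixed.\<close>

lemma set_integrals_from_countable:
  assumes \<Lambda>: "\<Lambda> \<in> finite_laws"
    and D1: "D1 \<subseteq> C1_compact_supp T" "\<forall>\<xi>\<in>C1_compact_supp T. \<exists>\<zeta>. range \<zeta> \<subseteq> D1 \<and>
      uniform_limit {0..T} \<zeta> \<xi> sequentially \<and>
      uniform_limit {0..T} (\<lambda>n. deriv (\<zeta> n)) (deriv \<xi>) sequentially"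
    and D2: "D2 \<subseteq> C2_compact_supp" "\<forall>\<phi>\<in>C2_compact_supp. \<exists>\<psi> R. range \<psi> \<subseteq> D2 \<and> 0 \<le> R \<and>
      (\<forall>x. R < norm x \<longrightarrow> \<phi> x = 0) \<and> (\<forall>n x. R < norm x \<longrightarrow> \<psi> n x = 0) \<and>
      uniform_limit UNIV \<psi> \<phi> sequentially \<and>
      uniform_limit UNIV (\<lambda>n. grad (\<psi> n)) (grad \<phi>) sequentially \<and>
      uniform_limit UNIV (\<lambda>n. hess (\<psi> n)) (hess \<phi>) sequentially"
    and G: "\<And>s. s \<le> T \<Longrightarrow> Int_stable (G s) \<and> topspace (path_topology T) \<in> G s \<and>
      G s \<subseteq> sets (path_filtration T s) \<and>
      sets (path_filtration T s) = sigma_sets (topspace (path_topology T)) (G s)"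
    and eq: "\<And>\<xi> \<phi> s t A. \<xi> \<in> D1 \<Longrightarrow> \<phi> \<in> D2 \<Longrightarrow> s \<in> \<rat> \<Longrightarrow> t \<in> \<rat> \<Longrightarrow> 0 \<le> s \<Longrightarrow> s \<le> t \<Longrightarrow> t \<le> T \<Longrightarrow> A \<in> G s \<Longrightarrow>
      (LINT \<gamma>:A|\<Lambda>. mp_process b a \<Lambda> \<xi> \<phi> t \<gamma>) = (LINT \<gamma>:A|\<Lambda>. mp_process b a \<Lambda> \<xi> \<phi> s \<gamma>)"
    and \<xi>: "\<xi> \<in> C1_compact_supp T" and \<phi>: "\<phi> \<in> C2_compact_supp"
    and st: "0 \<le> s" "s \<le> t" "t \<le> T" and A: "A \<in> sets (path_filtration T s)"
  shows "(LINT \<gamma>:A|\<Lambda>. mp_process b a \<Lambda> \<xi> \<phi> t \<gamma>) = (LINT \<gamma>:A|\<Lambda>. mp_process b a \<Lambda> \<xi> \<phi> s \<gamma>)"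
proof (cases "s = t")
  case False
  then have "s < t" using st by simp
  have P: "\<Lambda> \<in> borel_prob (path_topology T)" using \<Lambda> by (simp add: finite_laws_def)
  \<comment> \<open>Equality on the \<pi>-system \<open>G s\<close> spreads to the whole
    \<sigma>-algebra at time \<open>s\<close>.\<close>
  have rational: "(LINT \<gamma>:A|\<Lambda>. mp_process b a \<Lambda> \<xi> \<phi> t \<gamma>) = (LINT \<gamma>:A|\<Lambda>. mp_process b a \<Lambda> \<xi> \<phi> s \<gamma>)"
    if D: "\<xi> \<in> D1" "\<phi> \<in> D2" and q: "s \<in> \<rat>" "t \<in> \<rat>" "0 \<le> s" "s \<le> t" "t \<le> T"
      and A: "A \<in> sets (path_filtration T s)" for \<xi> \<phi> s t A
  proof (rule set_integral_eq_sigma_sets[where G = "G s"])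
    have "s \<le> T" using q by simp
    note Gs = G[OF this]
    show "integrable \<Lambda> (mp_process b a \<Lambda> \<xi> \<phi> t)" "integrable \<Lambda> (mp_process b a \<Lambda> \<xi> \<phi> s)"
      using D D1(1) D2(1) q by (auto intro!: integrable_mp_process[OF \<Lambda>])
    show "G s \<subseteq> sets \<Lambda>"
      using Gs sets_path_filtration_subset[OF \<open>s \<le> T\<close>] borel_probD(2)[OF P] by blast
    show "(LINT \<gamma>:B|\<Lambda>. mp_process b a \<Lambda> \<xi> \<phi> t \<gamma>) = (LINT \<gamma>:B|\<Lambda>. mp_process b a \<Lambda> \<xi> \<phi> s \<gamma>)" if "B \<in> G s" for B
      by (rule eq[OF D q that])
  qed (use G[of s] q A borel_probD(3)[OF P] in auto)
  obtain \<zeta> where \<zeta>: "range \<zeta> \<subseteq> D1" "uniform_limit {0..T} \<zeta> \<xi> sequentially"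
      "uniform_limit {0..T} (\<lambda>n. deriv (\<zeta> n)) (deriv \<xi>) sequentially"
    using bspec[OF D1(2) \<xi>] by (elim exE conjE)
  obtain \<psi> R where \<psi>: "range \<psi> \<subseteq> D2" "0 \<le> R"
      "\<forall>x. R < norm x \<longrightarrow> \<phi> x = 0" "\<forall>n x. R < norm x \<longrightarrow> \<psi> n x = 0"
      "uniform_limit UNIV \<psi> \<phi> sequentially"
      "uniform_limit UNIV (\<lambda>n. grad (\<psi> n)) (grad \<phi>) sequentially"
      "uniform_limit UNIV (\<lambda>n. hess (\<psi> n)) (hess \<phi>) sequentially"
    using bspec[OF D2(2) \<phi>] by (elim exE conjE)
  have in_D: "\<zeta> n \<in> D1" "\<psi> n \<in> D2" for n
    using \<zeta>(1) \<psi>(1) by auto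
  interpret test_function_approximation T b a \<zeta> \<xi> \<psi> \<phi> R
    by unfold_locales (use \<zeta> \<psi> D1(1) D2(1) \<xi> \<phi> in \<open>auto simp: image_subset_iff subset_iff\<close>)
  \<comment> \<open>The midpoint keeps the rational times apart: \<open>u n\<close> decreases
    towards \<open>s\<close> below \<open>m\<close>, \<open>v n\<close> approaches \<open>t\<close>
    from below and stays above \<open>m\<close>. Since \<open>s < u n\<close>, the event
    \<open>A\<close> is known at time \<open>u n\<close>; since \<open>v n < t\<close>, the horizon
    \<open>T\<close> is respected.\<close>
  define m where "m = (s + t) / 2"
  have m: "s < m" "m < t" using \<open>s < t\<close> by (auto simp: m_def)
  have "\<exists>q. q \<in> \<rat> \<and> s < q \<and> q < s + (m - s) * inverse (real (Suc n))" for n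
    using Rats_dense_in_real[of s "s + (m - s) * inverse (real (Suc n))"] m by auto
  then obtain u where u: "\<And>n. u n \<in> \<rat>" "\<And>n. s < u n" "\<And>n. u n < s + (m - s) * inverse (real (Suc n))"
    by metis
  have "\<exists>q. q \<in> \<rat> \<and> t - (t - m) * inverse (real (Suc n)) < q \<and> q < t" for n
    using Rats_dense_in_real[of "t - (t - m) * inverse (real (Suc n))" t] m by auto
  then obtain v where v: "\<And>n. v n \<in> \<rat>" "\<And>n. t - (t - m) * inverse (real (Suc n)) < v n" "\<And>n. v n < t"
    by metis
  have u_lim: "u \<longlonglongrightarrow> s"
  proof (rule tendsto_sandwich[of "\<lambda>_. s" _ _ "\<lambda>n. s + (m - s) * inverse (real (Suc n))"])
    have "(\<lambda>n. s + (m - s) * inverse (real (Suc n))) \<longlonglongrightarrow> s + (m - s) * 0"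
      by (intro tendsto_intros LIMSEQ_inverse_real_of_nat)
    then show "(\<lambda>n. s + (m - s) * inverse (real (Suc n))) \<longlonglongrightarrow> s" by simp
  qed (auto intro!: always_eventually less_imp_le[OF u(2)] less_imp_le[OF u(3)] simp del: of_nat_Suc)
  have v_lim: "v \<longlonglongrightarrow> t"
  proof (rule tendsto_sandwich[of "\<lambda>n. t - (t - m) * inverse (real (Suc n))" _ _ "\<lambda>_. t"])
    have "(\<lambda>n. t - (t - m) * inverse (real (Suc n))) \<longlonglongrightarrow> t - (t - m) * 0"
      by (intro tendsto_intros LIMSEQ_inverse_real_of_nat)
    then show "(\<lambda>n. t - (t - m) * inverse (real (Suc n))) \<longlonglongrightarrow> t" by simp
  qed (auto intro!: always_eventually less_imp_le[OF v(2)] less_imp_le[OF v(3)] simp del: of_nat_Suc)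
  have inv: "0 \<le> inverse (real (Suc n))" "inverse (real (Suc n)) \<le> 1" for n
    by (auto simp: inverse_le_1_iff)
  have um: "u n < m" and vm: "m < v n" for n
    using u(3)[of n] v(2)[of n] mult_left_le[OF inv(2)[of n], of "m - s"]
      mult_left_le[OF inv(2)[of n], of "t - m"] m by linarith+
  have uT: "u n \<in> {0..T}" and vT: "v n \<in> {0..T}" for n
    using u(2)[of n] um[of n] v(3)[of n] vm[of n] st m by auto
  have A': "A \<in> sets \<Lambda>"
    using A sets_path_filtration_subset[of s T] st borel_probD(2)[OF P] by auto
  have "(LINT \<gamma>:A|\<Lambda>. mp_process b a \<Lambda> (\<zeta> n) (\<psi> n) (v n) \<gamma>) =
      (LINT \<gamma>:A|\<Lambda>. mp_process b a \<Lambda> (\<zeta> n) (\<psi> n) (u n) \<gamma>)" for n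
  proof (rule rational)
    show "A \<in> sets (path_filtration T (u n))"
      using A sets_path_filtration_mono[of s "u n" T] u(2)[of n] by auto
    show "u n \<le> v n" using um[of n] vm[of n] by simp
  qed (use in_D u(1) v(1) uT[of n] vT[of n] in auto)
  moreover have "(\<lambda>n. LINT \<gamma>:A|\<Lambda>. mp_process b a \<Lambda> (\<zeta> n) (\<psi> n) (v n) \<gamma>) \<longlonglongrightarrow>
      (LINT \<gamma>:A|\<Lambda>. mp_process b a \<Lambda> \<xi> \<phi> t \<gamma>)"
    using st by (intro integral_mp_process_tendsto \<Lambda> A' vT v_lim) auto
  moreover have "(\<lambda>n. LINT \<gamma>:A|\<Lambda>. mp_process b a \<Lambda> (\<zeta> n) (\<psi> n) (u n) \<gamma>) \<longlonglongrightarrow>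
      (LINT \<gamma>:A|\<Lambda>. mp_process b a \<Lambda> \<xi> \<phi> s \<gamma>)"
    using st by (intro integral_mp_process_tendsto \<Lambda> A' uT u_lim) auto
  ultimately show ?thesis
    by (simp add: LIMSEQ_unique)
qed simp

lemma measurable_set_integral_mp_process:
  assumes A: "A \<in> sets (path_borel T)" and t: "0 \<le> t" "t \<le> T"
    and \<xi>: "\<xi> \<in> C1_compact_supp T" and \<phi>: "\<phi> \<in> C2_compact_supp"
  shows "(\<lambda>\<Lambda>. LINT \<gamma>:A|\<Lambda>. mp_process b a \<Lambda> \<xi> \<phi> t \<gamma>) \<in> borel_measurable (law_borel T)"
  unfolding set_lebesgue_integral_def
proof (rule integral_measurable_subprob_algebra2)
  note [measurable] = measurable_from_path_filtration[OF measurable_mp_process[OF t \<xi> \<phi>] t(2)] A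
  show "(\<lambda>(\<Lambda>, \<gamma>). indicator A \<gamma> *\<^sub>R mp_process b a \<Lambda> \<xi> \<phi> t \<gamma>) \<in>
      borel_measurable (law_borel T \<Otimes>\<^sub>M path_borel T)"
    by measurable
  show "(\<lambda>\<Lambda>. \<Lambda>) \<in> law_borel T \<rightarrow>\<^sub>M subprob_algebra (path_borel T)"
    by (rule narrow_measurable_subprob_algebra[OF metrizable_path_topology])
qed

lemma sets_MP: "MP T b a \<in> sets (law_borel T)"
proof -
  obtain D1 where D1: "countable D1" "D1 \<subseteq> C1_compact_supp T" "\<forall>\<xi>\<in>C1_compact_supp T. \<exists>\<zeta>. range \<zeta> \<subseteq> D1 \<and>
      uniform_limit {0..T} \<zeta> \<xi> sequentially \<and>
      uniform_limit {0..T} (\<lambda>n. deriv (\<zeta> n)) (deriv \<xi>) sequentially"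
    using C1_compact_supp_separable[of T] by (elim exE conjE)
  obtain D2 :: "(real^'d \<Rightarrow> real) set" where D2: "countable D2" "D2 \<subseteq> C2_compact_supp"
      "\<forall>\<phi>\<in>C2_compact_supp. \<exists>\<psi> R. range \<psi> \<subseteq> D2 \<and> 0 \<le> R \<and>
      (\<forall>x. R < norm x \<longrightarrow> \<phi> x = 0) \<and> (\<forall>n x. R < norm x \<longrightarrow> \<psi> n x = 0) \<and>
      uniform_limit UNIV \<psi> \<phi> sequentially \<and>
      uniform_limit UNIV (\<lambda>n. grad (\<psi> n)) (grad \<phi>) sequentially \<and>
      uniform_limit UNIV (\<lambda>n. hess (\<psi> n)) (hess \<phi>) sequentially"
    using C2_compact_supp_separable by (elim exE conjE)
  have "\<forall>s. \<exists>G. s \<le> T \<longrightarrow> countable G \<and> Int_stable G \<and> topspace (path_topology T) \<in> G \<and>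
    G \<subseteq> sets (path_filtration T s :: (real \<Rightarrow> real^'d) measure) \<and>
    sets (path_filtration T s :: (real \<Rightarrow> real^'d) measure) = sigma_sets (topspace (path_topology T)) G"
    using path_filtration_countable_pi_system[of _ T] by blast
  from choice[OF this] obtain G where G: "\<And>s. s \<le> T \<Longrightarrow> countable (G s) \<and> Int_stable (G s) \<and> topspace (path_topology T) \<in> G s \<and>
    G s \<subseteq> sets (path_filtration T s :: (real \<Rightarrow> real^'d) measure) \<and>
    sets (path_filtration T s :: (real \<Rightarrow> real^'d) measure) = sigma_sets (topspace (path_topology T)) (G s)"
    by blast
  define Q where "Q = {(s, t). s \<in> \<rat> \<and> t \<in> \<rat> \<and> 0 \<le> s \<and> s \<le> t \<and> t \<le> T}"
  define I where "I = (SIGMA \<xi>:D1. SIGMA \<phi>:D2. SIGMA q:Q. G (fst q))"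
  \<comment> \<open>Violations are collected over all laws and not only over
    \<open>finite_laws\<close>: the Bochner integrals are measurable in the law everywhere, with
    value 0 where the process is not integrable. The difference taken below discards the laws
    outside.\<close>
  define N where "N = (\<lambda>(\<xi>, \<phi>, (s, t), A). {\<Lambda> \<in> space (law_borel T).
    (LINT \<gamma>:A|\<Lambda>. mp_process b a \<Lambda> \<xi> \<phi> t \<gamma>) \<noteq> (LINT \<gamma>:A|\<Lambda>. mp_process b a \<Lambda> \<xi> \<phi> s \<gamma>)})"
  have "countable Q"
    by (rule countable_subset[of _ "\<rat> \<times> \<rat>"]) (auto simp: Q_def countable_rat)
  then have "countable I"
    unfolding I_def using D1(1) D2(1) G by (intro countable_SIGMA) (auto simp: Q_def)
  have N: "N i \<in> sets (law_borel T)" if "i \<in> I" for i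
  proof -
    obtain \<xi> \<phi> s t A where i: "i = (\<xi>, \<phi>, (s, t), A)" and D: "\<xi> \<in> C1_compact_supp T" "\<phi> \<in> C2_compact_supp"
      and st: "0 \<le> s" "s \<le> t" "t \<le> T" and "A \<in> G s"
      using \<open>i \<in> I\<close> D1(2) D2(2) unfolding I_def Q_def by (cases i) fastforce
    have "A \<in> sets (path_borel T)"
      using \<open>A \<in> G s\<close> G[of s] st sets_path_filtration_subset[of s T] by auto
    then have [measurable]: "(\<lambda>\<Lambda>. LINT \<gamma>:A|\<Lambda>. mp_process b a \<Lambda> \<xi> \<phi> t \<gamma>) \<in> borel_measurable (law_borel T)"
      "(\<lambda>\<Lambda>. LINT \<gamma>:A|\<Lambda>. mp_process b a \<Lambda> \<xi> \<phi> s \<gamma>) \<in> borel_measurable (law_borel T)"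
      using st by (auto intro!: measurable_set_integral_mp_process D)
    show ?thesis unfolding i N_def prod.case by measurable
  qed
  have MP_eq: "MP T b a = {\<Lambda> \<in> finite_laws. \<forall>\<xi>\<in>C1_compact_supp T. \<forall>\<phi>\<in>C2_compact_supp.
      martingale_on \<Lambda> {0..T} (path_filtration T) (mp_process b a \<Lambda> \<xi> \<phi>)}"
    unfolding MP_def finite_laws_def mp_density_def by auto
  have "MP T b a = finite_laws - (\<Union>i\<in>I. N i)"
  proof (intro set_eqI iffI)
    fix \<Lambda> assume "\<Lambda> \<in> MP T b a"
    then have \<Lambda>: "\<Lambda> \<in> finite_laws" and mart: "\<And>\<xi> \<phi>. \<xi> \<in> C1_compact_supp T \<Longrightarrow> \<phi> \<in> C2_compact_supp \<Longrightarrow>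
        martingale_on \<Lambda> {0..T} (path_filtration T) (mp_process b a \<Lambda> \<xi> \<phi>)"
      by (auto simp: MP_eq)
    have "\<Lambda> \<notin> N i" if "i \<in> I" for i
    proof -
      obtain \<xi> \<phi> s t A where i: "i = (\<xi>, \<phi>, (s, t), A)" and D: "\<xi> \<in> C1_compact_supp T" "\<phi> \<in> C2_compact_supp"
        and st: "0 \<le> s" "s \<le> t" "t \<le> T" and "A \<in> G s"
        using \<open>i \<in> I\<close> D1(2) D2(2) unfolding I_def Q_def by (cases i) fastforce
      have "A \<in> sets (path_filtration T s)" using \<open>A \<in> G s\<close> G[of s] st by auto
      then show ?thesis
        using mart[OF D] st unfolding martingale_iff_set_integrals[OF \<Lambda> D] i N_def by auto
    qed
    with \<Lambda> show "\<Lambda> \<in> finite_laws - (\<Union>i\<in>I. N i)" by blast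
  next
    fix \<Lambda> assume asm: "\<Lambda> \<in> finite_laws - (\<Union>i\<in>I. N i)"
    then have \<Lambda>: "\<Lambda> \<in> finite_laws" by simp
    then have sp: "\<Lambda> \<in> space (law_borel T)" by (simp add: finite_laws_def)
    have eq: "(LINT \<gamma>:A|\<Lambda>. mp_process b a \<Lambda> \<xi> \<phi> t \<gamma>) = (LINT \<gamma>:A|\<Lambda>. mp_process b a \<Lambda> \<xi> \<phi> s \<gamma>)"
      if "\<xi> \<in> D1" "\<phi> \<in> D2" "s \<in> \<rat>" "t \<in> \<rat>" "0 \<le> s" "s \<le> t" "t \<le> T" "A \<in> G s" for \<xi> \<phi> s t A
    proof -
      have "(\<xi>, \<phi>, (s, t), A) \<in> I" using that by (simp add: I_def Q_def)
      then have "\<Lambda> \<notin> N (\<xi>, \<phi>, (s, t), A)" using asm by blast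
      then show ?thesis using sp by (simp add: N_def)
    qed
    have G': "\<And>s. s \<le> T \<Longrightarrow> Int_stable (G s) \<and> topspace (path_topology T) \<in> G s \<and>
      G s \<subseteq> sets (path_filtration T s) \<and>
      sets (path_filtration T s) = sigma_sets (topspace (path_topology T)) (G s)"
      using G by blast
    have "martingale_on \<Lambda> {0..T} (path_filtration T) (mp_process b a \<Lambda> \<xi> \<phi>)"
      if D: "\<xi> \<in> C1_compact_supp T" "\<phi> \<in> C2_compact_supp" for \<xi> \<phi>
      unfolding martingale_iff_set_integrals[OF \<Lambda> D]
    proof (intro ballI impI)
      fix s t and A :: "(real \<Rightarrow> real^'d) set" assume "s \<in> {0..T}" "t \<in> {0..T}" "s \<le> t" "A \<in> sets (path_filtration T s)"
      then show "(LINT \<gamma>:A|\<Lambda>. mp_process b a \<Lambda> \<xi> \<phi> t \<gamma>) = (LINT \<gamma>:A|\<Lambda>. mp_process b a \<Lambda> \<xi> \<phi> s \<gamma>)"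
        by (intro set_integrals_from_countable[OF \<Lambda> D1(2,3) D2(2,3) G' eq D]) auto
    qed
    then show "\<Lambda> \<in> MP T b a" using \<Lambda> by (auto simp: MP_eq)
  qed
  also have "\<dots> \<in> sets (law_borel T)"
    by (intro sets.Diff sets_finite_laws sets.countable_UN'' \<open>countable I\<close> N)
  finally show ?thesis .
qed

end

theorem proposition4p10:
  fixes T :: real
    and b :: "real \<Rightarrow> real^'d \<Rightarrow> (real^'d) measure \<Rightarrow> real^'d"
    and a :: "real \<Rightarrow> real^'d \<Rightarrow> (real^'d) measure \<Rightarrow> real^'d^'d"
  assumes "0 < T"
    and "(\<lambda>(t, x, \<mu>). b t x \<mu>) \<in>
      borel_of (prod_topology (top_of_set {0..T}) (prod_topology euclidean (narrow_topology euclidean)))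
        \<rightarrow>\<^sub>M borel"
    and "(\<lambda>(t, x, \<mu>). a t x \<mu>) \<in>
      borel_of (prod_topology (top_of_set {0..T}) (prod_topology euclidean (narrow_topology euclidean)))
        \<rightarrow>\<^sub>M restrict_space borel Sym_plus"
  shows "MP T b a \<in> sets (borel_of (narrow_topology (path_topology T)))"
proof -
  interpret mp_coefficients T b a
    by unfold_locales (use assms in \<open>auto simp: measurable_restrict_space2_iff\<close>)
  show ?thesis by (rule sets_MP)
qed

end
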